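(* Let $s>0$, $P_0>0$, $\rho_n\asymp n^{-\frac{4s}{1+4s}}$ and $V_n=\{f:\ \|f\|^2\ge\rho_n,\ f\in\bar{\mathbb B}^s_{2\infty}(P_0)\}$. Let $0<\alpha<1$ and suppose $$0<\liminf_{n\to\infty}A_n\le\limsup_{n\to\infty}A_n<\infty .$$ Then the tests $L_n^a$ with critical regions $S_n^a=\{y:\ (T_n^a(Y_n)-C_n)(2A_n)^{-1/2}>x_\alpha\}$ are asymptotically minimax for testing $H_0:f=0$ versus $f\in V_n$, with $\alpha(L_n^a)=\alpha(1+o(1))$ and $$\beta(L_n^a,V_n)=\Phi\bigl(x_\alpha-(A_n/2)^{1/2}\bigr)(1+o(1))\quad\text{as }n\to\infty.$$
   Context: Model: one observes $dY_n(t)=f(t)dt+\frac{\sigma}{\sqrt n}dw(t)$, $t\in[0,1]$, $\sigma>0$, with unknown $f\in\mathbb L_2(0,1)$ and Gaussian white noise $dw$; $\|\cdot\|$ is the $\mathbb L_2(0,1)$ norm. In an orthonormal basis $\phi_j$: $y_j=\int\phi_jdY_n=\theta_j+\frac{\sigma}{\sqrt n}\xi_j$, $1\le j<\infty$, $\theta_j=\int f\phi_j$, $\xi_j$ i.i.d. $N(0,1)$, $y=\{y_j\}$. $\bar{\mathbb B}^s_{2\infty}(P_0)=\{f=\sum_{j\ge1}\theta_j\phi_j:\sup_{\lambda>0}\lambda^{2s}\sum_{j>\lambda}\theta_j^2<P_0\}$. $a_n\asymp b_n$ means $ca_n\le b_n\le Ca_n$ for all $n$ with constants $0<c\le C$.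 Define $k_n$ and $\kappa_n^2$ as the solution of the two equations $\frac1{2s}k_n^{1+2s}\kappa_n^2=P_0$ and $k_n\kappa_n^2+k_n^{-2s}P_0=\rho_n$. Put $\kappa_j^2=\kappa_n^2$ for $1\le j\le k_n$ and $\kappa_j^2=2sP_0j^{-2s-1}$ for $j>k_n$. Define $T_n^a(Y_n)=\sigma^{-4}n^2\sum_{j=1}^\infty\kappa_j^2y_j^2$, $A_n=\sigma^{-4}n^2\sum_{j=1}^\infty\kappa_j^4$, $C_n=\sigma^{-2}n\rho_n$. $\Phi$ is the standard normal distribution function and $x_\alpha$ is defined by $\alpha=1-\Phi(x_\alpha)$. For a test $K_n$, $\alpha(K_n)$ is the type I error probability, $\beta(K_n,f)$ the type II error probability at $f$, $\beta(K_n,V_n)=\sup_{f\in V_n}\beta(K_n,f)$. Tests $L_n$ with $\alpha(L_n)=\alpha(1+o(1))$ are asymptotically minimax for $V_n$ if for any sequence of tests $K_n$ with $\alpha(K_n)\le\alpha$, $\liminf_{n\to\infty}(\beta(K_n,V_n)-\beta(L_n,V_n))\ge0$. *)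

theory Defs
  imports "HOL-Probability.Probability" "HOL-Library.Landau_Symbols"
begin

section \<open>The space of square-integrable functions on the unit interval\<close>

text \<open>Elements are functions rather than equivalence classes; everything below depends on them only
  up to null sets (almost surely, in the case of the white noise).\<close>

definition Ltwo :: "(real \<Rightarrow> real) set" where
  "Ltwo = {f. f \<in> borel_measurable (lebesgue_on {0<..<1}) \<and>
              integrable (lebesgue_on {0<..<1}) (\<lambda>t. (f t)\<^sup>2)}"

definition ip :: "(real \<Rightarrow> real) \<Rightarrow> (real \<Rightarrow> real) \<Rightarrow> real" where
  "ip f g = (\<integral>t. f t * g t \<partial>lebesgue_on {0<..<1})"

definition Lnorm :: "(real \<Rightarrow> real) \<Rightarrow> real" where
  "Lnorm f = sqrt (\<integral>t. (f t)\<^sup>2 \<partial>lebesgue_on {0<..<1})"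

definition orthonormal_family :: "nat set \<Rightarrow> (nat \<Rightarrow> real \<Rightarrow> real) \<Rightarrow> bool" where
  "orthonormal_family I g \<longleftrightarrow>
     (\<forall>i\<in>I. g i \<in> Ltwo) \<and> (\<forall>i\<in>I. \<forall>j\<in>I. ip (g i) (g j) = (if i = j then 1 else 0))"

text \<open>A basis is indexed by the positive integers; the value at index \<open>0\<close> is never used.\<close>

definition orthonormal_basis :: "(nat \<Rightarrow> real \<Rightarrow> real) \<Rightarrow> bool" where
  "orthonormal_basis \<phi> \<longleftrightarrow> orthonormal_family {1..} \<phi> \<and>
     (\<forall>f\<in>Ltwo. (\<lambda>N. Lnorm (\<lambda>t. f t - (\<Sum>j=1..N. ip f (\<phi> j) * \<phi> j t))) \<longlonglongrightarrow> 0)"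


section \<open>Observations in Gaussian white noise\<close>

text \<open>\<open>w g\<close> stands for the stochastic integral of \<open>g\<close> against \<open>dw\<close>: it is almost surely linear in
  \<open>g\<close> and maps every (finite or infinite) orthonormal family to i.i.d. standard normal variables.\<close>

definition white_noise :: "'w measure \<Rightarrow> ((real \<Rightarrow> real) \<Rightarrow> 'w \<Rightarrow> real) \<Rightarrow> bool" where
  "white_noise M w \<longleftrightarrow>
     prob_space M \<and>
     (\<forall>g\<in>Ltwo. w g \<in> borel_measurable M) \<and>
     (\<forall>g\<in>Ltwo. \<forall>h\<in>Ltwo. \<forall>a b.
        AE \<omega> in M. w (\<lambda>t. a * g t + b * h t) \<omega> = a * w g \<omega> + b * w h \<omega>) \<and>
     (\<forall>I g. orthonormal_family I g \<longrightarrow>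
        prob_space.indep_vars M (\<lambda>_. borel) (\<lambda>i. w (g i)) I \<and>
        (\<forall>i\<in>I. distributed M lborel (w (g i)) std_normal_density))"

text \<open>The observation of \<open>dY(t) = f(t) dt + \<sigma> n\<^sup>-\<^sup>1\<^sup>/\<^sup>2 dw(t)\<close> is the family of all integrals of
  functions \<open>g\<close> in \<open>Ltwo\<close> against \<open>dY\<close>.\<close>

type_synonym observation = "(real \<Rightarrow> real) \<Rightarrow> real"

definition obs_space :: "observation measure" where
  "obs_space = Pi\<^sub>M Ltwo (\<lambda>_. borel)"

definition obs ::
  "((real \<Rightarrow> real) \<Rightarrow> 'w \<Rightarrow> real) \<Rightarrow> real \<Rightarrow> nat \<Rightarrow> (real \<Rightarrow> real) \<Rightarrow> 'w \<Rightarrow> observation" where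
  "obs w \<sigma> n f \<omega> = (\<lambda>g\<in>Ltwo. ip f g + \<sigma> / sqrt (real n) * w g \<omega>)"

definition coords :: "(nat \<Rightarrow> real \<Rightarrow> real) \<Rightarrow> observation \<Rightarrow> nat \<Rightarrow> real" where
  "coords \<phi> Y = (\<lambda>j. Y (\<phi> j))"


section \<open>Tests and their error probabilities\<close>

text \<open>Tests may be randomized: \<open>K Y\<close> is the probability of rejecting the hypothesis \<open>f = 0\<close> when
  \<open>Y\<close> is observed. A test given by a critical region is an indicator function.\<close>

definition is_test :: "(observation \<Rightarrow> real) \<Rightarrow> bool" where
  "is_test K \<longleftrightarrow> K \<in> borel_measurable obs_space \<and> (\<forall>Y\<in>space obs_space. 0 \<le> K Y \<and> K Y \<le> 1)"

definition type_I ::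
  "'w measure \<Rightarrow> ((real \<Rightarrow> real) \<Rightarrow> 'w \<Rightarrow> real) \<Rightarrow> real \<Rightarrow> nat \<Rightarrow> (observation \<Rightarrow> real) \<Rightarrow> real" where
  "type_I M w \<sigma> n K = (\<integral>\<omega>. K (obs w \<sigma> n (\<lambda>_. 0) \<omega>) \<partial>M)"

definition type_II ::
  "'w measure \<Rightarrow> ((real \<Rightarrow> real) \<Rightarrow> 'w \<Rightarrow> real) \<Rightarrow> real \<Rightarrow> nat \<Rightarrow> (observation \<Rightarrow> real) \<Rightarrow>
     (real \<Rightarrow> real) \<Rightarrow> real" where
  "type_II M w \<sigma> n K f = (\<integral>\<omega>. 1 - K (obs w \<sigma> n f \<omega>) \<partial>M)"

text \<open>For tests and nonempty \<open>V\<close> this is a supremum of numbers in \<open>[0, 1]\<close>; for empty \<open>V\<close> the value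
  carries no meaning, but the sets of alternatives considered below are nonempty for large \<open>n\<close>
  whenever their radii tend to zero.\<close>

definition type_II_sup ::
  "'w measure \<Rightarrow> ((real \<Rightarrow> real) \<Rightarrow> 'w \<Rightarrow> real) \<Rightarrow> real \<Rightarrow> nat \<Rightarrow> (observation \<Rightarrow> real) \<Rightarrow>
     (real \<Rightarrow> real) set \<Rightarrow> real" where
  "type_II_sup M w \<sigma> n K V = (SUP f\<in>V. type_II M w \<sigma> n K f)"

definition asymptotically_minimax ::
  "'w measure \<Rightarrow> ((real \<Rightarrow> real) \<Rightarrow> 'w \<Rightarrow> real) \<Rightarrow> real \<Rightarrow> real \<Rightarrow> (nat \<Rightarrow> (real \<Rightarrow> real) set) \<Rightarrow>
     (nat \<Rightarrow> observation \<Rightarrow> real) \<Rightarrow> bool" where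
  "asymptotically_minimax M w \<sigma> \<alpha> V L \<longleftrightarrow>
     (\<forall>n\<ge>1. is_test (L n)) \<and>
     (\<lambda>n. type_I M w \<sigma> n (L n)) \<sim>[sequentially] (\<lambda>_. \<alpha>) \<and>
     (\<forall>K. (\<forall>n\<ge>1. is_test (K n) \<and> type_I M w \<sigma> n (K n) \<le> \<alpha>) \<longrightarrow>
        0 \<le> liminf (\<lambda>n. ereal (type_II_sup M w \<sigma> n (K n) (V n) - type_II_sup M w \<sigma> n (L n) (V n))))"


section \<open>Alternatives and test statistics\<close>

definition same_order :: "(nat \<Rightarrow> real) \<Rightarrow> (nat \<Rightarrow> real) \<Rightarrow> bool" where
  "same_order a b \<longleftrightarrow> (\<exists>c C. 0 < c \<and> c \<le> C \<and> (\<forall>n\<ge>1. c * a n \<le> b n \<and> b n \<le> C * a n))"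

definition besov_ball :: "(nat \<Rightarrow> real \<Rightarrow> real) \<Rightarrow> real \<Rightarrow> real \<Rightarrow> (real \<Rightarrow> real) set" where
  "besov_ball \<phi> s P\<^sub>0 = {f \<in> Ltwo.
     (SUP l\<in>{0<..}. ereal (l powr (2 * s) * (\<Sum>\<^sub>\<infinity>j\<in>{j. real j > l}. (ip f (\<phi> j))\<^sup>2))) < ereal P\<^sub>0}"

definition alternatives ::
  "(nat \<Rightarrow> real \<Rightarrow> real) \<Rightarrow> real \<Rightarrow> real \<Rightarrow> (nat \<Rightarrow> real) \<Rightarrow> nat \<Rightarrow> (real \<Rightarrow> real) set" where
  "alternatives \<phi> s P\<^sub>0 \<rho> n = {f \<in> besov_ball \<phi> s P\<^sub>0. (Lnorm f)\<^sup>2 \<ge> \<rho> n}"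

text \<open>\<open>kappa_sq s P\<^sub>0 k v j\<close> is \<open>\<kappa>\<^sub>j\<^sup>2\<close> for the (in general non-integer) cut-off \<open>k = k\<^sub>n\<close> and level
  \<open>v = \<kappa>\<^sub>n\<^sup>2\<close>. Series over \<open>j \<ge> 1\<close> are written with \<open>Suc\<close>. The series defining \<open>T_stat\<close> converges
  for almost every observation.\<close>

definition kappa_sq :: "real \<Rightarrow> real \<Rightarrow> real \<Rightarrow> real \<Rightarrow> nat \<Rightarrow> real" where
  "kappa_sq s P\<^sub>0 k v j = (if real j \<le> k then v else 2 * s * P\<^sub>0 * real j powr (- 2 * s - 1))"

definition T_stat :: "real \<Rightarrow> nat \<Rightarrow> (nat \<Rightarrow> real) \<Rightarrow> (nat \<Rightarrow> real) \<Rightarrow> real" where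
  "T_stat \<sigma> n ksq y = (real n)\<^sup>2 / \<sigma> ^ 4 * (\<Sum>j. ksq (Suc j) * (y (Suc j))\<^sup>2)"

definition A_seq :: "real \<Rightarrow> nat \<Rightarrow> (nat \<Rightarrow> real) \<Rightarrow> real" where
  "A_seq \<sigma> n ksq = (real n)\<^sup>2 / \<sigma> ^ 4 * (\<Sum>j. (ksq (Suc j))\<^sup>2)"

definition C_seq :: "real \<Rightarrow> nat \<Rightarrow> real \<Rightarrow> real" where
  "C_seq \<sigma> n r = real n * r / \<sigma>\<^sup>2"

definition critical_region :: "real \<Rightarrow> nat \<Rightarrow> (nat \<Rightarrow> real) \<Rightarrow> real \<Rightarrow> real \<Rightarrow> (nat \<Rightarrow> real) set" where
  "critical_region \<sigma> n ksq r x =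
     {y. (T_stat \<sigma> n ksq y - C_seq \<sigma> n r) * (2 * A_seq \<sigma> n ksq) powr (- 1 / 2) > x}"

definition region_test :: "(nat \<Rightarrow> real \<Rightarrow> real) \<Rightarrow> (nat \<Rightarrow> real) set \<Rightarrow> observation \<Rightarrow> real" where
  "region_test \<phi> S Y = indicator S (coords \<phi> Y)"

definition std_normal_cdf :: "real \<Rightarrow> real" where
  "std_normal_cdf = cdf std_normal_distribution"

end

(*
  By summation by parts, the constraint on the tail sums forces the drift n^2 sigma^-4 sum kappa_j^2
  theta_j^2 of the statistic to be at least A_n - o(1) on V_n. The statistic is therefore, up to
  terms of smaller order, at least sum u_j (xi_j^2 - 1) + A_n after centering, where
  u_j = n kappa_j^2 / sigma^2 tends to 0 uniformly in j; a central limit theorem for weighted sums of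
  xi_j^2 - 1 then gives both error probabilities of the tests L_n from above.

  For the lower bound the Bayes prior puts independent random signs on fixed coefficients whose
  squares are increments of a slightly enlarged extremal tail function, so that it lives on V_n. The
  likelihood ratio of the mixture is prod exp (- u_j / 2) cosh (sqrt u_j xi_j). Bounding the Bayes
  risk by E min (Lambda, t) - t alpha requires only a lower bound on the ratio Lambda, for which
  cosh x >= exp (x^2/2 - x^4/12) suffices; the limit is a Gaussian shift by sqrt (A / 2).
*)

theory Submission
  imports Defs
begin

section \<open>The extremal profile\<close>

text \<open>Three features of the problem shape the argument. The sequence \<open>A n\<close> stays
  away from 0 and infinity but need not converge, so limits are taken either for the statistic
  divided by \<open>sqrt (2 * A n)\<close> or along subsequences, and Lipschitz continuity of the
  normal distribution function replaces convergence of its arguments. Competing tests may use the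
  whole observation, not just its coordinates in \<phi>; the likelihood ratio is therefore
  identified on a product space with uncountably many coordinates, through the finite-dimensional
  spaces spanned by finitely many test functions and the basis vectors that carry the prior.
  Finally, the extremal sequence itself is not admissible: the ball is defined by a strict
  inequality, and passing from the integral of the profile to a sum loses energy. Radius
  \<open>P\<^sub>0 * q powr s\<close> and cut-off \<open>q * k\<close> with \<open>q < 1\<close>
  leave room in both constraints at once: the energy grows by \<open>q powr (- s)\<close> up to the
  discretisation loss, while the squared coefficients are inflated at most by
  \<open>q powr (- 2 * s - 1)\<close>, which can be brought arbitrarily close to 1.\<close>

lemma powr_neg_diff_bounds:
  fixes s x y :: real
  assumes "s > 0" "0 < x" "x \<le> y"
  shows "2 * s * y powr (- 2 * s - 1) * (y - x) \<le> x powr (- 2 * s) - y powr (- 2 * s)"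
    and "x powr (- 2 * s) - y powr (- 2 * s) \<le> 2 * s * x powr (- 2 * s - 1) * (y - x)"
proof -
  have *: "2 * s * y powr (- 2 * s - 1) * (y - x) \<le> x powr (- 2 * s) - y powr (- 2 * s) \<and>
     x powr (- 2 * s) - y powr (- 2 * s) \<le> 2 * s * x powr (- 2 * s - 1) * (y - x)"
  proof (cases "x = y")
    case False
    then have xy: "x < y" using assms by simp
    have "\<exists>z. x < z \<and> z < y \<and> y powr (- 2 * s) - x powr (- 2 * s)
             = (y - x) * ((- 2 * s) * z powr (- 2 * s - 1))"
    proof (rule MVT2[OF xy])
      fix z assume "x \<le> z" "z \<le> y"
      then show "((\<lambda>x. x powr (- 2 * s)) has_real_derivative (- 2 * s) * z powr (- 2 * s - 1)) (at z)"
        using assms by (intro has_real_derivative_powr) auto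
    qed
    then obtain z where z: "x < z" "z < y"
      "y powr (- 2 * s) - x powr (- 2 * s) = (y - x) * ((- 2 * s) * z powr (- 2 * s - 1))" by blast
    have e: "x powr (- 2 * s) - y powr (- 2 * s) = 2 * s * z powr (- 2 * s - 1) * (y - x)"
      using z(3) by (simp add: algebra_simps)
    have "y powr (- 2 * s - 1) \<le> z powr (- 2 * s - 1)" "z powr (- 2 * s - 1) \<le> x powr (- 2 * s - 1)"
      using assms z by (auto intro!: powr_mono2')
    then show ?thesis unfolding e using assms xy
      by (auto intro!: mult_right_mono mult_left_mono)
  qed auto
  show "2 * s * y powr (- 2 * s - 1) * (y - x) \<le> x powr (- 2 * s) - y powr (- 2 * s)"
    and "x powr (- 2 * s) - y powr (- 2 * s) \<le> 2 * s * x powr (- 2 * s - 1) * (y - x)"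
    using * by auto
qed

text \<open>\<open>prof s P k\<close> is the paper's \<open>\<kappa>\<^sub>j\<^sup>2\<close> as a function of a real argument, and
  \<open>ptail s P k x\<close> is its integral over \<open>[x, \<infinity>)\<close>.\<close>

definition prof :: "real \<Rightarrow> real \<Rightarrow> real \<Rightarrow> real \<Rightarrow> real" where
  "prof s P k x = 2 * s * P * max x k powr (- 2 * s - 1)"

definition ptail :: "real \<Rightarrow> real \<Rightarrow> real \<Rightarrow> real \<Rightarrow> real" where
  "ptail s P k x = (if x \<le> k then P * k powr (- 2 * s) + prof s P k k * (k - x) else P * x powr (- 2 * s))"

lemma prof_nonneg: "s > 0 \<Longrightarrow> P > 0 \<Longrightarrow> 0 \<le> prof s P k x"
  by (simp add: prof_def)

lemma prof_pos: "s > 0 \<Longrightarrow> P > 0 \<Longrightarrow> k > 0 \<Longrightarrow> 0 < prof s P k x"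
  by (auto simp: prof_def max_def)

lemma prof_antimono:
  assumes "s > 0" "P > 0" "k > 0" "x \<le> y"
  shows "prof s P k y \<le> prof s P k x"
  using assms unfolding prof_def by (intro mult_left_mono powr_mono2') auto

lemma prof_le_level: "x \<le> k \<Longrightarrow> prof s P k x = prof s P k k"
  by (simp add: prof_def max_def)

text \<open>The integral of a nonincreasing function over \<open>[x, y]\<close> lies between its two
  endpoint rectangles. No integral is formed: \<open>ptail\<close> is explicit, linear up to
  \<open>k\<close> and a power beyond, and an interval containing \<open>k\<close> is split
  there.\<close>

lemma ptail_diff_bounds:
  assumes "s > 0" "P > 0" "k > 0" "x \<le> y"
  shows "prof s P k y * (y - x) \<le> ptail s P k x - ptail s P k y \<and>
         ptail s P k x - ptail s P k y \<le> prof s P k x * (y - x)"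
proof -
  have right: "prof s P k b * (b - a) \<le> P * a powr (- 2 * s) - P * b powr (- 2 * s) \<and>
      P * a powr (- 2 * s) - P * b powr (- 2 * s) \<le> prof s P k a * (b - a)"
    if "k \<le> a" "a \<le> b" for a b
  proof -
    have "0 < a" using assms that by simp
    note b = powr_neg_diff_bounds[OF assms(1) this that(2)]
    have "max a k = a" "max b k = b" using that by auto
    then show ?thesis using mult_left_mono[OF b(1), of P] mult_left_mono[OF b(2), of P] assms(2)
      by (simp add: prof_def right_diff_distrib mult_ac)
  qed
  consider "y \<le> k" | "k < x" | "x \<le> k" "k < y" by linarith
  then show ?thesis
  proof cases
    case 1
    then have "prof s P k y = prof s P k k" "prof s P k x = prof s P k k"
      using assms 1 prof_le_level[of y k] prof_le_level[of x k] by (blast intro: order_trans)+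
    then show ?thesis using 1 assms by (simp add: ptail_def algebra_simps)
  next
    case 2 then show ?thesis using right[of x y] assms by (simp add: ptail_def)
  next
    case 3
    have "prof s P k x = prof s P k k" using 3 by (intro prof_le_level)
    moreover have "prof s P k y * (k - x) \<le> prof s P k k * (k - x)"
      using 3 assms prof_antimono[of s P k k y] by (intro mult_right_mono) auto
    moreover note right[of k y]
    ultimately show ?thesis using 3 by (simp add: ptail_def algebra_simps)
  qed
qed

text \<open>Left of \<open>k\<close>, \<open>ptail\<close> is the tangent at \<open>k\<close> to the
  convex function \<open>P * x powr (- 2 * s)\<close>, which lies above it.\<close>

lemma ptail_le_powr:
  assumes "s > 0" "P > 0" "k > 0" "0 < x"
  shows "ptail s P k x \<le> P * x powr (- 2 * s)"
proof (cases "x \<le> k")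
  case True
  show ?thesis
    using mult_left_mono[OF powr_neg_diff_bounds(1)[OF assms(1,4) True], of P] assms True
    by (simp add: ptail_def prof_def algebra_simps)
qed (simp add: ptail_def)

lemma ptail_nonneg: "s > 0 \<Longrightarrow> P > 0 \<Longrightarrow> 0 \<le> ptail s P k x"
  by (simp add: ptail_def prof_nonneg)

lemma ptail_tendsto_0:
  assumes "s > 0"
  shows "(\<lambda>j. ptail s P k (real j)) \<longlonglongrightarrow> 0"
proof -
  have "(\<lambda>j. P * real j powr (- 2 * s)) \<longlonglongrightarrow> P * 0"
    using assms by (intro tendsto_mult tendsto_const tendsto_neg_powr filterlim_real_sequentially) auto
  moreover have "\<forall>\<^sub>F j in sequentially. P * real j powr (- 2 * s) = ptail s P k (real j)"
    using eventually_gt_at_top[of "nat \<lceil>k\<rceil>"]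
    by eventually_elim (auto simp: ptail_def, linarith)
  ultimately show ?thesis by (simp add: tendsto_cong)
qed

lemma kappa_sq_eq_prof: "kappa_sq s P k (prof s P k k) j = prof s P k (real j)"
  by (auto simp: kappa_sq_def prof_def max_def)

text \<open>The first equation makes the level equal to the power branch at the cut-off, so the two
  branches join continuously; the second then fixes the total mass of the profile. Eliminating the
  level ties \<open>r\<close> to \<open>k\<close> alone.\<close>

lemma prof_eq_of_eqs:
  assumes "s > 0" "k > 0" "1 / (2 * s) * k powr (1 + 2 * s) * v = P"
    "k * v + k powr (- 2 * s) * P = r"
  shows "v = prof s P k k" "ptail s P k 0 = r"
    "r = (1 + 2 * s) * P * k powr (- 2 * s)"
proof -
  have p: "k powr (- 2 * s - 1) * k powr (1 + 2 * s) = 1" using assms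
    by (simp add: powr_add[symmetric])
  have "2 * s * P = k powr (1 + 2 * s) * v" using assms by (auto simp: field_simps)
  then have "prof s P k k = k powr (- 2 * s - 1) * k powr (1 + 2 * s) * v" by (simp add: prof_def)
  then show v: "v = prof s P k k" using p by simp
  show "ptail s P k 0 = r" using assms v by (simp add: ptail_def algebra_simps)
  have "k * k powr (- 2 * s - 1) = k powr (- 2 * s)"
    using assms powr_mult_base[of k "- 2 * s - 1"] by simp
  then have "k * v = 2 * s * P * k powr (- 2 * s)" using v by (simp add: prof_def)
  then show "r = (1 + 2 * s) * P * k powr (- 2 * s)" using assms(4) by (simp add: algebra_simps)
qed

text \<open>Telescoping the rectangle bounds. Together the two estimates say that sums of the
  profile differ from its integrals by about one step, which later controls the centering
  constant.\<close>

lemma ptail_sum_bounds: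
  assumes "s > 0" "P > 0" "k > 0"
  shows "(\<Sum>j=Suc a..b. prof s P k (real j)) \<le> ptail s P k (real a)"
    and "a \<le> b \<Longrightarrow> ptail s P k (real (Suc a)) - ptail s P k (real (Suc b)) \<le> (\<Sum>j=Suc a..b. prof s P k (real j))"
proof -
  have "(\<Sum>j=Suc a..b. prof s P k (real j)) \<le> ptail s P k (real a) - ptail s P k (real b)" if "a \<le> b" for b
    using that
  proof (induction b rule: dec_induct)
    case (step n)
    have "prof s P k (real (Suc n)) \<le> ptail s P k (real n) - ptail s P k (real (Suc n))"
      using ptail_diff_bounds[OF assms, of "real n" "real (Suc n)"] by simp
    then show ?case using step by simp
  qed auto
  moreover have "ptail s P k (real b) \<ge> 0" using assms ptail_nonneg by auto
  ultimately show "(\<Sum>j=Suc a..b. prof s P k (real j)) \<le> ptail s P k (real a)"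
    using ptail_nonneg[OF assms(1,2), of k "real a"] by (cases "a \<le> b") force+
  show "ptail s P k (real (Suc a)) - ptail s P k (real (Suc b)) \<le> (\<Sum>j=Suc a..b. prof s P k (real j))"
    if "a \<le> b" using that
  proof (induction b rule: dec_induct)
    case (step n)
    have "ptail s P k (real (Suc n)) - ptail s P k (real (Suc (Suc n))) \<le> prof s P k (real (Suc n))"
      using ptail_diff_bounds[OF assms, of "real (Suc n)" "real (Suc (Suc n))"] by simp
    then show ?case using step by simp
  qed auto
qed

lemma summable_prof:
  assumes "s > 0" "P > 0" "k > 0"
  shows "summable (\<lambda>j. prof s P k (real (Suc j)))"
proof (rule bounded_imp_summable)
  show "0 \<le> prof s P k (real (Suc n))" for n using prof_nonneg assms by auto
  show "(\<Sum>i\<le>n. prof s P k (real (Suc i))) \<le> ptail s P k 0" for n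
    using ptail_sum_bounds(1)[OF assms, of 0 "Suc n"]
      sum.shift_bounds_cl_Suc_ivl[of "\<lambda>j. prof s P k (real j)" 0 n] by (simp add: atLeast0AtMost)
qed

text \<open>Discrete summation by parts: the increments of \<open>h\<close> and the excess \<open>e\<close> of the tail sums
  over the extremal ones have opposite signs.\<close>

lemma abel_nonneg:
  fixes h e :: "nat \<Rightarrow> real"
  assumes "e 1 \<ge> 0" "h 1 \<ge> 0"
    and "\<And>j. j \<ge> 1 \<Longrightarrow> (h (Suc j) - h j) * e (Suc j) \<ge> 0"
    and "N \<ge> 1"
  shows "(\<Sum>j=1..N. h j * (e j - e (Suc j))) + h N * e (Suc N) \<ge> 0"
  using assms(4)
proof (induction N rule: nat_induct_at_least)
  case base then show ?case using assms by (simp add: algebra_simps)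
next
  case (Suc n)
  have "(\<Sum>j=1..Suc n. h j * (e j - e (Suc j))) + h (Suc n) * e (Suc (Suc n)) =
    (\<Sum>j=1..n. h j * (e j - e (Suc j))) + h n * e (Suc n) + (h (Suc n) - h n) * e (Suc n)"
    by (simp add: algebra_simps)
  then show ?case using Suc assms(3)[of n] by simp
qed

text \<open>\<open>abel_nonneg\<close> is applied to the excess of \<open>t\<close> over the
  extremal tails. Up to \<open>k\<close> the profile is constant, so the excess, of unknown sign
  there, is multiplied by 0; beyond \<open>k\<close> the excess and the increments of the profile
  are both nonpositive. The left-hand sum starts at 2 because an increment of \<open>ptail\<close>
  over a unit interval is bounded below by the profile at the right end.\<close>

lemma extremal_prof_sum:
  fixes t :: "nat \<Rightarrow> real"
  assumes "s > 0" "P > 0" "k > 0" and "t 1 \<ge> ptail s P k 0"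
    and t: "\<And>j. j \<ge> 1 \<Longrightarrow> t j \<le> P * real j powr (- 2 * s)"
    and N: "N \<ge> 1" "real N \<ge> k"
  shows "(\<Sum>j=2..Suc N. (prof s P k (real j))\<^sup>2) \<le> (\<Sum>j=1..N. prof s P k (real j) * (t j - t (Suc j)))"
proof -
  define h where "h j = prof s P k (real j)" for j :: nat
  \<comment> \<open>At index 1 the comparison tail is the value of \<open>ptail\<close> at 0, since
    this is the energy that \<open>t 1\<close> is known to reach. The first increment only becomes
    larger by this choice.\<close>
  define g where "g j = (if j = 1 then ptail s P k 0 else ptail s P k (real j))" for j :: nat
  have hn: "h j \<ge> 0" for j using assms prof_nonneg by (auto simp: h_def)
  have ha: "h (Suc j) \<le> h j" for j using assms prof_antimono by (auto simp: h_def)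
  have tg: "t j - g j \<le> 0" if "real j > k" "j \<ge> 2" for j
    using that t[of j] by (simp add: g_def ptail_def)
  have main: "(\<Sum>j=1..N. h j * ((t j - g j) - (t (Suc j) - g (Suc j)))) + h N * (t (Suc N) - g (Suc N)) \<ge> 0"
  proof (rule abel_nonneg[OF _ hn _ N(1)])
    show "t 1 - g 1 \<ge> 0" using assms by (simp add: g_def)
    fix j :: nat assume j: "j \<ge> 1"
    show "(h (Suc j) - h j) * (t (Suc j) - g (Suc j)) \<ge> 0"
    proof (cases "real (Suc j) \<le> k")
      case True
      then have "h (Suc j) = h j" using prof_le_level[of "real j" k s P] prof_le_level[of "real (Suc j)" k s P] unfolding h_def by linarith
      then show ?thesis by simp
    next
      case False
      then show ?thesis using tg[of "Suc j"] ha[of j] j by (intro mult_nonpos_nonpos) auto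
    qed
  qed
  \<comment> \<open>As \<open>N\<close> is at least \<open>k\<close>, the boundary term of the
    summation by parts has the sign that allows dropping it.\<close>
  have "h N * (t (Suc N) - g (Suc N)) \<le> 0"
    using tg[of "Suc N"] N hn by (intro mult_nonneg_nonpos) auto
  with main have "(\<Sum>j=1..N. h j * ((t j - g j) - (t (Suc j) - g (Suc j)))) \<ge> 0" by linarith
  then have "(\<Sum>j=1..N. h j * (g j - g (Suc j))) \<le> (\<Sum>j=1..N. h j * (t j - t (Suc j)))"
    by (simp add: algebra_simps sum.distrib sum_subtractf)
  moreover have "(\<Sum>j=1..N. (h (Suc j))\<^sup>2) \<le> (\<Sum>j=1..N. h j * (g j - g (Suc j)))"
  proof (rule sum_mono)
    fix j assume "j \<in> {1..N}"
    have "h (Suc j) \<le> ptail s P k (real j) - ptail s P k (real (Suc j))"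
      using ptail_diff_bounds[OF assms(1-3), of "real j" "real (Suc j)"] by (simp add: h_def)
    moreover have "ptail s P k 1 \<le> ptail s P k 0"
      using ptail_diff_bounds[OF assms(1-3), of 0 1] prof_nonneg[OF assms(1,2), of k 1] by simp
    ultimately have "h (Suc j) \<le> g j - g (Suc j)" using \<open>j \<in> {1..N}\<close> by (auto simp: g_def)
    then show "(h (Suc j))\<^sup>2 \<le> h j * (g j - g (Suc j))"
      using ha[of j] hn[of j] hn[of "Suc j"] by (simp add: power2_eq_square mult_mono)
  qed
  moreover have "(\<Sum>j=1..N. (h (Suc j))\<^sup>2) = (\<Sum>j=2..Suc N. (h j)\<^sup>2)"
    using sum.shift_bounds_cl_Suc_ivl[of "\<lambda>j. (h j)\<^sup>2" 1 N] by (simp add: numeral_2_eq_2)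
  ultimately show ?thesis by (simp add: h_def)
qed

section \<open>Orthonormal families in the space of square-integrable functions\<close>

abbreviation leb :: "real measure" where
  "leb \<equiv> lebesgue_on {0<..<1}"

lemma Ltwo_mult_integrable:
  assumes "f \<in> Ltwo" "g \<in> Ltwo"
  shows "integrable (leb) (\<lambda>t. f t * g t)"
proof (rule Bochner_Integration.integrable_bound)
  show "integrable (leb) (\<lambda>t. (f t)\<^sup>2 + (g t)\<^sup>2)"
    using assms by (auto simp: Ltwo_def)
  show "(\<lambda>t. f t * g t) \<in> borel_measurable (leb)"
    using assms by (auto simp: Ltwo_def)
  have "norm (a * b) \<le> norm (a\<^sup>2 + b\<^sup>2)" for a b :: real
  proof -
    have "2 * (\<bar>a\<bar> * \<bar>b\<bar>) \<le> a\<^sup>2 + b\<^sup>2"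
      using sum_squares_bound[of "\<bar>a\<bar>" "\<bar>b\<bar>"] by simp
    moreover have "0 \<le> \<bar>a\<bar> * \<bar>b\<bar>" by simp
    ultimately have "\<bar>a\<bar> * \<bar>b\<bar> \<le> a\<^sup>2 + b\<^sup>2" by linarith
    then show ?thesis by (simp add: abs_mult)
  qed
  then show "AE t in leb. norm (f t * g t) \<le> norm ((f t)\<^sup>2 + (g t)\<^sup>2)" by auto
qed

lemma Ltwo_lincomb:
  assumes "f \<in> Ltwo" "g \<in> Ltwo"
  shows "(\<lambda>t. a * f t + b * g t) \<in> Ltwo"
proof -
  have "(\<lambda>t. (a * f t + b * g t)\<^sup>2) = (\<lambda>t. a\<^sup>2 * (f t)\<^sup>2 + (2 * a * b) * (f t * g t) + b\<^sup>2 * (g t)\<^sup>2)"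
    by (auto simp: power2_eq_square algebra_simps)
  moreover have "integrable (leb) (\<lambda>t. a\<^sup>2 * (f t)\<^sup>2 + (2 * a * b) * (f t * g t) + b\<^sup>2 * (g t)\<^sup>2)"
    using assms Ltwo_mult_integrable[OF assms]
    by (intro Bochner_Integration.integrable_add integrable_mult_right) (auto simp: Ltwo_def)
  ultimately show ?thesis using assms by (auto simp: Ltwo_def)
qed

lemma Ltwo_0: "(\<lambda>_. 0) \<in> Ltwo" by (auto simp: Ltwo_def)

lemma Ltwo_scale: "f \<in> Ltwo \<Longrightarrow> (\<lambda>t. a * f t) \<in> Ltwo"
  using Ltwo_lincomb[of f f a 0] by simp

lemma Ltwo_add: "f \<in> Ltwo \<Longrightarrow> g \<in> Ltwo \<Longrightarrow> (\<lambda>t. f t + g t) \<in> Ltwo"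
  using Ltwo_lincomb[of f g 1 1] by simp

lemma Ltwo_diff: "f \<in> Ltwo \<Longrightarrow> g \<in> Ltwo \<Longrightarrow> (\<lambda>t. f t - g t) \<in> Ltwo"
  using Ltwo_lincomb[of f g 1 "-1"] by simp

lemma Ltwo_sum:
  "(\<And>i. i \<in> I \<Longrightarrow> g i \<in> Ltwo) \<Longrightarrow> (\<lambda>t. \<Sum>i\<in>I. c i * g i t) \<in> Ltwo"
proof (induction I rule: infinite_finite_induct)
  case (insert x F)
  then show ?case using Ltwo_add[OF Ltwo_scale] by simp
qed (simp_all add: Ltwo_0)

lemma ip_commute: "ip f g = ip g f" by (simp add: ip_def mult.commute)

lemma ip_0 [simp]: "ip (\<lambda>_. 0) g = 0" by (simp add: ip_def)

lemma ip_lincomb: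
  assumes "f \<in> Ltwo" "g \<in> Ltwo" "h \<in> Ltwo"
  shows "ip (\<lambda>t. a * f t + b * g t) h = a * ip f h + b * ip g h"
proof -
  have "ip (\<lambda>t. a * f t + b * g t) h =
     (\<integral>t. a * (f t * h t) + b * (g t * h t) \<partial>leb)"
    unfolding ip_def by (intro Bochner_Integration.integral_cong) (auto simp: algebra_simps)
  also have "\<dots> = a * ip f h + b * ip g h"
    unfolding ip_def using assms
    by (subst Bochner_Integration.integral_add) (auto intro!: Ltwo_mult_integrable)
  finally show ?thesis .
qed

lemma ip_scale: "f \<in> Ltwo \<Longrightarrow> h \<in> Ltwo \<Longrightarrow> ip (\<lambda>t. a * f t) h = a * ip f h"
  using ip_lincomb[of f f h a 0] by simp

lemma ip_diff: "f \<in> Ltwo \<Longrightarrow> g \<in> Ltwo \<Longrightarrow> h \<in> Ltwo \<Longrightarrow> ip (\<lambda>t. f t - g t) h = ip f h - ip g h"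
  using ip_lincomb[of f g h 1 "-1"] by simp

lemma ip_sum:
  assumes "\<And>i. i \<in> I \<Longrightarrow> g i \<in> Ltwo" "h \<in> Ltwo"
  shows "ip (\<lambda>t. \<Sum>i\<in>I. c i * g i t) h = (\<Sum>i\<in>I. c i * ip (g i) h)"
  using assms(1)
proof (induction I rule: infinite_finite_induct)
  case (insert x F)
  then show ?case
    using ip_lincomb[of "g x" "\<lambda>t. \<Sum>i\<in>F. c i * g i t" h "c x" 1] assms(2) Ltwo_sum[of F g c] by simp
qed simp_all

lemma Lnorm_sq: "(Lnorm f)\<^sup>2 = ip f f"
  by (simp add: Lnorm_def ip_def power2_eq_square)

lemma ip_self_nonneg: "0 \<le> ip f f" by (simp add: ip_def)

lemma ip_self_eq_0_iff:
  assumes "f \<in> Ltwo"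
  shows "ip f f = 0 \<longleftrightarrow> (AE t in leb. f t = 0)"
proof -
  have "ip f f = 0 \<longleftrightarrow> (AE t in leb. f t * f t = 0)"
    unfolding ip_def by (rule integral_nonneg_eq_0_iff_AE) (auto intro: Ltwo_mult_integrable assms)
  then show ?thesis by simp
qed

lemma ip_cong_AE:
  assumes "g \<in> Ltwo" "g' \<in> Ltwo" "h \<in> Ltwo" "AE t in leb. g t = g' t"
  shows "ip h g = ip h g'"
  unfolding ip_def using assms by (intro integral_cong_AE) (auto simp: Ltwo_def)

lemma orthonormal_family_sum_ip:
  assumes "orthonormal_family I e" "finite J" "J \<subseteq> I" "l \<in> I"
  shows "ip (\<lambda>t. \<Sum>j\<in>J. c j * e j t) (e l) = (if l \<in> J then c l else 0)"
proof -
  have "ip (\<lambda>t. \<Sum>j\<in>J. c j * e j t) (e l) = (\<Sum>j\<in>J. c j * ip (e j) (e l))"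
    using assms by (intro ip_sum) (auto simp: orthonormal_family_def)
  also have "\<dots> = (\<Sum>j\<in>J. if l = j then c l else 0)"
    using assms by (intro sum.cong) (auto simp: orthonormal_family_def)
  finally show ?thesis using assms(2) by simp
qed

lemma orthonormal_family_insert:
  assumes e: "orthonormal_family {1..J} e" and u: "u \<in> Ltwo" "ip u u = 1"
    and o: "\<And>j. j \<in> {1..J} \<Longrightarrow> ip u (e j) = 0"
  shows "orthonormal_family {1..Suc J} (e(Suc J := u))"
  unfolding orthonormal_family_def
proof safe
  fix i assume "i \<in> {1..Suc J}"
  then show "(e(Suc J := u)) i \<in> Ltwo" using e u by (auto simp: orthonormal_family_def)
next
  fix i j assume ij: "i \<in> {1..Suc J}" "j \<in> {1..Suc J}"
  consider "i = Suc J" "j = Suc J" | "i = Suc J" "j \<in> {1..J}" | "i \<in> {1..J}" "j = Suc J" | "i \<in> {1..J}" "j \<in> {1..J}"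
    using ij by force
  then show "ip ((e(Suc J := u)) i) ((e(Suc J := u)) j) = (if i = j then 1 else 0)"
  proof cases
    case 1 then show ?thesis using u by simp
  next
    case 2 then show ?thesis using o by auto
  next
    case 3 then show ?thesis using o ip_commute[of "e i" u] by auto
  next
    case 4 then show ?thesis using e by (auto simp: orthonormal_family_def)
  qed
qed

text \<open>A function whose remainder has norm 0 adds no vector, hence the equalities hold only
  almost everywhere. The first \<open>J\<close> members are kept so that a drift spanned by them has
  no component along the added ones.\<close>

lemma gram_schmidt:
  assumes "finite G" "G \<subseteq> Ltwo" "orthonormal_family {1..J} e"
  shows "\<exists>J' e'. J \<le> J' \<and> orthonormal_family {1..J'} e' \<and> (\<forall>j\<in>{1..J}. e' j = e j) \<and>
    (\<forall>g\<in>G. \<exists>c. AE t in leb. g t = (\<Sum>l=1..J'. c l * e' l t))"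
  using assms(1,2)
proof (induction G rule: finite_induct)
  case empty then show ?case using assms(3) by (intro exI[of _ J] exI[of _ e]) auto
next
  case (insert g G)
  then obtain J' e' where J': "J \<le> J'" "orthonormal_family {1..J'} e'" "\<forall>j\<in>{1..J}. e' j = e j"
    and G: "\<forall>g\<in>G. \<exists>c. AE t in leb. g t = (\<Sum>l=1..J'. c l * e' l t)" by auto
  have gL: "g \<in> Ltwo" using insert by auto
  have eL: "e' l \<in> Ltwo" if "l \<in> {1..J'}" for l using J'(2) that by (auto simp: orthonormal_family_def)
  define r where "r = (\<lambda>t. g t - (\<Sum>l=1..J'. ip g (e' l) * e' l t))"
  have SL: "(\<lambda>t. \<Sum>l=1..J'. ip g (e' l) * e' l t) \<in> Ltwo" using eL by (intro Ltwo_sum)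
  have rL: "r \<in> Ltwo" unfolding r_def using gL SL by (intro Ltwo_diff)
  have ro: "ip r (e' j) = 0" if "j \<in> {1..J'}" for j
    unfolding r_def using that gL SL eL orthonormal_family_sum_ip[OF J'(2), of "{1..J'}" j "\<lambda>l. ip g (e' l)"]
    by (subst ip_diff) auto
  show ?case
  proof (cases "ip r r = 0")
    case True
    then have "AE t in leb. g t = (\<Sum>l=1..J'. ip g (e' l) * e' l t)"
      using ip_self_eq_0_iff[OF rL] by (simp add: r_def)
    then show ?thesis using J' G by (intro exI[of _ J'] exI[of _ e']) auto
  next
    case False
    define u where "u = (\<lambda>t. (1 / sqrt (ip r r)) * r t)"
    have uL: "u \<in> Ltwo" unfolding u_def using rL by (intro Ltwo_scale)
    have p: "ip r r > 0" using False ip_self_nonneg[of r] by simp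
    have ur: "ip u h = (1 / sqrt (ip r r)) * ip r h" if "h \<in> Ltwo" for h
      unfolding u_def using rL that by (rule ip_scale)
    have "ip u u = (1 / sqrt (ip r r)) * ((1 / sqrt (ip r r)) * ip r r)"
      using ur[OF uL] ur[OF rL] ip_commute[of r u] by simp
    then have uu: "ip u u = 1" using p by (simp add: field_simps)
    define e2 where "e2 = e'(Suc J' := u)"
    have on: "orthonormal_family {1..Suc J'} e2" unfolding e2_def
      using J'(2) uL uu by (rule orthonormal_family_insert) (use ur[OF eL] ro in auto)
    have ext: "(\<Sum>l=1..Suc J'. (c(Suc J' := a)) l * e2 l t) = (\<Sum>l=1..J'. c l * e' l t) + a * u t" for c a t
      by (auto simp: e2_def intro!: sum.cong)
    have comb: "\<exists>c. AE t in leb. h t = (\<Sum>l=1..Suc J'. c l * e2 l t)" if "h \<in> insert g G" for h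
    proof (cases "h = g")
      case True
      have "g t = (\<Sum>l=1..Suc J'. ((\<lambda>l. ip g (e' l))(Suc J' := sqrt (ip r r))) l * e2 l t)" for t
        unfolding ext using p by (simp add: u_def r_def)
      then have "AE t in leb. h t = (\<Sum>l=1..Suc J'. ((\<lambda>l. ip g (e' l))(Suc J' := sqrt (ip r r))) l * e2 l t)"
        using True by simp
      then show ?thesis by (intro exI[of _ "(\<lambda>l. ip g (e' l))(Suc J' := sqrt (ip r r))"])
    next
      case False
      then have "h \<in> G" using that by simp
      from G[rule_format, OF this] obtain c where "AE t in leb. h t = (\<Sum>l=1..J'. c l * e' l t)" ..
      then have "AE t in leb. h t = (\<Sum>l=1..Suc J'. (c(Suc J' := 0)) l * e2 l t)"
        unfolding ext by simp
      then show ?thesis by (intro exI[of _ "c(Suc J' := 0)"])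
    qed
    have eq: "e2 j = e j" if "j \<in> {1..J}" for j using J'(1,3) that by (simp add: e2_def)
    show ?thesis
    proof (rule exI[of _ "Suc J'"], rule exI[of _ e2], intro conjI)
      show "J \<le> Suc J'" using J'(1) by simp
      show "\<forall>j\<in>{1..J}. e2 j = e j" using eq by (rule ballI)
      show "\<forall>g\<in>insert g G. \<exists>c. AE t in leb. g t = (\<Sum>l=1..Suc J'. c l * e2 l t)"
        using comb by (rule ballI)
    qed (fact on)
  qed
qed

section \<open>Orthonormal bases and Parseval's identity\<close>

lemma orthonormal_basis_Ltwo: "orthonormal_basis \<phi> \<Longrightarrow> j \<ge> 1 \<Longrightarrow> \<phi> j \<in> Ltwo"
  by (auto simp: orthonormal_basis_def orthonormal_family_def)

lemma orthonormal_family_subset: "orthonormal_family I g \<Longrightarrow> J \<subseteq> I \<Longrightarrow> orthonormal_family J g"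
  unfolding orthonormal_family_def by blast

text \<open>The squared norm of the residual after \<open>N\<close> terms is the squared norm of
  \<open>f\<close> minus the partial sum of squares. The unordered form fits the infinite tail sums
  in \<open>besov_ball\<close>.\<close>

lemma parseval:
  assumes b: "orthonormal_basis \<phi>" and f: "f \<in> Ltwo"
  shows "((\<lambda>j. (ip f (\<phi> j))\<^sup>2) has_sum (Lnorm f)\<^sup>2) {1..}"
proof -
  have fam: "orthonormal_family {1..} \<phi>" using b by (simp add: orthonormal_basis_def)
  have eq: "(Lnorm (\<lambda>t. f t - (\<Sum>j=1..N. ip f (\<phi> j) * \<phi> j t)))\<^sup>2 = (Lnorm f)\<^sup>2 - (\<Sum>j=1..N. (ip f (\<phi> j))\<^sup>2)" for N
  proof -
    define S where "S = (\<lambda>t. \<Sum>j=1..N. ip f (\<phi> j) * \<phi> j t)"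
    have SL: "S \<in> Ltwo" unfolding S_def using orthonormal_basis_Ltwo[OF b] by (intro Ltwo_sum) auto
    have "ip S f = (\<Sum>j=1..N. ip f (\<phi> j) * ip (\<phi> j) f)" unfolding S_def
      using orthonormal_basis_Ltwo[OF b] f by (intro ip_sum) auto
    then have Sf: "ip S f = (\<Sum>j=1..N. (ip f (\<phi> j))\<^sup>2)"
      by (simp add: ip_commute[of "\<phi> _" f] power2_eq_square)
    have "ip S S = (\<Sum>j=1..N. ip f (\<phi> j) * ip (\<phi> j) S)" 
      using orthonormal_basis_Ltwo[OF b] SL unfolding S_def by (intro ip_sum) auto
    also have "\<dots> = (\<Sum>j=1..N. (ip f (\<phi> j))\<^sup>2)"
    proof (intro sum.cong refl)
      fix j assume j: "j \<in> {1..N}"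
      have "ip S (\<phi> j) = ip f (\<phi> j)"
        unfolding S_def using j by (subst orthonormal_family_sum_ip[OF fam]) auto
      then show "ip f (\<phi> j) * ip (\<phi> j) S = (ip f (\<phi> j))\<^sup>2"
        by (simp add: ip_commute[of _ S] power2_eq_square)
    qed
    finally have SS: "ip S S = (\<Sum>j=1..N. (ip f (\<phi> j))\<^sup>2)" .
    have "ip (\<lambda>t. f t - S t) (\<lambda>t. f t - S t) = ip f (\<lambda>t. f t - S t) - ip S (\<lambda>t. f t - S t)"
      using f SL by (intro ip_diff Ltwo_diff)
    also have "\<dots> = (ip f f - ip S f) - (ip f S - ip S S)"
      using ip_diff[OF f SL f] ip_diff[OF f SL SL] by (simp add: ip_commute[of _ "\<lambda>t. f t - S t"])
    finally show ?thesis using Sf SS ip_commute[of f S] unfolding Lnorm_sq S_def by simp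
  qed
  have "(\<lambda>N. (Lnorm (\<lambda>t. f t - (\<Sum>j=1..N. ip f (\<phi> j) * \<phi> j t)))\<^sup>2) \<longlonglongrightarrow> 0\<^sup>2"
    using b f by (intro tendsto_power) (auto simp: orthonormal_basis_def)
  then have "(\<lambda>N. (Lnorm f)\<^sup>2 - ((Lnorm f)\<^sup>2 - (\<Sum>j=1..N. (ip f (\<phi> j))\<^sup>2))) \<longlonglongrightarrow> (Lnorm f)\<^sup>2 - 0\<^sup>2"
    unfolding eq by (intro tendsto_intros)
  then have lim: "(\<lambda>N. \<Sum>j=1..N. (ip f (\<phi> j))\<^sup>2) \<longlonglongrightarrow> (Lnorm f)\<^sup>2" by simp
  have "(\<lambda>N. \<Sum>j<N. (ip f (\<phi> (Suc j)))\<^sup>2) \<longlonglongrightarrow> (Lnorm f)\<^sup>2"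
    using lim by (simp add: sum.atLeast1_atMost_eq)
  then have "(\<lambda>j. (ip f (\<phi> (Suc j)))\<^sup>2) sums (Lnorm f)\<^sup>2" by (simp add: sums_def)
  then have "((\<lambda>j. (ip f (\<phi> (Suc j)))\<^sup>2) has_sum (Lnorm f)\<^sup>2) UNIV"
    by (intro norm_summable_imp_has_sum) (auto simp: sums_iff)
  then have "((\<lambda>j. (ip f (\<phi> j))\<^sup>2) has_sum (Lnorm f)\<^sup>2) (range Suc)"
    by (subst has_sum_reindex) (auto simp: o_def)
  moreover have "range Suc = {1..}" by (metis atLeast_Suc_greaterThan greaterThan_0 One_nat_def)
  ultimately show ?thesis by simp
qed

section \<open>White noise and change of measure\<close>

context prob_space begin

lemma std_normal_moment_integrable:
  assumes "distributed M lborel X std_normal_density"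
  shows "integrable M (\<lambda>\<omega>. X \<omega> ^ k)"
  using integrable_std_normal_moment[of k]
  by (subst distributed_integrable[OF assms, symmetric]) auto

lemma std_normal_even_moment:
  assumes "distributed M lborel X std_normal_density"
  shows "(\<integral>\<omega>. X \<omega> ^ (2 * k) \<partial>M) = fact (2 * k) / (2 ^ k * fact k)"
  using integral_std_normal_moment_even[of k] distributed_integral[OF assms, of "\<lambda>x. x ^ (2 * k)"] by simp

lemma std_normal_moments:
  assumes "distributed M lborel X std_normal_density"
  shows "(\<integral>\<omega>. X \<omega> \<partial>M) = 0" "(\<integral>\<omega>. (X \<omega>)\<^sup>2 \<partial>M) = 1" "(\<integral>\<omega>. X \<omega> ^ 4 \<partial>M) = 3" "(\<integral>\<omega>. X \<omega> ^ 8 \<partial>M) = 105"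
proof -
  show "(\<integral>\<omega>. X \<omega> \<partial>M) = 0"
    using integral_std_normal_moment_odd[of 0] distributed_integral[OF assms, of "\<lambda>x. x"] by simp
  show "(\<integral>\<omega>. (X \<omega>)\<^sup>2 \<partial>M) = 1" "(\<integral>\<omega>. X \<omega> ^ 4 \<partial>M) = 3" "(\<integral>\<omega>. X \<omega> ^ 8 \<partial>M) = 105"
    using std_normal_even_moment[OF assms, of 1] std_normal_even_moment[OF assms, of 2]
      std_normal_even_moment[OF assms, of 4] by (simp_all add: fact_numeral)
qed

text \<open>Mixed products integrate to 0 by independence and zero means. The common variance
  \<open>v\<close> is left free because the lemma serves both the linear term of the statistic under
  an alternative and the quartic remainder of the log-likelihood.\<close>

lemma expectation_sum_sq:
  fixes Y :: "nat \<Rightarrow> 'a \<Rightarrow> real"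
  assumes ind: "indep_vars (\<lambda>_. borel) Y I" and fin: "finite I"
    and int: "\<And>j. j \<in> I \<Longrightarrow> integrable M (Y j)" "\<And>j. j \<in> I \<Longrightarrow> integrable M (\<lambda>\<omega>. (Y j \<omega>)\<^sup>2)"
    and zero: "\<And>j. j \<in> I \<Longrightarrow> expectation (Y j) = 0"
    and var: "\<And>j. j \<in> I \<Longrightarrow> (\<integral>\<omega>. (Y j \<omega>)\<^sup>2 \<partial>M) = v"
  shows "integrable M (\<lambda>\<omega>. (\<Sum>j\<in>I. a j * Y j \<omega>)\<^sup>2)"
    and "(\<integral>\<omega>. (\<Sum>j\<in>I. a j * Y j \<omega>)\<^sup>2 \<partial>M) = v * (\<Sum>j\<in>I. (a j)\<^sup>2)"
proof -
  have pair: "integrable M (\<lambda>\<omega>. Y i \<omega> * Y j \<omega>) \<and> (\<integral>\<omega>. Y i \<omega> * Y j \<omega> \<partial>M) = (if i = j then v else 0)"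
    if "i \<in> I" "j \<in> I" for i j
  proof (cases "i = j")
    case True then show ?thesis using int(2)[OF that(1)] var[OF that(1)] by (simp add: power2_eq_square)
  next
    case False
    have iv: "indep_vars (\<lambda>_. borel) Y {i, j}" using ind by (rule indep_vars_subset) (use that in auto)
    have "(\<lambda>\<omega>. \<Prod>l\<in>{i,j}. Y l \<omega>) = (\<lambda>\<omega>. Y i \<omega> * Y j \<omega>)" using False by auto
    moreover have "integrable M (\<lambda>\<omega>. \<Prod>l\<in>{i,j}. Y l \<omega>)"
      by (rule indep_vars_integrable[OF _ iv]) (use int that in auto)
    moreover have "(\<integral>\<omega>. (\<Prod>l\<in>{i,j}. Y l \<omega>) \<partial>M) = (\<Prod>l\<in>{i,j}. \<integral>\<omega>. Y l \<omega> \<partial>M)"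
      by (rule indep_vars_lebesgue_integral[OF _ iv]) (use int that in auto)
    ultimately show ?thesis using False zero that by simp
  qed
  have sq: "(\<Sum>j\<in>I. a j * Y j \<omega>)\<^sup>2 = (\<Sum>i\<in>I. \<Sum>j\<in>I. (a i * a j) * (Y i \<omega> * Y j \<omega>))" for \<omega>
    by (simp add: power2_eq_square sum_product mult_ac)
  show "integrable M (\<lambda>\<omega>. (\<Sum>j\<in>I. a j * Y j \<omega>)\<^sup>2)"
    unfolding sq using pair by (intro Bochner_Integration.integrable_sum integrable_mult_right) auto
  have "(\<integral>\<omega>. (\<Sum>j\<in>I. a j * Y j \<omega>)\<^sup>2 \<partial>M) = (\<Sum>i\<in>I. \<Sum>j\<in>I. (a i * a j) * (\<integral>\<omega>. Y i \<omega> * Y j \<omega> \<partial>M))"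
    unfolding sq using pair
    by (subst Bochner_Integration.integral_sum) (auto intro!: sum.cong Bochner_Integration.integral_sum)
  also have "\<dots> = (\<Sum>i\<in>I. \<Sum>j\<in>I. if i = j then v * (a i)\<^sup>2 else 0)"
    using pair by (intro sum.cong) (auto simp: power2_eq_square)
  finally show "(\<integral>\<omega>. (\<Sum>j\<in>I. a j * Y j \<omega>)\<^sup>2 \<partial>M) = v * (\<Sum>j\<in>I. (a j)\<^sup>2)"
    using fin by (simp add: sum_distrib_left)
qed

end

text \<open>Completing the square: the exponential factor is the likelihood ratio of a shift of the
  mean by \<open>\<tau>\<close>.\<close>

lemma std_normal_density_tilt:
  "std_normal_density x * exp (\<tau> * x - \<tau>\<^sup>2 / 2) = std_normal_density (x - \<tau>)"
  by (simp add: std_normal_density_def exp_add[symmetric] power2_eq_square field_simps)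

lemma std_normal_shift:
  fixes g :: "real \<Rightarrow> ennreal"
  assumes [measurable]: "g \<in> borel_measurable borel"
  shows "(\<integral>\<^sup>+x. ennreal (std_normal_density x) * (ennreal (exp (\<tau> * x - \<tau>\<^sup>2 / 2)) * g x) \<partial>lborel)
    = (\<integral>\<^sup>+x. ennreal (std_normal_density x) * g (x + \<tau>) \<partial>lborel)"
proof -
  have "(\<integral>\<^sup>+x. ennreal (std_normal_density x) * (ennreal (exp (\<tau> * x - \<tau>\<^sup>2 / 2)) * g x) \<partial>lborel)
    = (\<integral>\<^sup>+x. ennreal (std_normal_density (x - \<tau>)) * g x \<partial>lborel)"
    by (intro nn_integral_cong) (simp add: std_normal_density_tilt[symmetric] ennreal_mult mult.assoc)
  also have "\<dots> = (\<integral>\<^sup>+x. ennreal (std_normal_density x) * g (x + \<tau>) \<partial>lborel)"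
    by (subst nn_integral_real_affine[where c=1 and t=\<tau>]) (auto simp: add.commute)
  finally show ?thesis .
qed

section \<open>Consequences of the white noise axioms\<close>

locale gauss_noise =
  fixes M :: "'w measure" and w :: "(real \<Rightarrow> real) \<Rightarrow> 'w \<Rightarrow> real" and \<phi> :: "nat \<Rightarrow> real \<Rightarrow> real"
  assumes noise: "white_noise M w" and basis: "orthonormal_basis \<phi>"

sublocale gauss_noise \<subseteq> prob_space M
  using noise by (simp add: white_noise_def)

context gauss_noise begin

lemma w_measurable [measurable]: "g \<in> Ltwo \<Longrightarrow> w g \<in> borel_measurable M"
  using noise by (simp add: white_noise_def)

lemma w_lincomb: "g \<in> Ltwo \<Longrightarrow> h \<in> Ltwo \<Longrightarrow> AE \<omega> in M. w (\<lambda>t. a * g t + b * h t) \<omega> = a * w g \<omega> + b * w h \<omega>"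
  using noise by (simp add: white_noise_def)

lemma w_indep: "orthonormal_family I g \<Longrightarrow> indep_vars (\<lambda>_. borel) (\<lambda>i. w (g i)) I"
  using noise by (simp add: white_noise_def)

lemma w_distributed: "orthonormal_family I g \<Longrightarrow> i \<in> I \<Longrightarrow> distributed M lborel (w (g i)) std_normal_density"
  using noise by (simp add: white_noise_def)

lemma w_distributed_unit:
  assumes "u \<in> Ltwo" "ip u u = 1"
  shows "distributed M lborel (w u) std_normal_density"
  using w_distributed[of "{0::nat}" "\<lambda>_. u" 0] assms by (simp add: orthonormal_family_def)

lemma basis_Ltwo [simp]: "j \<ge> 1 \<Longrightarrow> \<phi> j \<in> Ltwo"
  using basis orthonormal_basis_Ltwo by auto

lemma basis_family: "orthonormal_family {1..} \<phi>"
  using basis by (simp add: orthonormal_basis_def)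

text \<open>By the parallelogram identity for a unit vector \<open>e\<close>: both \<open>e + h\<close> and \<open>e - h\<close> are unit
  vectors.\<close>

lemma w_null:
  assumes h: "h \<in> Ltwo" "ip h h = 0"
  shows "AE \<omega> in M. w h \<omega> = 0"
proof -
  define e where "e = \<phi> 1"
  have e: "e \<in> Ltwo" "ip e e = 1" using basis_family by (auto simp: e_def orthonormal_family_def)
  have "ip e h = ip e (\<lambda>_. 0)"
    using h ip_self_eq_0_iff[OF h(1)] e by (intro ip_cong_AE) (auto simp: Ltwo_0)
  then have eh: "ip e h = 0" "ip h e = 0" using ip_0[of e] by (simp_all add: ip_commute[of h e] ip_commute[of e "\<lambda>_. 0"])
  have unit: "distributed M lborel (w (\<lambda>t. 1 * e t + b * h t)) std_normal_density" for b
  proof (rule w_distributed_unit)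
    show L: "(\<lambda>t. 1 * e t + b * h t) \<in> Ltwo" using e h by (intro Ltwo_lincomb)
    show "ip (\<lambda>t. 1 * e t + b * h t) (\<lambda>t. 1 * e t + b * h t) = 1"
      by (subst ip_lincomb[OF e(1) h(1) L])
        (simp only: ip_commute[of e "\<lambda>t. 1 * e t + b * h t"] ip_commute[of h "\<lambda>t. 1 * e t + b * h t"]
          ip_lincomb[OF e(1) h(1) e(1)] ip_lincomb[OF e(1) h(1) h(1)] e h eh, simp)
  qed
  define p m where "p = w (\<lambda>t. 1 * e t + 1 * h t)" and "m = w (\<lambda>t. 1 * e t + (-1) * h t)"
  have D: "distributed M lborel p std_normal_density" "distributed M lborel m std_normal_density"
    "distributed M lborel (w e) std_normal_density"
    using unit[of 1] unit[of "-1"] w_distributed_unit[OF e] by (auto simp: p_def m_def)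
  \<comment> \<open>All three squares have expectation 1, so \<open>?F\<close> has mean 0, while
    almost surely it equals the nonnegative variable \<open>2 * (w h \<omega>)\<^sup>2\<close>,
    which must therefore vanish.\<close>
  let ?F = "\<lambda>\<omega>. (p \<omega>)\<^sup>2 + (m \<omega>)\<^sup>2 - 2 * (w e \<omega>)\<^sup>2"
  have ae: "AE \<omega> in M. 2 * (w h \<omega>)\<^sup>2 = ?F \<omega>"
    using w_lincomb[OF e(1) h(1), of 1 1] w_lincomb[OF e(1) h(1), of 1 "-1"]
  proof eventually_elim
    case (elim \<omega>)
    then have pm: "p \<omega> = w e \<omega> + w h \<omega>" "m \<omega> = w e \<omega> - w h \<omega>" by (simp_all add: p_def m_def)
    show ?case by (simp only: pm) (simp add: power2_eq_square algebra_simps)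
  qed
  have iF: "integrable M ?F" using D std_normal_moment_integrable by auto
  have "integral\<^sup>L M ?F = 0"
    using D std_normal_moment_integrable std_normal_moments(2) by simp
  then have "(\<integral>\<omega>. 2 * (w h \<omega>)\<^sup>2 \<partial>M) = 0"
    using ae h iF by (subst integral_cong_AE[of _ _ ?F]) (auto intro: borel_measurable_integrable)
  moreover have "integrable M (\<lambda>\<omega>. 2 * (w h \<omega>)\<^sup>2)"
    using ae h iF by (subst integrable_cong_AE[of _ _ ?F]) (auto intro: borel_measurable_integrable)
  ultimately have "AE \<omega> in M. 2 * (w h \<omega>)\<^sup>2 = 0"
    by (subst (asm) integral_nonneg_eq_0_iff_AE) auto
  then show ?thesis by simp
qed

text \<open>Elements of \<open>Ltwo\<close> are functions rather than classes, so invariance under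
  changes on null sets has to be derived from linearity and \<open>w_null\<close>.\<close>

lemma w_cong_AE:
  assumes "g \<in> Ltwo" "h \<in> Ltwo" "AE t in leb. g t = h t"
  shows "AE \<omega> in M. w g \<omega> = w h \<omega>"
proof -
  have L: "(\<lambda>t. 1 * g t + (-1) * h t) \<in> Ltwo" using assms by (intro Ltwo_lincomb)
  have "AE t in leb. 1 * g t + (-1) * h t = 0"
    using assms(3) by eventually_elim simp
  then have "AE \<omega> in M. w (\<lambda>t. 1 * g t + (-1) * h t) \<omega> = 0"
    using ip_self_eq_0_iff[OF L] w_null[OF L] by blast
  with w_lincomb[OF assms(1,2), of 1 "-1"] show ?thesis by eventually_elim simp
qed

lemma w_sum:
  assumes "finite I" "\<And>i. i \<in> I \<Longrightarrow> g i \<in> Ltwo"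
  shows "AE \<omega> in M. w (\<lambda>t. \<Sum>i\<in>I. c i * g i t) \<omega> = (\<Sum>i\<in>I. c i * w (g i) \<omega>)"
  using assms
proof (induction I rule: finite_induct)
  case empty
  show ?case using w_null[OF Ltwo_0] by simp
next
  case (insert x F)
  have "(\<lambda>t. \<Sum>i\<in>F. c i * g i t) \<in> Ltwo" using insert by (intro Ltwo_sum) auto
  then have "AE \<omega> in M. w (\<lambda>t. c x * g x t + 1 * (\<Sum>i\<in>F. c i * g i t)) \<omega> =
     c x * w (g x) \<omega> + 1 * w (\<lambda>t. \<Sum>i\<in>F. c i * g i t) \<omega>"
    using insert by (intro w_lincomb) auto
  moreover have "AE \<omega> in M. w (\<lambda>t. \<Sum>i\<in>F. c i * g i t) \<omega> = (\<Sum>i\<in>F. c i * w (g i) \<omega>)"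
    using insert by auto
  ultimately show ?case unfolding sum.insert[OF insert.hyps] by eventually_elim simp
qed

text \<open>On cylinders, independence factors both sides into one-dimensional integrals, and in
  each of these the tilt amounts to a shift of the mean.\<close>

lemma shift_coordinates:
  assumes on: "orthonormal_family {1..J} e"
  shows "distr (density M (\<lambda>\<omega>. ennreal (\<Prod>l=1..J. exp (\<tau> l * w (e l) \<omega> - (\<tau> l)\<^sup>2 / 2))))
           (Pi\<^sub>M {1..J} (\<lambda>_. borel)) (\<lambda>\<omega>. \<lambda>l\<in>{1..J}. w (e l) \<omega>) =
         distr M (Pi\<^sub>M {1..J} (\<lambda>_. borel)) (\<lambda>\<omega>. \<lambda>l\<in>{1..J}. w (e l) \<omega> + \<tau> l)"
    (is "distr (density M ?L) ?P ?X = distr M ?P ?Y")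
proof (rule sym, rule measure_eqI_PiM_infinite)
  have [measurable]: "w (e l) \<in> borel_measurable M" if "l \<in> {1..J}" for l
    using on that by (auto simp: orthonormal_family_def intro: w_measurable)
  have mX: "?X \<in> measurable M ?P" "?Y \<in> measurable M ?P" by (auto intro!: measurable_restrict)
  have mL: "?L \<in> borel_measurable M" by measurable
  show "finite_measure (distr M ?P ?Y)"
    using mX by (intro prob_space.finite_measure prob_space_distr)
  fix A :: "nat \<Rightarrow> real set" and K assume K: "finite K" "K \<subseteq> {1..J}" "\<And>i. i \<in> K \<Longrightarrow> A i \<in> sets borel"
  \<comment> \<open>Unconstrained coordinates get the whole line, so that the indicator of the
    cylinder becomes a product over all of \<open>{1..J}\<close>.\<close>
  define B where "B i = (if i \<in> K then A i else UNIV)" for i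
  have [measurable]: "B i \<in> sets borel" for i using K by (auto simp: B_def)
  let ?E = "prod_emb {1..J} (\<lambda>_. borel) K (Pi\<^sub>E K A)"
  have E: "?E \<in> sets ?P" using K by (intro sets_PiM_I) auto
  have ind: "indicator ?E (\<lambda>l\<in>{1..J}. x l) = (\<Prod>l=1..J. indicator (B l) (x l) :: ennreal)" for x :: "nat \<Rightarrow> real"
  proof -
    have "(\<lambda>l\<in>{1..J}. x l) \<in> ?E \<longleftrightarrow> (\<forall>l\<in>{1..J}. x l \<in> B l)"
      using K by (auto simp: prod_emb_def B_def PiE_iff space_PiM)
    then show ?thesis by (auto simp: indicator_def prod_zero_iff)
  qed
  have iv: "indep_vars (\<lambda>_. borel) (\<lambda>l. w (e l)) {1..J}" using w_indep[OF on] .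
  have "emeasure (distr (density M ?L) ?P ?X) ?E = (\<integral>\<^sup>+y. indicator ?E y \<partial>distr (density M ?L) ?P ?X)"
    using E by simp
  also have "\<dots> = (\<integral>\<^sup>+\<omega>. ?L \<omega> * indicator ?E (?X \<omega>) \<partial>M)"
    using mX mL E by (subst nn_integral_distr) (auto simp: nn_integral_density)
  also have "\<dots> = (\<integral>\<^sup>+\<omega>. (\<Prod>l=1..J. ennreal (exp (\<tau> l * w (e l) \<omega> - (\<tau> l)\<^sup>2 / 2)) * indicator (B l) (w (e l) \<omega>)) \<partial>M)"
    unfolding ind by (simp add: prod.distrib prod_ennreal)
  also have "\<dots> = (\<Prod>l=1..J. \<integral>\<^sup>+\<omega>. ennreal (exp (\<tau> l * w (e l) \<omega> - (\<tau> l)\<^sup>2 / 2)) * indicator (B l) (w (e l) \<omega>) \<partial>M)"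
    by (intro indep_vars_nn_integral indep_vars_compose2[OF iv]) auto
  also have "\<dots> = (\<Prod>l=1..J. \<integral>\<^sup>+\<omega>. indicator (B l) (w (e l) \<omega> + \<tau> l) \<partial>M)"
  proof (intro prod.cong refl)
    fix l assume l: "l \<in> {1..J}"
    note D = w_distributed[OF on l]
    show "(\<integral>\<^sup>+\<omega>. ennreal (exp (\<tau> l * w (e l) \<omega> - (\<tau> l)\<^sup>2 / 2)) * indicator (B l) (w (e l) \<omega>) \<partial>M) =
      (\<integral>\<^sup>+\<omega>. indicator (B l) (w (e l) \<omega> + \<tau> l) \<partial>M)"
      using distributed_nn_integral[OF D, of "\<lambda>x. ennreal (exp (\<tau> l * x - (\<tau> l)\<^sup>2 / 2)) * indicator (B l) x"]
        distributed_nn_integral[OF D, of "\<lambda>x. indicator (B l) (x + \<tau> l)"]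
        std_normal_shift[of "indicator (B l)" "\<tau> l"] by simp
  qed
  also have "\<dots> = (\<integral>\<^sup>+\<omega>. (\<Prod>l=1..J. indicator (B l) (w (e l) \<omega> + \<tau> l)) \<partial>M)"
    by (intro indep_vars_nn_integral[symmetric] indep_vars_compose2[OF iv]) auto
  also have "\<dots> = (\<integral>\<^sup>+\<omega>. indicator ?E (?Y \<omega>) \<partial>M)" unfolding ind ..
  also have "\<dots> = (\<integral>\<^sup>+y. indicator ?E y \<partial>distr M ?P ?Y)"
    using mX E by (subst nn_integral_distr) auto
  also have "\<dots> = emeasure (distr M ?P ?Y) ?E" using E by simp
  finally show "emeasure (distr M ?P ?Y) ?E = emeasure (distr (density M ?L) ?P ?X) ?E" ..
qed simp_all

lemma obs_measurable [measurable]: "obs w \<sigma> n f \<in> measurable M obs_space"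
  unfolding obs_def obs_space_def by (intro measurable_restrict) auto

text \<open>A finite measure on the product space is determined by cylinders over finite sets
  \<open>G\<close>. For given \<open>G\<close>, the vectors \<phi> 1, ..., \<phi> J are enlarged to
  an orthonormal family spanning \<open>G\<close> almost everywhere; both observations then depend,
  almost surely, on finitely many independent normal variables, and \<open>shift_coordinates\<close>
  applies.\<close>

lemma girsanov:
  fixes \<theta> :: "nat \<Rightarrow> real" and J :: nat
  assumes "\<sigma> > 0" "n \<ge> 1"
  defines "f \<equiv> \<lambda>t. \<Sum>j=1..J. \<theta> j * \<phi> j t"
  defines "\<Lambda> \<equiv> \<lambda>\<omega>. \<Prod>j=1..J. exp (sqrt (real n) * \<theta> j / \<sigma> * w (\<phi> j) \<omega> - (sqrt (real n) * \<theta> j / \<sigma>)\<^sup>2 / 2)"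
  shows "distr M obs_space (obs w \<sigma> n f) =
         distr (density M (\<lambda>\<omega>. ennreal (\<Lambda> \<omega>))) obs_space (obs w \<sigma> n (\<lambda>_. 0))"
proof (rule measure_eqI_PiM_infinite[where I=Ltwo and M="\<lambda>_. borel"])
  have mL: "(\<lambda>\<omega>. ennreal (\<Lambda> \<omega>)) \<in> borel_measurable M" unfolding \<Lambda>_def by measurable
  show "finite_measure (distr M obs_space (obs w \<sigma> n f))"
    by (intro prob_space.finite_measure prob_space_distr obs_measurable)
  show "sets (distr M obs_space (obs w \<sigma> n f)) = sets (Pi\<^sub>M Ltwo (\<lambda>_. borel))"
    "sets (distr (density M (\<lambda>\<omega>. ennreal (\<Lambda> \<omega>))) obs_space (obs w \<sigma> n (\<lambda>_. 0))) = sets (Pi\<^sub>M Ltwo (\<lambda>_. borel))"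
    by (simp_all add: obs_space_def)
  fix A :: "(real \<Rightarrow> real) \<Rightarrow> real set" and G
  assume G: "finite G" "G \<subseteq> Ltwo" and A: "\<And>g. g \<in> G \<Longrightarrow> A g \<in> sets borel"
  let ?E = "prod_emb Ltwo (\<lambda>_. borel) G (Pi\<^sub>E G A)"
  have E: "?E \<in> sets obs_space" unfolding obs_space_def using G A by (intro sets_PiM_I) auto
  have obs_E: "obs w \<sigma> n h \<omega> \<in> ?E \<longleftrightarrow> (\<forall>g\<in>G. ip h g + \<sigma> / sqrt (real n) * w g \<omega> \<in> A g)" for h \<omega>
    using G by (auto simp: prod_emb_def PiE_iff space_PiM obs_def subset_eq)
  have famJ: "orthonormal_family {1..J} \<phi>" using basis_family by (rule orthonormal_family_subset) auto
  obtain J' e where J': "J \<le> J'" and on: "orthonormal_family {1..J'} e" and ej: "\<forall>j\<in>{1..J}. e j = \<phi> j"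
    and ex: "\<forall>g\<in>G. \<exists>c. AE t in leb. g t = (\<Sum>l=1..J'. c l * e l t)"
    using gram_schmidt[OF G famJ] by blast
  from ex obtain c where c: "\<And>g. g \<in> G \<Longrightarrow> AE t in leb. g t = (\<Sum>l=1..J'. c g l * e l t)"
    by metis
  have eL: "e l \<in> Ltwo" if "l \<in> {1..J'}" for l using on that by (auto simp: orthonormal_family_def)
  have SL: "(\<lambda>t. \<Sum>l=1..J'. c g l * e l t) \<in> Ltwo" for g using eL by (intro Ltwo_sum)
  \<comment> \<open>The drift has no component beyond \<open>J\<close>, so the added vectors
    contribute factors 1 and the likelihood ratio does not depend on \<open>G\<close>.\<close>
  define \<tau> where "\<tau> l = (if l \<le> J then sqrt (real n) * \<theta> l / \<sigma> else 0)" for l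
  have f_eq: "f = (\<lambda>t. \<Sum>l=1..J'. (\<sigma> / sqrt (real n) * \<tau> l) * e l t)"
  proof
    fix t
    have "(\<Sum>l=1..J'. (\<sigma> / sqrt (real n) * \<tau> l) * e l t) = (\<Sum>l=1..J. (\<sigma> / sqrt (real n) * \<tau> l) * e l t)"
      using J' by (intro sum.mono_neutral_right) (auto simp: \<tau>_def)
    also have "\<dots> = f t" unfolding f_def using assms(1,2) ej by (intro sum.cong) (auto simp: \<tau>_def)
    finally show "f t = (\<Sum>l=1..J'. (\<sigma> / sqrt (real n) * \<tau> l) * e l t)" ..
  qed
  have ipf: "ip f g = (\<Sum>l=1..J'. (\<sigma> / sqrt (real n) * \<tau> l) * c g l)" if "g \<in> G" for g
  proof -
    have gL: "g \<in> Ltwo" using that G by auto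
    have "ip f g = (\<Sum>l=1..J'. (\<sigma> / sqrt (real n) * \<tau> l) * ip (e l) g)"
      unfolding f_eq using eL gL by (intro ip_sum)
    also have "\<dots> = (\<Sum>l=1..J'. (\<sigma> / sqrt (real n) * \<tau> l) * c g l)"
    proof (intro sum.cong refl)
      fix l assume l: "l \<in> {1..J'}"
      have "ip (e l) g = ip (e l) (\<lambda>t. \<Sum>l=1..J'. c g l * e l t)"
        using gL SL eL[OF l] c[OF that] by (rule ip_cong_AE)
      also have "\<dots> = c g l"
        using orthonormal_family_sum_ip[OF on, of "{1..J'}" l "c g"] l by (simp add: ip_commute[of "e l"])
      finally show "(\<sigma> / sqrt (real n) * \<tau> l) * ip (e l) g = (\<sigma> / sqrt (real n) * \<tau> l) * c g l" by simp
    qed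
    finally show ?thesis .
  qed
  have wg: "AE \<omega> in M. \<forall>g\<in>G. w g \<omega> = (\<Sum>l=1..J'. c g l * w (e l) \<omega>)"
  proof (rule AE_finite_allI[OF G(1)])
    fix g assume g: "g \<in> G"
    have "AE \<omega> in M. w g \<omega> = w (\<lambda>t. \<Sum>l=1..J'. c g l * e l t) \<omega>"
      using G g SL c by (intro w_cong_AE) auto
    moreover have "AE \<omega> in M. w (\<lambda>t. \<Sum>l=1..J'. c g l * e l t) \<omega> = (\<Sum>l=1..J'. c g l * w (e l) \<omega>)"
      using eL by (intro w_sum) auto
    ultimately show "AE \<omega> in M. w g \<omega> = (\<Sum>l=1..J'. c g l * w (e l) \<omega>)" by eventually_elim simp
  qed
  let ?P = "Pi\<^sub>M {1..J'} (\<lambda>_. borel :: real measure)"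
  \<comment> \<open>The cylinder read as an event about the coordinates under the null; evaluating
    it at the coordinates shifted by \<open>\<tau>\<close> gives the event under
    \<open>f\<close>.\<close>
  define B where "B = {x \<in> space ?P. \<forall>g\<in>G. \<sigma> / sqrt (real n) * (\<Sum>l=1..J'. c g l * x l) \<in> A g}"
  have B: "B \<in> sets ?P"
  proof -
    have "Measurable.pred ?P (\<lambda>x. \<sigma> / sqrt (real n) * (\<Sum>l=1..J'. c g l * x l) \<in> A g)" if "g \<in> G" for g
      using A[OF that] by measurable
    then show ?thesis unfolding B_def using G(1) by measurable
  qed
  have [measurable]: "w (e l) \<in> borel_measurable M" if "l \<in> {1..J'}" for l using eL[OF that] by simp
  define X Y where "X = (\<lambda>\<omega>. \<lambda>l\<in>{1..J'}. w (e l) \<omega>)" and "Y = (\<lambda>\<omega>. \<lambda>l\<in>{1..J'}. w (e l) \<omega> + \<tau> l)"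
  have mX: "X \<in> measurable M ?P" "Y \<in> measurable M ?P" unfolding X_def Y_def by (auto intro!: measurable_restrict)
  have XB: "X \<omega> \<in> B \<longleftrightarrow> (\<forall>g\<in>G. \<sigma> / sqrt (real n) * (\<Sum>l=1..J'. c g l * w (e l) \<omega>) \<in> A g)" for \<omega>
    unfolding B_def X_def by (auto simp: space_PiM)
  have YB: "Y \<omega> \<in> B \<longleftrightarrow> (\<forall>g\<in>G. \<sigma> / sqrt (real n) * (\<Sum>l=1..J'. c g l * (w (e l) \<omega> + \<tau> l)) \<in> A g)" for \<omega>
    unfolding B_def Y_def by (auto simp: space_PiM)
  have aeY: "AE \<omega> in M. obs w \<sigma> n f \<omega> \<in> ?E \<longleftrightarrow> Y \<omega> \<in> B"
    using wg
  proof eventually_elim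
    case (elim \<omega>)
    have "ip f g + \<sigma> / sqrt (real n) * w g \<omega> = \<sigma> / sqrt (real n) * (\<Sum>l=1..J'. c g l * (w (e l) \<omega> + \<tau> l))"
      if "g \<in> G" for g
      using elim that ipf[OF that] by (simp add: sum_distrib_left sum.distrib algebra_simps)
    then show ?case unfolding obs_E YB by simp
  qed
  have aeX: "AE \<omega> in M. obs w \<sigma> n (\<lambda>_. 0) \<omega> \<in> ?E \<longleftrightarrow> X \<omega> \<in> B"
    using wg by eventually_elim (simp add: obs_E XB)
  have Leq: "\<Lambda> \<omega> = (\<Prod>l=1..J'. exp (\<tau> l * w (e l) \<omega> - (\<tau> l)\<^sup>2 / 2))" for \<omega>
  proof -
    have "(\<Prod>l=1..J'. exp (\<tau> l * w (e l) \<omega> - (\<tau> l)\<^sup>2 / 2)) = (\<Prod>l=1..J. exp (\<tau> l * w (e l) \<omega> - (\<tau> l)\<^sup>2 / 2))"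
      using J' by (intro prod.mono_neutral_right) (auto simp: \<tau>_def)
    also have "\<dots> = \<Lambda> \<omega>" unfolding \<Lambda>_def using ej by (intro prod.cong) (auto simp: \<tau>_def)
    finally show ?thesis ..
  qed
  have "emeasure (distr M obs_space (obs w \<sigma> n f)) ?E = (\<integral>\<^sup>+\<omega>. indicator ?E (obs w \<sigma> n f \<omega>) \<partial>M)"
    using E by (simp add: nn_integral_distr flip: nn_integral_indicator)
  also have "\<dots> = (\<integral>\<^sup>+\<omega>. indicator B (Y \<omega>) \<partial>M)"
    using aeY by (intro nn_integral_cong_AE) (auto simp: indicator_def)
  also have "\<dots> = emeasure (distr M ?P Y) B"
    using B mX by (simp add: nn_integral_distr flip: nn_integral_indicator)
  also have "\<dots> = emeasure (distr (density M (\<lambda>\<omega>. ennreal (\<Lambda> \<omega>))) ?P X) B"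
    unfolding X_def Y_def Leq using shift_coordinates[OF on, of \<tau>] by simp
  also have "\<dots> = (\<integral>\<^sup>+\<omega>. ennreal (\<Lambda> \<omega>) * indicator B (X \<omega>) \<partial>M)"
    using B mX mL by (simp add: nn_integral_distr nn_integral_density flip: nn_integral_indicator)
  also have "\<dots> = (\<integral>\<^sup>+\<omega>. ennreal (\<Lambda> \<omega>) * indicator ?E (obs w \<sigma> n (\<lambda>_. 0) \<omega>) \<partial>M)"
    using aeX by (intro nn_integral_cong_AE) (auto simp: indicator_def)
  also have "\<dots> = emeasure (distr (density M (\<lambda>\<omega>. ennreal (\<Lambda> \<omega>))) obs_space (obs w \<sigma> n (\<lambda>_. 0))) ?E"
    using E mL by (simp add: nn_integral_distr nn_integral_density flip: nn_integral_indicator)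
  finally show "emeasure (distr M obs_space (obs w \<sigma> n f)) ?E =
    emeasure (distr (density M (\<lambda>\<omega>. ennreal (\<Lambda> \<omega>))) obs_space (obs w \<sigma> n (\<lambda>_. 0))) ?E" .
qed

text \<open>Integrability is stated separately because the likelihood ratio is unbounded; it is
  inherited from the bounded integrand under the law with drift.\<close>

lemma type_II_girsanov:
  fixes \<theta> :: "nat \<Rightarrow> real"
  assumes "\<sigma> > 0" "n \<ge> 1" and K: "is_test K"
  shows "type_II M w \<sigma> n K (\<lambda>t. \<Sum>j=1..J. \<theta> j * \<phi> j t) =
    (\<integral>\<omega>. (\<Prod>j=1..J. exp (sqrt (real n) * \<theta> j / \<sigma> * w (\<phi> j) \<omega> - (sqrt (real n) * \<theta> j / \<sigma>)\<^sup>2 / 2)) *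
        (1 - K (obs w \<sigma> n (\<lambda>_. 0) \<omega>)) \<partial>M)" (is "_ = (\<integral>\<omega>. ?L \<omega> * _ \<partial>M)")
    and "integrable M (\<lambda>\<omega>. (\<Prod>j=1..J. exp (sqrt (real n) * \<theta> j / \<sigma> * w (\<phi> j) \<omega> - (sqrt (real n) * \<theta> j / \<sigma>)\<^sup>2 / 2)) *
        (1 - K (obs w \<sigma> n (\<lambda>_. 0) \<omega>)))"
proof -
  let ?f = "\<lambda>t. \<Sum>j=1..J. \<theta> j * \<phi> j t"
  have [measurable]: "K \<in> borel_measurable obs_space" using K by (simp add: is_test_def)
  have Kb: "0 \<le> K (obs w \<sigma> n g \<omega>) \<and> K (obs w \<sigma> n g \<omega>) \<le> 1" if "\<omega> \<in> space M" for g \<omega>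
    using K measurable_space[OF obs_measurable that] by (auto simp: is_test_def)
  have mL: "?L \<in> borel_measurable M" by measurable
  have L0: "?L \<omega> \<ge> 0" for \<omega> by (intro prod_nonneg) auto
  note G = girsanov[OF assms(1,2), of \<theta> J]
  have "type_II M w \<sigma> n K ?f = (\<integral>y. 1 - K y \<partial>distr M obs_space (obs w \<sigma> n ?f))"
    unfolding type_II_def by (subst integral_distr) auto
  also have "\<dots> = (\<integral>\<omega>. 1 - K (obs w \<sigma> n (\<lambda>_. 0) \<omega>) \<partial>density M (\<lambda>\<omega>. ennreal (?L \<omega>)))"
    unfolding G by (subst integral_distr) (auto simp: measurable_density_eq1 intro: measurable_compose)
  also have "\<dots> = (\<integral>\<omega>. ?L \<omega> * (1 - K (obs w \<sigma> n (\<lambda>_. 0) \<omega>)) \<partial>M)"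
    using L0 mL by (subst integral_real_density) auto
  finally show "type_II M w \<sigma> n K ?f = (\<integral>\<omega>. ?L \<omega> * (1 - K (obs w \<sigma> n (\<lambda>_. 0) \<omega>)) \<partial>M)" .
  have "integrable M (\<lambda>\<omega>. 1 - K (obs w \<sigma> n ?f \<omega>))"
    using Kb by (intro integrable_const_bound[of _ 1]) auto
  then have "integrable (distr M obs_space (obs w \<sigma> n ?f)) (\<lambda>y. 1 - K y)"
    by (subst integrable_distr_eq) auto
  then have "integrable (density M (\<lambda>\<omega>. ennreal (?L \<omega>))) (\<lambda>\<omega>. 1 - K (obs w \<sigma> n (\<lambda>_. 0) \<omega>))"
    unfolding G by (subst (asm) integrable_distr_eq) auto
  then show "integrable M (\<lambda>\<omega>. ?L \<omega> * (1 - K (obs w \<sigma> n (\<lambda>_. 0) \<omega>)))"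
    using L0 mL by (subst (asm) integrable_real_density) auto
qed

end

section \<open>Weak convergence\<close>

text \<open>If \<open>P\<close> failed infinitely often, \<open>a\<close> would converge along some
  subsequence of the failures. Limit theorems can thus be applied at a convergent value of a merely
  bounded sequence, and one success per subsequence suffices.\<close>

lemma eventually_by_subseq:
  fixes a :: "nat \<Rightarrow> real"
  assumes "bounded (range a)"
    and "\<And>r l. strict_mono r \<Longrightarrow> (\<lambda>n. a (r n)) \<longlonglongrightarrow> l \<Longrightarrow> \<exists>n. P (r n)"
  shows "eventually P sequentially"
proof (rule ccontr)
  assume "\<not> eventually P sequentially"
  from not_eventually_sequentiallyD[OF this]
  obtain r :: "nat \<Rightarrow> nat" where r: "strict_mono r" "\<forall>n. \<not> P (r n)" by auto
  have "bounded (range (\<lambda>n. a (r n)))" using assms(1) by (rule bounded_subset) auto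
  then obtain l q where q: "strict_mono q" "((\<lambda>n. a (r n)) \<circ> q) \<longlonglongrightarrow> l"
    using bounded_imp_convergent_subsequence by blast
  have "\<exists>n. P ((r \<circ> q) n)"
    using q by (intro assms(2)[of "r \<circ> q" l] strict_mono_o r) (simp_all add: o_def)
  with r show False by auto
qed

interpretation std_normal: real_distribution std_normal_distribution
  by (rule real_dist_normal_dist)

lemma std_normal_integral:
  fixes f :: "real \<Rightarrow> real"
  assumes "f \<in> borel_measurable borel"
  shows "integral\<^sup>L std_normal_distribution f = (\<integral>x. std_normal_density x * f x \<partial>lborel)"
  using assms by (subst integral_real_density) auto

lemma std_normal_cdf_eq_integral:
  "std_normal_cdf x = (\<integral>y. indicator {..x} y \<partial>std_normal_distribution)"
  by (simp add: std_normal_cdf_def cdf_def2)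

lemma std_normal_cdf_mono: "x \<le> y \<Longrightarrow> std_normal_cdf x \<le> std_normal_cdf y"
  unfolding std_normal_cdf_def by (rule std_normal.cdf_nondecreasing)

lemma std_normal_cdf_bounds: "0 \<le> std_normal_cdf x" "std_normal_cdf x \<le> 1"
  unfolding std_normal_cdf_def by (rule std_normal.cdf_nonneg, rule std_normal.cdf_bounded_prob)

lemma std_normal_density_le_1: "std_normal_density x \<le> 1"
proof -
  have "1 \<le> sqrt (2 * pi)" using pi_gt3 by simp
  then have "1 / sqrt (2 * pi) \<le> 1" by simp
  moreover have "exp (- x\<^sup>2 / 2) \<le> 1" by simp
  ultimately show ?thesis unfolding std_normal_density_def
    by (intro mult_le_one) auto
qed

text \<open>The density is at most 1. The constant 1 lets errors in the argument be carried over
  unchanged to errors of the risk.\<close>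

lemma std_normal_cdf_lipschitz:
  assumes "x \<le> y"
  shows "std_normal_cdf y - std_normal_cdf x \<le> y - x"
proof -
  have "std_normal_cdf y - std_normal_cdf x = measure std_normal_distribution {x<..y}"
  proof (cases "x = y")
    case False
    then show ?thesis using assms by (simp add: std_normal_cdf_def std_normal.cdf_diff_eq)
  qed simp
  also have "\<dots> = (\<integral>z. std_normal_density z * indicator {x<..y} z \<partial>lborel)"
    using std_normal_integral[of "indicator {x<..y}"] by simp
  also have "\<dots> \<le> (\<integral>z. indicator {x<..y} z \<partial>lborel)"
  proof (rule integral_mono)
    show "integrable lborel (\<lambda>z. std_normal_density z * indicator {x<..y} z)"
      by (rule integrable_real_mult_indicator) auto
    show "integrable lborel (indicator {x<..y} :: real \<Rightarrow> real)" using assms by simp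
  qed (auto simp: indicator_def std_normal_density_le_1)
  also have "\<dots> = y - x" using assms by simp
  finally show ?thesis .
qed

lemma abs_std_normal_cdf_diff_le: "\<bar>std_normal_cdf x - std_normal_cdf y\<bar> \<le> \<bar>x - y\<bar>"
  using std_normal_cdf_lipschitz[of x y] std_normal_cdf_lipschitz[of y x]
    std_normal_cdf_mono[of x y] std_normal_cdf_mono[of y x] by (cases "x \<le> y") auto

text \<open>A vanishing value would force a half-line to be a Lebesgue null set, the density being
  positive. Positivity is what turns additive errors of the risk into relative ones.\<close>

lemma std_normal_cdf_pos: "0 < std_normal_cdf x"
proof -
  have "std_normal_cdf x \<noteq> 0"
  proof
    assume "std_normal_cdf x = 0"
    then have "(\<integral>z. std_normal_density z * indicator {..x} z \<partial>lborel) = 0"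
      using std_normal_integral[of "indicator {..x}"] by (simp add: std_normal_cdf_eq_integral)
    moreover have "integrable lborel (\<lambda>z. std_normal_density z * indicator {..x} z)"
      by (rule integrable_real_mult_indicator) auto
    ultimately have "AE z in lborel. std_normal_density z * indicator {..x} z = 0"
      by (subst (asm) integral_nonneg_eq_0_iff_AE) auto
    then have "AE z in lborel. z \<notin> {..x}"
    proof eventually_elim
      case (elim z)
      have "std_normal_density z \<noteq> 0" using normal_density_pos[of 1 0 z] by simp
      then show ?case using elim by (auto simp: indicator_def)
    qed
    then have "emeasure lborel {..x} = 0" by (subst (asm) AE_iff_measurable[of "{..x}"]) auto
    moreover have "emeasure lborel {x - 1..x} \<le> emeasure lborel {..x}" by (intro emeasure_mono) auto
    ultimately show False by simp
  qed
  then show ?thesis using std_normal_cdf_bounds(1)[of x] by simp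
qed

lemma isCont_std_normal_cdf: "isCont (cdf std_normal_distribution) x"
proof -
  have "continuous (at x) std_normal_cdf"
    unfolding continuous_at_eps_delta
  proof (intro allI impI)
    fix e :: real assume e: "e > 0"
    show "\<exists>d>0. \<forall>x'. dist x' x < d \<longrightarrow> dist (std_normal_cdf x') (std_normal_cdf x) < e"
    proof (intro exI[of _ e] conjI allI impI)
      fix x' assume "dist x' x < e"
      then show "dist (std_normal_cdf x') (std_normal_cdf x) < e"
        using abs_std_normal_cdf_diff_le[of x' x] by (simp add: dist_real_def)
    qed (fact e)
  qed
  then show ?thesis by (simp add: std_normal_cdf_def)
qed

text \<open>The points \<open>z n\<close> need not converge. Along a subsequence with limit
  \<open>l\<close>, monotonicity encloses the value at \<open>z n\<close> between the values at
  \<open>l - d\<close> and \<open>l + d\<close>, where pointwise convergence is available.\<close>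

lemma cdf_moving_point:
  assumes \<mu>: "\<And>n. real_distribution (\<mu> n)" and conv: "weak_conv_m \<mu> std_normal_distribution"
    and z: "bounded (range z)"
  shows "(\<lambda>n. cdf (\<mu> n) (z n) - std_normal_cdf (z n)) \<longlonglongrightarrow> 0"
proof (rule LIMSEQ_I)
  fix e :: real assume e: "e > 0"
  have ptw: "(\<lambda>n. cdf (\<mu> n) x) \<longlonglongrightarrow> std_normal_cdf x" for x
    using conv isCont_std_normal_cdf by (auto simp: weak_conv_m_def weak_conv_def std_normal_cdf_def)
  have "\<forall>\<^sub>F n in sequentially. \<bar>cdf (\<mu> n) (z n) - std_normal_cdf (z n)\<bar> < e"
    using z
  proof (rule eventually_by_subseq)
    fix r :: "nat \<Rightarrow> nat" and l assume r: "strict_mono r" and l: "(\<lambda>n. z (r n)) \<longlonglongrightarrow> l"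
    \<comment> \<open>The total error stays below \<open>3 * d\<close>: one \<open>d\<close> from
      convergence at the fixed points and at most \<open>2 * d\<close> from the Lipschitz
      bound.\<close>
    define d where "d = e / 4"
    have d: "d > 0" using e by (simp add: d_def)
    have "\<forall>\<^sub>F n in sequentially. \<bar>z (r n) - l\<bar> < d"
      using tendstoD[OF l d] by (simp add: dist_real_def)
    moreover have "\<forall>\<^sub>F n in sequentially. \<bar>cdf (\<mu> (r n)) (l + d) - std_normal_cdf (l + d)\<bar> < d"
      using eventually_subseq[OF r tendstoD[OF ptw d, of "l + d"]] by (simp add: dist_real_def)
    moreover have "\<forall>\<^sub>F n in sequentially. \<bar>cdf (\<mu> (r n)) (l - d) - std_normal_cdf (l - d)\<bar> < d"
      using eventually_subseq[OF r tendstoD[OF ptw d, of "l - d"]] by (simp add: dist_real_def)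
    ultimately have "\<forall>\<^sub>F n in sequentially. \<bar>cdf (\<mu> (r n)) (z (r n)) - std_normal_cdf (z (r n))\<bar> < e"
    proof eventually_elim
      case (elim n)
      interpret real_distribution "\<mu> (r n)" by (rule \<mu>)
      have zl: "z (r n) \<le> l + d" "l - d \<le> z (r n)" using elim by linarith+
      have "cdf (\<mu> (r n)) (z (r n)) \<le> cdf (\<mu> (r n)) (l + d)" "cdf (\<mu> (r n)) (l - d) \<le> cdf (\<mu> (r n)) (z (r n))"
        using elim by (auto intro!: cdf_nondecreasing)
      moreover have "std_normal_cdf (l + d) \<le> std_normal_cdf (z (r n)) + 2 * d" 
        using std_normal_cdf_lipschitz[OF zl(1)] elim by linarith
      moreover have "std_normal_cdf (z (r n)) \<le> std_normal_cdf (l - d) + 2 * d" 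
        using std_normal_cdf_lipschitz[OF zl(2)] elim by linarith
      ultimately show ?case using elim d unfolding d_def by linarith
    qed
    then show "\<exists>n. \<bar>cdf (\<mu> (r n)) (z (r n)) - std_normal_cdf (z (r n))\<bar> < e"
      by (rule eventually_happens'[OF sequentially_bot])
  qed
  then show "\<exists>no. \<forall>n\<ge>no. norm (cdf (\<mu> n) (z n) - std_normal_cdf (z n) - 0) < e"
    by (simp add: eventually_sequentially)
qed

lemma std_normal_integral_shift:
  fixes g :: "real \<Rightarrow> real"
  assumes [measurable]: "g \<in> borel_measurable borel"
  shows "(\<integral>x. exp (\<tau> * x - \<tau>\<^sup>2 / 2) * g x \<partial>std_normal_distribution) = (\<integral>x. g (x + \<tau>) \<partial>std_normal_distribution)"
proof -
  have "(\<integral>x. exp (\<tau> * x - \<tau>\<^sup>2 / 2) * g x \<partial>std_normal_distribution)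
    = (\<integral>x. std_normal_density x * (exp (\<tau> * x - \<tau>\<^sup>2 / 2) * g x) \<partial>lborel)"
    by (rule std_normal_integral) simp
  also have "\<dots> = (\<integral>x. std_normal_density (x - \<tau>) * g x \<partial>lborel)"
    by (simp add: std_normal_density_tilt[symmetric] mult.assoc)
  also have "\<dots> = (\<integral>x. std_normal_density x * g (x + \<tau>) \<partial>lborel)"
    by (subst lborel_integral_real_affine[where c=1 and t=\<tau>]) (auto simp: add.commute)
  also have "\<dots> = (\<integral>x. g (x + \<tau>) \<partial>std_normal_distribution)"
    by (rule std_normal_integral[symmetric]) simp
  finally show ?thesis .
qed

text \<open>The Bayes risk of the Neyman-Pearson test in the limiting Gaussian shift experiment.\<close>

lemma neyman_pearson_value:
  assumes "d \<ge> 0"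
  shows "(\<integral>x. min (exp (d * x - d\<^sup>2 / 2)) (exp (d * a - d\<^sup>2 / 2)) \<partial>std_normal_distribution) =
    std_normal_cdf (a - d) + exp (d * a - d\<^sup>2 / 2) * (1 - std_normal_cdf a)"
proof -
  let ?t = "exp (d * a - d\<^sup>2 / 2)"
  \<comment> \<open>Since \<open>d \<ge> 0\<close>, the likelihood ratio is nondecreasing in
    \<open>x\<close>, so it is the minimum up to \<open>a\<close> and the constant is the minimum
    beyond. In the first part the tilt moves the mean to \<open>d\<close>, which gives the
    distribution function at \<open>a - d\<close>.\<close>
  have eq: "min (exp (d * x - d\<^sup>2 / 2)) ?t = exp (d * x - d\<^sup>2 / 2) * indicator {..a} x + ?t * (1 - indicator {..a} x)" for x
  proof (cases "x \<le> a")
    case True then show ?thesis using mult_left_mono[OF True assms] by (simp add: min_def)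
  next
    case False then show ?thesis using mult_left_mono[of a x d] assms by (auto simp: min_def)
  qed
  have i1: "integrable std_normal_distribution (\<lambda>x. exp (d * x - d\<^sup>2 / 2) * indicator {..a} x)"
  proof (rule std_normal.integrable_const_bound[where B="?t"])
    show "AE x in std_normal_distribution. norm (exp (d * x - d\<^sup>2 / 2) * indicator {..a} x) \<le> ?t"
      using assms by (intro always_eventually) (auto simp: indicator_def mult_left_mono)
  qed auto
  have i2: "integrable std_normal_distribution (\<lambda>x. indicator {..a} x :: real)"
    by (rule std_normal.integrable_const_bound[where B=1]) (auto simp: indicator_def)
  have "(\<integral>x. exp (d * x - d\<^sup>2 / 2) * indicator {..a} x \<partial>std_normal_distribution)
     = (\<integral>x. indicator {..a} (x + d) \<partial>std_normal_distribution)"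
    by (rule std_normal_integral_shift) simp
  also have "\<dots> = std_normal_cdf (a - d)"
    unfolding std_normal_cdf_eq_integral by (intro Bochner_Integration.integral_cong) (auto simp: indicator_def)
  moreover have "measure std_normal_distribution UNIV = 1" using std_normal.prob_space by simp
  ultimately show ?thesis unfolding eq using i1 i2
    by (simp add: std_normal_cdf_eq_integral)
qed

section \<open>A central limit theorem for weighted centered squares\<close>

lemma exp_minus_bounds:
  fixes y :: real
  assumes "y \<ge> 0"
  shows "\<bar>exp (- y) - (1 - y)\<bar> \<le> y\<^sup>2"
proof -
  have a: "1 + y \<le> exp y" by (rule exp_ge_add_one_self)
  have "exp (- y) * (1 + y) \<le> exp (- y) * exp y" using a by (intro mult_left_mono) auto
  also have "\<dots> = 1" by (simp add: exp_minus)
  also have "1 \<le> (1 - y + y\<^sup>2) * (1 + y)"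
  proof -
    have "(1 - y + y\<^sup>2) * (1 + y) = 1 + y ^ 3" by (simp add: power2_eq_square power3_eq_cube algebra_simps)
    then show ?thesis using assms by simp
  qed
  finally have "exp (- y) \<le> 1 - y + y\<^sup>2" using assms by (simp add: mult_le_cancel_right)
  moreover have "1 - y \<le> exp (- y)" using exp_ge_add_one_self[of "- y"] by simp
  ultimately show ?thesis by simp
qed

context prob_space begin

text \<open>The variable \<open>X\<^sup>2 - 1\<close> has mean 0 and variance 2, so with
  \<open>s = t * u\<close> its characteristic function at \<open>s\<close> is
  \<open>1 - s\<^sup>2\<close> up to a cubic error, and so is \<open>exp (- s\<^sup>2)\<close> up to
  \<open>s ^ 4\<close>. The constant \<open>C\<close> depends on the standard normal law only, hence
  is uniform over the weights.\<close>

lemma chi_square_char_bound: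
  assumes X: "distributed M lborel X std_normal_density"
  defines "C \<equiv> (\<integral>x. \<bar>x\<^sup>2 - 1\<bar> ^ 3 \<partial>std_normal_distribution) / 6"
  shows "cmod (char (distr M borel (\<lambda>\<omega>. u * ((X \<omega>)\<^sup>2 - 1))) t - exp (- (t * u)\<^sup>2)) \<le> C * \<bar>t * u\<bar> ^ 3 + (t * u) ^ 4"
proof -
  define Z where "Z = (\<lambda>\<omega>. (X \<omega>)\<^sup>2 - 1)"
  have rX [measurable]: "X \<in> borel_measurable M" using X by (auto simp: distributed_def)
  note int = std_normal_moment_integrable[OF X]
  have Z2: "(\<lambda>\<omega>. (Z \<omega>)\<^sup>2) = (\<lambda>\<omega>. X \<omega> ^ 4 - 2 * (X \<omega>)\<^sup>2 + 1)"
    by (auto simp: Z_def power2_eq_square power4_eq_xxxx algebra_simps)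
  have i1: "integrable M Z" unfolding Z_def using int by auto
  have i2: "integrable M (\<lambda>\<omega>. (Z \<omega>)\<^sup>2)" unfolding Z2 using int by auto
  have e1: "expectation Z = 0" unfolding Z_def using int std_normal_moments[OF X] by (simp add: prob_space)
  have e2: "variance Z = 2" unfolding e1 using int std_normal_moments[OF X] by (simp add: prob_space Z2)
  have Z3: "\<bar>(x\<^sup>2 - 1)\<bar> ^ 3 \<le> x ^ 6 + 3 * x ^ 4 + 3 * x\<^sup>2 + 1" for x :: real
  proof -
    have "\<bar>(x\<^sup>2 - 1)\<bar> ^ 3 \<le> (x\<^sup>2 + 1) ^ 3" by (intro power_mono) (use zero_le_power2[of x] in linarith, simp)
    also have "\<dots> = x ^ 6 + 3 * x ^ 4 + 3 * x\<^sup>2 + 1" by (simp add: power2_eq_square power3_eq_cube eval_nat_numeral algebra_simps)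
    finally show ?thesis .
  qed
  have i3: "integrable M (\<lambda>\<omega>. \<bar>Z \<omega>\<bar> ^ 3)"
  proof (rule Bochner_Integration.integrable_bound)
    show "integrable M (\<lambda>\<omega>. X \<omega> ^ 6 + 3 * X \<omega> ^ 4 + 3 * (X \<omega>)\<^sup>2 + 1)" using int by auto
    show "AE \<omega> in M. norm (\<bar>Z \<omega>\<bar> ^ 3) \<le> norm (X \<omega> ^ 6 + 3 * X \<omega> ^ 4 + 3 * (X \<omega>)\<^sup>2 + 1)"
      unfolding Z_def using Z3 by (intro always_eventually allI) (smt (verit) real_norm_def norm_power abs_abs)
  qed (simp add: Z_def)
  have C: "(\<integral>\<omega>. \<bar>Z \<omega>\<bar> ^ 3 \<partial>M) = 6 * C"
    unfolding C_def Z_def using distributed_integral[OF X, of "\<lambda>x. \<bar>x\<^sup>2 - 1\<bar> ^ 3"]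
      std_normal_integral[of "\<lambda>x. \<bar>x\<^sup>2 - 1\<bar> ^ 3"] by simp
  define s where "s = t * u"
  have "char (distr M borel (\<lambda>\<omega>. u * ((X \<omega>)\<^sup>2 - 1))) t = char (distr M borel Z) s"
    unfolding char_def Z_def s_def by (subst (1 2) integral_distr) (auto simp: mult_ac)
  moreover have "cmod (char (distr M borel Z) s - (1 - s\<^sup>2 * 2 / 2)) \<le>
    (s\<^sup>2 / 6) * expectation (\<lambda>x. min (6 * (Z x)\<^sup>2) (\<bar>s\<bar> * \<bar>Z x\<bar> ^ 3))"
    using i1 i2 e1 e2 by (intro char_approx3') (auto simp: Z_def)
  moreover have "expectation (\<lambda>x. min (6 * (Z x)\<^sup>2) (\<bar>s\<bar> * \<bar>Z x\<bar> ^ 3)) \<le> \<bar>s\<bar> * (6 * C)"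
  proof -
    have "expectation (\<lambda>x. min (6 * (Z x)\<^sup>2) (\<bar>s\<bar> * \<bar>Z x\<bar> ^ 3)) \<le> expectation (\<lambda>x. \<bar>s\<bar> * \<bar>Z x\<bar> ^ 3)"
      using i2 i3 by (intro integral_mono integrable_min) auto
    then show ?thesis using C by simp
  qed
  ultimately have b: "cmod (char (distr M borel (\<lambda>\<omega>. u * ((X \<omega>)\<^sup>2 - 1))) t - (1 - s\<^sup>2)) \<le> C * \<bar>s\<bar> ^ 3"
  proof -
    assume a: "expectation (\<lambda>x. min (6 * (Z x)\<^sup>2) (\<bar>s\<bar> * \<bar>Z x\<bar> ^ 3)) \<le> \<bar>s\<bar> * (6 * C)"
      and b: "cmod (char (distr M borel Z) s - (1 - s\<^sup>2 * 2 / 2)) \<le>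
        (s\<^sup>2 / 6) * expectation (\<lambda>x. min (6 * (Z x)\<^sup>2) (\<bar>s\<bar> * \<bar>Z x\<bar> ^ 3))"
      and c: "char (distr M borel (\<lambda>\<omega>. u * ((X \<omega>)\<^sup>2 - 1))) t = char (distr M borel Z) s"
    have "(s\<^sup>2 / 6) * expectation (\<lambda>x. min (6 * (Z x)\<^sup>2) (\<bar>s\<bar> * \<bar>Z x\<bar> ^ 3)) \<le> (s\<^sup>2 / 6) * (\<bar>s\<bar> * (6 * C))"
      using a by (intro mult_left_mono) auto
    also have "\<dots> = C * \<bar>s\<bar> ^ 3" by (simp add: power2_eq_square power3_eq_cube flip: abs_mult)
    finally show ?thesis using b c by simp
  qed
  have "cmod (complex_of_real (exp (- s\<^sup>2)) - (1 - s\<^sup>2)) = \<bar>exp (- s\<^sup>2) - (1 - s\<^sup>2)\<bar>"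
    by (metis norm_of_real of_real_1 of_real_diff)
  also have "\<dots> \<le> (s\<^sup>2)\<^sup>2" by (rule exp_minus_bounds) simp
  also have "(s\<^sup>2)\<^sup>2 = s ^ 4" by (simp flip: power_mult)
  finally have "cmod (complex_of_real (exp (- s\<^sup>2)) - (1 - s\<^sup>2)) \<le> s ^ 4" .
  then show ?thesis using b unfolding s_def[symmetric]
    by (smt (verit) norm_diff_triangle_ineq norm_minus_commute norm_triangle_ineq4 diff_diff_eq2 diff_add_cancel)
qed

text \<open>A difference of products of numbers of modulus at most 1 is bounded by the sum of the
  differences. Each of these carries a factor \<open>(U n j)\<^sup>2\<close> times a quantity
  vanishing with \<open>e n\<close>, and the squares have bounded sum. The limit is written as an
  image of the standard normal law so that \<open>v = 0\<close> is covered.\<close>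

lemma chi_square_clt:
  fixes X :: "nat \<Rightarrow> 'a \<Rightarrow> real" and U :: "nat \<Rightarrow> nat \<Rightarrow> real" and N :: "nat \<Rightarrow> nat"
  assumes ind: "indep_vars (\<lambda>_. borel) X {1..}"
    and D: "\<And>j. j \<ge> 1 \<Longrightarrow> distributed M lborel (X j) std_normal_density"
    and U: "\<And>n j. j \<in> {1..N n} \<Longrightarrow> \<bar>U n j\<bar> \<le> e n" and e: "e \<longlonglongrightarrow> 0"
    and v: "(\<lambda>n. \<Sum>j=1..N n. (U n j)\<^sup>2) \<longlonglongrightarrow> v"
  shows "weak_conv_m (\<lambda>n. distr M borel (\<lambda>\<omega>. \<Sum>j=1..N n. U n j * ((X j \<omega>)\<^sup>2 - 1)))
           (distr std_normal_distribution borel (\<lambda>x. sqrt (2 * v) * x))"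
proof (rule levy_continuity)
  have rX [measurable]: "X j \<in> borel_measurable M" if "j \<in> {1..}" for j using D[of j] that by (auto simp: distributed_def)
  let ?P = "\<lambda>n j. distr M borel (\<lambda>\<omega>. U n j * ((X j \<omega>)\<^sup>2 - 1))"
  let ?S = "\<lambda>n \<omega>. \<Sum>j=1..N n. U n j * ((X j \<omega>)\<^sup>2 - 1)"
  have rS: "?S n \<in> borel_measurable M" for n by measurable
  show "real_distribution (distr M borel (?S n))" for n using rS by (intro real_distribution_distr) auto
  show "real_distribution (distr std_normal_distribution borel (\<lambda>x. sqrt (2 * v) * x))"
    by (intro std_normal.real_distribution_distr) auto
  fix t :: real
  let ?E = "\<lambda>n. complex_of_real (exp (- (t\<^sup>2 * (\<Sum>j=1..N n. (U n j)\<^sup>2))))"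
  define C where "C = (\<integral>x. \<bar>x\<^sup>2 - 1\<bar> ^ 3 \<partial>std_normal_distribution) / 6"
  have C0: "C \<ge> 0" by (simp add: C_def)
  have v0: "v \<ge> 0" using v by (rule LIMSEQ_le_const) (auto intro!: sum_nonneg)
  have bound: "norm (char (distr M borel (?S n)) t - ?E n) \<le>
     (C * \<bar>t\<bar> ^ 3 * \<bar>e n\<bar> + t ^ 4 * (e n)\<^sup>2) * (\<Sum>j=1..N n. (U n j)\<^sup>2)" for n
  proof -
    have iv: "indep_vars (\<lambda>_. borel) (\<lambda>j \<omega>. U n j * ((X j \<omega>)\<^sup>2 - 1)) {1..N n}"
      by (rule indep_vars_compose2[OF indep_vars_subset[OF ind]]) auto
    have c: "char (distr M borel (?S n)) t = (\<Prod>j=1..N n. char (?P n j) t)"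
      by (rule char_distr_sum[OF iv])
    have p: "?E n = (\<Prod>j=1..N n. complex_of_real (exp (- (t * U n j)\<^sup>2)))"
      by (simp add: sum_distrib_left sum_negf[symmetric] exp_sum power_mult_distrib)
    have "norm (char (distr M borel (?S n)) t - ?E n) \<le>
      (\<Sum>j=1..N n. norm (char (?P n j) t - complex_of_real (exp (- (t * U n j)\<^sup>2))))"
      unfolding c p
    proof (rule norm_prod_diff)
      fix j assume j: "j \<in> {1..N n}"
      then have "real_distribution (?P n j)"
        by (intro real_distribution_distr) auto
      then show "norm (char (?P n j) t) \<le> 1"
        by (rule real_distribution.cmod_char_le_1)
    qed (simp flip: of_real_exp)
    also have "\<dots> \<le> (\<Sum>j=1..N n. (C * \<bar>t\<bar> ^ 3 * \<bar>e n\<bar> + t ^ 4 * (e n)\<^sup>2) * (U n j)\<^sup>2)"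
    proof (rule sum_mono)
      fix j assume j: "j \<in> {1..N n}"
      have Ub: "\<bar>U n j\<bar> \<le> \<bar>e n\<bar>" using U[OF j] by linarith
      have "norm (char (?P n j) t - complex_of_real (exp (- (t * U n j)\<^sup>2)))
        \<le> C * \<bar>t * U n j\<bar> ^ 3 + (t * U n j) ^ 4"
        using chi_square_char_bound[OF D, of j "U n j" t] j unfolding C_def by auto
      also have "\<dots> = C * \<bar>t\<bar> ^ 3 * (\<bar>U n j\<bar> * (U n j)\<^sup>2) + t ^ 4 * ((U n j)\<^sup>2 * (U n j)\<^sup>2)"
      proof -
        have "\<bar>U n j\<bar> ^ 3 = \<bar>U n j\<bar> * (U n j)\<^sup>2"
          by (metis power2_abs power3_eq_cube power2_eq_square mult.assoc)
        moreover have "U n j ^ 4 = (U n j)\<^sup>2 * (U n j)\<^sup>2" by (simp flip: power_add)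
        ultimately show ?thesis by (simp add: abs_mult power_mult_distrib)
      qed
      also have "\<dots> \<le> C * \<bar>t\<bar> ^ 3 * (\<bar>e n\<bar> * (U n j)\<^sup>2) + t ^ 4 * ((e n)\<^sup>2 * (U n j)\<^sup>2)"
        using Ub C0 abs_le_square_iff[of "U n j" "e n"]
        by (intro add_mono mult_left_mono mult_right_mono) auto
      finally show "norm (char (?P n j) t - complex_of_real (exp (- (t * U n j)\<^sup>2)))
        \<le> (C * \<bar>t\<bar> ^ 3 * \<bar>e n\<bar> + t ^ 4 * (e n)\<^sup>2) * (U n j)\<^sup>2"
        by (simp add: algebra_simps)
    qed
    finally show ?thesis by (simp only: sum_distrib_left)
  qed
  have "(\<lambda>n. (C * \<bar>t\<bar> ^ 3 * \<bar>e n\<bar> + t ^ 4 * (e n)\<^sup>2) * (\<Sum>j=1..N n. (U n j)\<^sup>2)) \<longlonglongrightarrow>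
    (C * \<bar>t\<bar> ^ 3 * \<bar>0\<bar> + t ^ 4 * 0\<^sup>2) * v"
    by (intro tendsto_intros e v)
  then have "(\<lambda>n. (C * \<bar>t\<bar> ^ 3 * \<bar>e n\<bar> + t ^ 4 * (e n)\<^sup>2) * (\<Sum>j=1..N n. (U n j)\<^sup>2)) \<longlonglongrightarrow> 0" by simp
  then have "(\<lambda>n. char (distr M borel (?S n)) t - ?E n) \<longlonglongrightarrow> 0"
    by (rule Lim_null_comparison[rotated]) (intro always_eventually allI bound)
  then have "(\<lambda>n. char (distr M borel (?S n)) t - ?E n
      + ?E n) \<longlonglongrightarrow> 0 + complex_of_real (exp (- (t\<^sup>2 * v)))"
    by (rule tendsto_add) (intro tendsto_intros v)
  then have "(\<lambda>n. char (distr M borel (?S n)) t) \<longlonglongrightarrow> complex_of_real (exp (- (t\<^sup>2 * v)))"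
    by simp
  moreover have "char (distr std_normal_distribution borel (\<lambda>x. sqrt (2 * v) * x)) t = complex_of_real (exp (- (t\<^sup>2 * v)))"
  proof -
    have "char (distr std_normal_distribution borel (\<lambda>x. sqrt (2 * v) * x)) t = char std_normal_distribution (t * sqrt (2 * v))"
      unfolding char_def by (subst integral_distr) (auto simp: mult_ac)
    also have "\<dots> = complex_of_real (exp (- (t * sqrt (2 * v))\<^sup>2 / 2))" by (simp add: char_std_normal_distribution)
    also have "- (t * sqrt (2 * v))\<^sup>2 / 2 = - (t\<^sup>2 * v)" using v0 by (simp add: power_mult_distrib)
    finally show ?thesis .
  qed
  ultimately show "(\<lambda>n. char (distr M borel (?S n)) t) \<longlonglongrightarrow>
    char (distr std_normal_distribution borel (\<lambda>x. sqrt (2 * v) * x)) t" by simp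
qed

end

section \<open>The sign prior\<close>

text \<open>The exponent is the Taylor polynomial of \<open>ln (cosh x)\<close> of degree 4.
  Differentiating reduces the claim to \<open>tanh z \<ge> z - z ^ 3 / 3\<close>, which follows in
  the same way from \<open>tanh z \<le> z\<close>; evenness gives negative \<open>x\<close>.\<close>

lemma cosh_real_lower:
  fixes x :: real
  shows "exp (x\<^sup>2 / 2 - x ^ 4 / 12) \<le> cosh x"
proof -
  have main: "exp (x\<^sup>2 / 2 - x ^ 4 / 12) \<le> cosh x" if x: "x \<ge> 0" for x :: real
  proof -
    have t1: "tanh y \<le> y" if "y \<ge> 0" for y :: real
    proof -
      have "(\<lambda>y. y - tanh y) 0 \<le> (\<lambda>y. y - tanh y) y"
      proof (rule DERIV_nonneg_imp_nondecreasing[OF that])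
        fix z :: real
        have "((\<lambda>y. y - tanh y) has_real_derivative (tanh z)\<^sup>2) (at z)"
          by (auto intro!: derivative_eq_intros)
        then show "\<exists>d. ((\<lambda>y. y - tanh y) has_real_derivative d) (at z) \<and> 0 \<le> d"
          by (intro exI[of _ "(tanh z)\<^sup>2"]) auto
      qed
      then show ?thesis by simp
    qed
    have t2: "y - y ^ 3 / 3 \<le> tanh y" if "y \<ge> 0" for y :: real
    proof -
      have "(\<lambda>y. tanh y - y + y ^ 3 / 3) 0 \<le> (\<lambda>y. tanh y - y + y ^ 3 / 3) y"
      proof (rule DERIV_nonneg_imp_nondecreasing[OF that])
        fix z :: real assume z: "0 \<le> z" "z \<le> y"
        have "((\<lambda>y. tanh y - y + y ^ 3 / 3) has_real_derivative z\<^sup>2 - (tanh z)\<^sup>2) (at z)"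
          by (auto intro!: derivative_eq_intros simp: power2_eq_square)
        moreover have "(tanh z)\<^sup>2 \<le> z\<^sup>2" using t1[of z] z by (intro power_mono) auto
        ultimately show "\<exists>d. ((\<lambda>y. tanh y - y + y ^ 3 / 3) has_real_derivative d) (at z) \<and> 0 \<le> d"
          by (intro exI[of _ "z\<^sup>2 - (tanh z)\<^sup>2"]) auto
      qed
      then show ?thesis by simp
    qed
    have "(\<lambda>y. ln (cosh y) - y\<^sup>2 / 2 + y ^ 4 / 12) 0 \<le> (\<lambda>y. ln (cosh y) - y\<^sup>2 / 2 + y ^ 4 / 12) x"
    proof (rule DERIV_nonneg_imp_nondecreasing[OF x])
      fix z :: real assume z: "0 \<le> z" "z \<le> x"
      have "((\<lambda>y. ln (cosh y) - y\<^sup>2 / 2 + y ^ 4 / 12) has_real_derivative tanh z - z + z ^ 3 / 3) (at z)"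
        by (auto intro!: derivative_eq_intros simp: tanh_def cosh_real_pos)
      then show "\<exists>d. ((\<lambda>y. ln (cosh y) - y\<^sup>2 / 2 + y ^ 4 / 12) has_real_derivative d) (at z) \<and> 0 \<le> d"
        using t2[of z] z by (intro exI[of _ "tanh z - z + z ^ 3 / 3"]) auto
    qed
    then have "x\<^sup>2 / 2 - x ^ 4 / 12 \<le> ln (cosh x)" by simp
    then have "exp (x\<^sup>2 / 2 - x ^ 4 / 12) \<le> exp (ln (cosh x))" by (simp only: exp_le_cancel_iff)
    then show ?thesis by (simp only: exp_ln[OF cosh_real_pos])
  qed
  show ?thesis using main[of "\<bar>x\<bar>"] by simp
qed

text \<open>Truncation at \<open>t\<close> is truncation of the exponent at \<open>ln t\<close>, and
  below that level the exponential has slope at most \<open>t\<close>.\<close>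

lemma min_exp_lipschitz:
  fixes a b t :: real
  assumes "t > 0"
  shows "min (exp b) t - min (exp a) t \<le> t * \<bar>b - a\<bar>"
proof -
  have eq: "min (exp x) t = exp (min x (ln t))" for x
    using assms by (cases "x \<le> ln t") (auto simp: min_def ln_ge_iff)
  define m m' where "m = min b (ln t)" and "m' = min a (ln t)"
  have "1 + (m' - m) \<le> exp (m' - m)" by (rule exp_ge_add_one_self)
  then have "exp m * (1 - exp (m' - m)) \<le> exp m * (m - m')" by (intro mult_left_mono) (linarith, simp)
  then have "exp m - exp m' \<le> exp m * (m - m')" by (simp add: algebra_simps exp_diff)
  also have "\<dots> \<le> exp m * \<bar>m - m'\<bar>" by (intro mult_left_mono) auto
  also have "\<dots> \<le> t * \<bar>m - m'\<bar>" using assms by (intro mult_right_mono) (auto simp: m_def eq[symmetric])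
  also have "\<dots> \<le> t * \<bar>b - a\<bar>" using assms by (intro mult_left_mono) (auto simp: m_def m'_def)
  finally show ?thesis unfolding eq m_def m'_def .
qed

text \<open>Expanding the product, with a sign pattern encoded by the set \<open>S\<close> of its
  positive positions. This is what turns the average of likelihood ratios over all signs into a
  product of hyperbolic cosines.\<close>

lemma sum_Pow_signs:
  fixes f :: "nat \<Rightarrow> real \<Rightarrow> real"
  assumes "finite A"
  shows "(\<Sum>S\<in>Pow A. \<Prod>j\<in>A. f j (if j \<in> S then 1 else -1)) = (\<Prod>j\<in>A. f j 1 + f j (-1))"
proof -
  have "(\<Prod>j\<in>A. f j (if j \<in> S then 1 else -1)) = (\<Prod>j\<in>S. f j 1) * (\<Prod>j\<in>A - S. f j (-1))" if "S \<in> Pow A" for S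
    using that assms by (subst prod.subset_diff[of S A]) (auto simp: mult.commute intro!: arg_cong2[where f="(*)"] prod.cong)
  then show ?thesis using assms by (subst prod_add) (auto intro!: sum.cong)
qed

text \<open>The weights are increments of \<open>ptail\<close> for the reduced radius and cut-off,
  so their sums telescope: tails inherit \<open>ptail_le_powr\<close>, and sizes are bounded by the
  profile. In \<open>large\<close>, the term \<open>2 * s / (q * k)\<close> is the energy lost by
  starting the tail at 1 instead of 0.\<close>

lemma prior_weights_exist:
  fixes s P\<^sub>0 k q :: real
  assumes s: "s > 0" and P0: "P\<^sub>0 > 0" and k: "k > 0" and q: "0 < q" "q < 1" and qk: "1 \<le> q * k"
    and large: "(1 + 2 * s) < q powr (- s) * (1 + 2 * s - 2 * s / (q * k))"
  shows "\<exists>J (b::nat \<Rightarrow> real). (\<forall>j. 0 \<le> b j \<and> b j \<le> q powr (- 2 * s - 1) * prof s P\<^sub>0 k (real j)) \<and>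
    (1 + 2 * s) * P\<^sub>0 * k powr (- 2 * s) \<le> (\<Sum>j=1..J. b j) \<and>
    (\<forall>j\<ge>1. (\<Sum>i=j..J. b i) \<le> P\<^sub>0 * q powr s * real j powr (- 2 * s))"
proof -
  define P where "P = P\<^sub>0 * q powr s"
  have P: "P > 0" using P0 q by (simp add: P_def)
  have qs: "q powr s \<le> 1" using q s by (simp add: powr_le1)
  have k': "q * k > 0" using q k by simp
  define G where "G j = ptail s P (q * k) (real j)" for j
  define b where "b j = G j - G (Suc j)" for j
  note bd = ptail_diff_bounds[OF s P k', of "real j" "real (Suc j)" for j]
  have b0: "0 \<le> b j" for j
    using bd[of j] prof_nonneg[OF s P, of "q * k" "real (Suc j)"] by (simp add: b_def G_def)
  have b1: "b j \<le> q powr (- 2 * s - 1) * prof s P\<^sub>0 k (real j)" for j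
  proof -
    have "b j \<le> prof s P (q * k) (real j)" using bd[of j] by (simp add: b_def G_def)
    also have "\<dots> \<le> 2 * s * P\<^sub>0 * (q * max (real j) k) powr (- 2 * s - 1)"
      unfolding prof_def
    proof (rule mult_mono)
      show "2 * s * P \<le> 2 * s * P\<^sub>0" using s P0 qs by (simp add: P_def mult_left_le)
      have "q * max (real j) k \<le> max (real j) (q * k)"
      proof (cases "real j \<le> k")
        case False
        have "q * real j \<le> real j" using q by (intro mult_left_le_one_le) auto
        then show ?thesis using False by (simp add: le_max_iff_disj)
      qed (auto simp: max_def)
      then show "max (real j) (q * k) powr (- 2 * s - 1) \<le> (q * max (real j) k) powr (- 2 * s - 1)"
        using s q k by (intro powr_mono2') auto
    qed (use s P0 in auto)
    also have "\<dots> = q powr (- 2 * s - 1) * prof s P\<^sub>0 k (real j)"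
      unfolding prof_def using q k by (subst powr_mult) auto
    finally show ?thesis .
  qed
  have tel: "(\<Sum>i=j..J. b i) = (if j \<le> Suc J then G j - G (Suc J) else 0)" for j J
  proof (cases "j \<le> Suc J")
    case True
    then show ?thesis using sum_Suc_diff[OF True, of "\<lambda>i. - G i"] by (simp add: b_def)
  qed auto
  have G0: "G j \<ge> 0" for j unfolding G_def using ptail_nonneg[OF s P] by auto
  have tail: "(\<Sum>i=j..J. b i) \<le> P\<^sub>0 * q powr s * real j powr (- 2 * s)" if "j \<ge> 1" for j J
    unfolding tel using ptail_le_powr[OF s P k', of "real j"] G0[of "Suc J"] that P
    by (auto simp: G_def P_def)
  \<comment> \<open>Because \<open>1 \<le> q * k\<close>, the point 1 lies on the linear branch of
    \<open>ptail\<close>.\<close>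
  have "G 1 = P * (q * k) powr (- 2 * s) + prof s P (q * k) (q * k) * (q * k - 1)"
    using qk by (simp add: G_def ptail_def)
  also have "\<dots> = P * (q * k) powr (- 2 * s) * (1 + 2 * s - 2 * s / (q * k))"
  proof -
    have "(q * k) powr (- 2 * s - 1) = (q * k) powr (- 2 * s) / (q * k)"
      using k' by (simp add: powr_diff)
    then show ?thesis unfolding prof_def using k' q k by (simp add: field_simps)
  qed
  also have "P * (q * k) powr (- 2 * s) = q powr (- s) * (P\<^sub>0 * k powr (- 2 * s))"
    unfolding P_def using q k by (simp add: powr_mult) (simp flip: powr_add)
  finally have G1: "G 1 = (q powr (- s) * (1 + 2 * s - 2 * s / (q * k))) * (P\<^sub>0 * k powr (- 2 * s))"
    by (simp add: mult_ac)
  have "(1 + 2 * s) * (P\<^sub>0 * k powr (- 2 * s)) < G 1"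
    unfolding G1 using large P0 k by (intro mult_strict_right_mono) auto
  then have lt: "(1 + 2 * s) * P\<^sub>0 * k powr (- 2 * s) < G 1" by (simp add: mult.assoc)
  \<comment> \<open>The strict surplus in \<open>lt\<close> pays for cutting the sequence off at a
    finite \<open>J\<close>; the change of measure then involves finitely many coordinates.\<close>
  have "(\<lambda>J. G 1 - G (Suc J)) \<longlonglongrightarrow> G 1 - 0"
    unfolding G_def using ptail_tendsto_0[OF s, of P "q * k"]
    by (intro tendsto_diff tendsto_const LIMSEQ_Suc)
  then have "\<forall>\<^sub>F J in sequentially. (1 + 2 * s) * P\<^sub>0 * k powr (- 2 * s) < G 1 - G (Suc J)"
    using lt by (intro order_tendstoD(1)) auto
  then obtain J where J: "(1 + 2 * s) * P\<^sub>0 * k powr (- 2 * s) < G 1 - G (Suc J)"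
    using eventually_happens'[OF sequentially_bot] by blast
  then have "(1 + 2 * s) * P\<^sub>0 * k powr (- 2 * s) \<le> (\<Sum>j=1..J. b j)" unfolding tel by simp
  then show ?thesis using b0 b1 tail by blast
qed

context gauss_noise begin

lemma basis_comb_ip:
  assumes "l \<ge> 1"
  shows "ip (\<lambda>t. \<Sum>j=1..J. \<theta> j * \<phi> j t) (\<phi> l) = (if l \<in> {1..J} then \<theta> l else 0)"
  using orthonormal_family_sum_ip[OF basis_family, of "{1..J}" l \<theta>] assms by auto

lemma basis_comb_Ltwo: "(\<lambda>t. \<Sum>j=1..J. \<theta> j * \<phi> j t) \<in> Ltwo"
  by (intro Ltwo_sum) auto

text \<open>Every term of the supremum is bounded by \<open>P\<close>. The gap between
  \<open>P\<close> and \<open>P\<^sub>0\<close> is essential since a supremum of strict bounds need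
  not be strict.\<close>

lemma basis_comb_in_alternatives:
  fixes \<theta> b :: "nat \<Rightarrow> real" and J :: nat
  assumes b: "\<And>j. (\<theta> j)\<^sup>2 = b j" and P: "0 < P" "P < P\<^sub>0" and s: "s > 0"
    and tail: "\<And>j. j \<ge> 1 \<Longrightarrow> (\<Sum>i=j..J. b i) \<le> P * real j powr (- 2 * s)"
    and total: "\<rho> n \<le> (\<Sum>j=1..J. b j)"
  shows "(\<lambda>t. \<Sum>j=1..J. \<theta> j * \<phi> j t) \<in> alternatives \<phi> s P\<^sub>0 \<rho> n"
proof -
  define f where "f = (\<lambda>t. \<Sum>j=1..J. \<theta> j * \<phi> j t)"
  have fL: "f \<in> Ltwo" unfolding f_def by (rule basis_comb_Ltwo)
  have ipf: "(ip f (\<phi> l))\<^sup>2 = (if l \<in> {1..J} then b l else 0)" if "l \<ge> 1" for l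
    using basis_comb_ip[OF that, of \<theta> J] b by (simp add: f_def)
  have "((\<lambda>j. (ip f (\<phi> j))\<^sup>2) has_sum (\<Sum>j=1..J. b j)) {1..}"
  proof (rule has_sum_finite_neutralI[where B="{1..J}"])
    show "(\<Sum>j=1..J. b j) = (\<Sum>j=1..J. (ip f (\<phi> j))\<^sup>2)" using ipf by (intro sum.cong) auto
  qed (use ipf in auto)
  with parseval[OF basis fL] have "(Lnorm f)\<^sup>2 = (\<Sum>j=1..J. b j)" by (rule has_sum_unique)
  then have "(Lnorm f)\<^sup>2 \<ge> \<rho> n" using total by simp
  moreover have "(SUP l\<in>{0<..}. ereal (l powr (2 * s) * (\<Sum>\<^sub>\<infinity>j\<in>{j. real j > l}. (ip f (\<phi> j))\<^sup>2))) \<le> ereal P"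
  proof (rule SUP_least)
    fix l :: real assume l: "l \<in> {0<..}"
    \<comment> \<open>Floor plus one rather than the ceiling: for an integer \<open>l\<close> the
      index \<open>l\<close> itself is excluded from the tail.\<close>
    define j0 where "j0 = nat \<lfloor>l\<rfloor> + 1"
    have j0: "j0 \<ge> 1" "l < real j0" using l by (auto simp: j0_def) linarith
    have set: "{j. real j > l} = {j0..}"
    proof (intro set_eqI iffI)
      fix j assume "j \<in> {j. real j > l}"
      then have "l < real j" by simp
      then have "nat \<lfloor>l\<rfloor> < j" using l by (simp add: nat_less_iff floor_less_iff)
      then show "j \<in> {j0..}" by (simp add: j0_def)
    next
      fix j assume "j \<in> {j0..}"
      then show "j \<in> {j. real j > l}" using j0 by (auto intro: less_le_trans)
    qed
    have "(\<Sum>\<^sub>\<infinity>j\<in>{j0..}. (ip f (\<phi> j))\<^sup>2) = (\<Sum>\<^sub>\<infinity>j\<in>{j0..J}. b j)"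
    proof (rule infsum_cong_neutral)
      fix x assume "x \<in> {j0..} - {j0..J}"
      then show "(ip f (\<phi> x))\<^sup>2 = 0" using ipf[of x] j0 by auto
    next
      fix x assume "x \<in> {j0..} \<inter> {j0..J}"
      then show "(ip f (\<phi> x))\<^sup>2 = b x" using ipf[of x] j0 by auto
    qed auto
    also have "\<dots> \<le> P * real j0 powr (- 2 * s)" using tail[OF j0(1)] by simp
    finally have "l powr (2 * s) * (\<Sum>\<^sub>\<infinity>j\<in>{j0..}. (ip f (\<phi> j))\<^sup>2) \<le> l powr (2 * s) * (P * real j0 powr (- 2 * s))"
      by (intro mult_left_mono) auto
    also have "\<dots> \<le> real j0 powr (2 * s) * (P * real j0 powr (- 2 * s))"
      using j0 l s P by (intro mult_right_mono powr_mono2) auto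
    also have "\<dots> = P" using j0 by (simp add: mult.left_commute flip: powr_add)
    finally show "ereal (l powr (2 * s) * (\<Sum>\<^sub>\<infinity>j\<in>{j. real j > l}. (ip f (\<phi> j))\<^sup>2)) \<le> ereal P"
      unfolding set by simp
  qed
  ultimately show ?thesis using fL P unfolding alternatives_def besov_ball_def f_def[symmetric]
    by (auto intro: le_less_trans)
qed

section \<open>Error probabilities of tests and the Bayes risk of the sign mixture\<close>

lemma is_test_bounds:
  assumes "is_test K" "\<omega> \<in> space M"
  shows "0 \<le> K (obs w \<sigma> n f \<omega>)" "K (obs w \<sigma> n f \<omega>) \<le> 1"
  using assms measurable_space[OF obs_measurable assms(2)] by (auto simp: is_test_def)

lemma integrable_test:
  assumes "is_test K"
  shows "integrable M (\<lambda>\<omega>. K (obs w \<sigma> n f \<omega>))"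
proof (rule integrable_const_bound[where B=1])
  have [measurable]: "K \<in> borel_measurable obs_space" using assms by (simp add: is_test_def)
  show "(\<lambda>\<omega>. K (obs w \<sigma> n f \<omega>)) \<in> borel_measurable M" by measurable
  show "AE \<omega> in M. norm (K (obs w \<sigma> n f \<omega>)) \<le> 1"
    using is_test_bounds[OF assms] by (auto intro!: AE_I2)
qed

lemma type_II_bounds:
  assumes "is_test K"
  shows "0 \<le> type_II M w \<sigma> n K f" "type_II M w \<sigma> n K f \<le> 1"
proof -
  show "0 \<le> type_II M w \<sigma> n K f" unfolding type_II_def
    using is_test_bounds[OF assms] by (intro integral_nonneg_AE AE_I2) auto
  have "type_II M w \<sigma> n K f \<le> (\<integral>\<omega>. 1 \<partial>M)" unfolding type_II_def
    using is_test_bounds[OF assms] integrable_test[OF assms] by (intro integral_mono) auto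
  then show "type_II M w \<sigma> n K f \<le> 1" by (simp add: prob_space)
qed

lemma type_II_le_sup:
  assumes "is_test K" "f \<in> V"
  shows "type_II M w \<sigma> n K f \<le> type_II_sup M w \<sigma> n K V"
  unfolding type_II_sup_def using assms type_II_bounds[OF assms(1)]
  by (intro cSUP_upper) (auto intro!: bdd_aboveI[of _ 1])

text \<open>The likelihood ratio against the null of the uniform mixture over all sign patterns, for
  coefficients of size \<open>a j\<close> in units of the noise level.\<close>

definition mixture_density :: "(nat \<Rightarrow> real) \<Rightarrow> nat \<Rightarrow> 'w \<Rightarrow> real" where
  "mixture_density a J \<omega> = (\<Prod>j=1..J. exp (- (a j)\<^sup>2 / 2) * cosh (a j * w (\<phi> j) \<omega>))"

lemma mixture_density_measurable [measurable]: "mixture_density a J \<in> borel_measurable M"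
  unfolding mixture_density_def cosh_def by measurable

text \<open>The supremum dominates the average over sign patterns, which is the integral of the
  mixture ratio times \<open>1 - K\<close>. For any value of \<open>K\<close> in
  \<open>[0, 1]\<close>, the convex combination of the ratio and \<open>t\<close> with weights
  \<open>1 - K\<close> and \<open>K\<close> is at least their minimum.\<close>

lemma bayes_risk_bound:
  fixes b :: "nat \<Rightarrow> real" and J :: nat
  assumes "\<sigma> > 0" "n \<ge> 1" and K: "is_test K"
    and V: "\<And>S. S \<subseteq> {1..J} \<Longrightarrow> (\<lambda>t. \<Sum>j=1..J. (b j * (if j \<in> S then 1 else -1)) * \<phi> j t) \<in> V"
    and t: "t > 0"
  shows "(\<integral>\<omega>. min (mixture_density (\<lambda>j. sqrt (real n) * b j / \<sigma>) J \<omega>) t \<partial>M) - t * type_I M w \<sigma> n K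
    \<le> type_II_sup M w \<sigma> n K V"
proof -
  define a where "a j = sqrt (real n) * b j / \<sigma>" for j
  define \<Lambda> where "\<Lambda> = mixture_density a J"
  let ?K = "\<lambda>\<omega>. K (obs w \<sigma> n (\<lambda>_. 0) \<omega>)"
  let ?f = "\<lambda>S t. \<Sum>j=1..J. (b j * (if j \<in> S then 1 else -1)) * \<phi> j t"
  define p where "p S \<omega> = (\<Prod>j=1..J. exp ((if j \<in> S then 1 else -1) * (a j * w (\<phi> j) \<omega>) - (a j)\<^sup>2 / 2))" for S \<omega>
  have ae: "sqrt (real n) * (b j * (if j \<in> S then 1 else - 1)) / \<sigma> = (if j \<in> S then 1 else -1) * a j" for j and S :: "nat set"
    by (simp add: a_def)
  have sq: "((if j \<in> S then 1 else -1) * a j)\<^sup>2 = (a j)\<^sup>2" for j and S :: "nat set" by simp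
  have g1: "type_II M w \<sigma> n K (?f S) = (\<integral>\<omega>. p S \<omega> * (1 - ?K \<omega>) \<partial>M)" for S
    using type_II_girsanov(1)[OF assms(1-3), of "\<lambda>j. b j * (if j \<in> S then 1 else -1)" J]
    unfolding ae sq p_def by (simp only: mult.assoc)
  have g2: "integrable M (\<lambda>\<omega>. p S \<omega> * (1 - ?K \<omega>))" for S
    using type_II_girsanov(2)[OF assms(1-3), of "\<lambda>j. b j * (if j \<in> S then 1 else -1)" J]
    unfolding ae sq p_def by (simp only: mult.assoc)
  have mix: "(\<Sum>S\<in>Pow {1..J}. p S \<omega>) = 2 ^ J * \<Lambda> \<omega>" for \<omega>
  proof -
    have "(\<Sum>S\<in>Pow {1..J}. p S \<omega>) = (\<Prod>j=1..J. exp (1 * (a j * w (\<phi> j) \<omega>) - (a j)\<^sup>2 / 2) + exp ((-1) * (a j * w (\<phi> j) \<omega>) - (a j)\<^sup>2 / 2))"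
      unfolding p_def
      by (rule sum_Pow_signs[where f="\<lambda>j e. exp (e * (a j * w (\<phi> j) \<omega>) - (a j)\<^sup>2 / 2)"]) simp
    also have "\<dots> = (\<Prod>j=1..J. 2 * (exp (- (a j)\<^sup>2 / 2) * cosh (a j * w (\<phi> j) \<omega>)))"
    proof (intro prod.cong refl)
      have "exp (1 * x - y) + exp ((-1) * x - y) = 2 * (exp (- y) * cosh x)" for x y :: real
        by (simp add: cosh_field_def exp_diff exp_minus field_simps)
      then show "exp (1 * (a j * w (\<phi> j) \<omega>) - (a j)\<^sup>2 / 2) + exp ((-1) * (a j * w (\<phi> j) \<omega>) - (a j)\<^sup>2 / 2)
        = 2 * (exp (- (a j)\<^sup>2 / 2) * cosh (a j * w (\<phi> j) \<omega>))" for j by simp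
    qed
    also have "\<dots> = 2 ^ J * \<Lambda> \<omega>" unfolding \<Lambda>_def mixture_density_def by (simp only: prod.distrib) simp
    finally show ?thesis .
  qed
  have iL: "integrable M (\<lambda>\<omega>. \<Lambda> \<omega> * (1 - ?K \<omega>))"
  proof -
    have "integrable M (\<lambda>\<omega>. (1 / 2 ^ J) * (\<Sum>S\<in>Pow {1..J}. p S \<omega> * (1 - ?K \<omega>)))"
      using g2 by auto
    moreover have "(1 / 2 ^ J) * (\<Sum>S\<in>Pow {1..J}. p S \<omega> * (1 - ?K \<omega>)) = \<Lambda> \<omega> * (1 - ?K \<omega>)" for \<omega>
      using mix[of \<omega>] by (simp flip: sum_distrib_right)
    ultimately show ?thesis by simp
  qed
  have "2 ^ J * (\<integral>\<omega>. \<Lambda> \<omega> * (1 - ?K \<omega>) \<partial>M) = (\<integral>\<omega>. (\<Sum>S\<in>Pow {1..J}. p S \<omega> * (1 - ?K \<omega>)) \<partial>M)"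
    using mix by (simp flip: sum_distrib_right integral_mult_right_zero add: mult.assoc)
  also have "\<dots> = (\<Sum>S\<in>Pow {1..J}. type_II M w \<sigma> n K (?f S))"
    unfolding g1 using g2 by (intro Bochner_Integration.integral_sum) auto
  also have "\<dots> \<le> (\<Sum>S\<in>Pow {1..J}. type_II_sup M w \<sigma> n K V)"
    using V by (intro sum_mono type_II_le_sup K) auto
  also have "\<dots> = 2 ^ J * type_II_sup M w \<sigma> n K V" by (simp add: card_Pow)
  finally have 1: "(\<integral>\<omega>. \<Lambda> \<omega> * (1 - ?K \<omega>) \<partial>M) \<le> type_II_sup M w \<sigma> n K V" by simp
  have L0: "\<Lambda> \<omega> \<ge> 0" for \<omega> unfolding \<Lambda>_def mixture_density_def
    by (intro prod_nonneg) (auto intro: less_imp_le[OF cosh_real_pos])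
  have "(\<integral>\<omega>. min (\<Lambda> \<omega>) t \<partial>M) \<le> (\<integral>\<omega>. \<Lambda> \<omega> * (1 - ?K \<omega>) + t * ?K \<omega> \<partial>M)"
  proof (rule integral_mono)
    show "integrable M (\<lambda>\<omega>. min (\<Lambda> \<omega>) t)"
      using L0 t unfolding \<Lambda>_def by (intro integrable_const_bound[where B=t]) auto
    show "integrable M (\<lambda>\<omega>. \<Lambda> \<omega> * (1 - ?K \<omega>) + t * ?K \<omega>)" using iL integrable_test[OF K] by auto
    fix \<omega> assume \<omega>: "\<omega> \<in> space M"
    note kb = is_test_bounds[OF K \<omega>, of \<sigma> n "\<lambda>_. 0"]
    have "min (\<Lambda> \<omega>) t * (1 - ?K \<omega>) \<le> \<Lambda> \<omega> * (1 - ?K \<omega>)" using kb by (intro mult_right_mono) auto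
    moreover have "min (\<Lambda> \<omega>) t * ?K \<omega> \<le> t * ?K \<omega>" using kb by (intro mult_right_mono) auto
    ultimately show "min (\<Lambda> \<omega>) t \<le> \<Lambda> \<omega> * (1 - ?K \<omega>) + t * ?K \<omega>" by (simp add: algebra_simps)
  qed
  also have "\<dots> = (\<integral>\<omega>. \<Lambda> \<omega> * (1 - ?K \<omega>) \<partial>M) + t * type_I M w \<sigma> n K"
    unfolding type_I_def using iL integrable_test[OF K] by simp
  finally show ?thesis using 1 unfolding \<Lambda>_def a_def by simp
qed

lemma expectation_abs_le_sqrt:
  fixes R :: "'w \<Rightarrow> real"
  assumes "integrable M R" "integrable M (\<lambda>\<omega>. (R \<omega>)\<^sup>2)"
  shows "(\<integral>\<omega>. \<bar>R \<omega>\<bar> \<partial>M) \<le> sqrt (\<integral>\<omega>. (R \<omega>)\<^sup>2 \<partial>M)"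
proof -
  have "0 \<le> variance (\<lambda>\<omega>. \<bar>R \<omega>\<bar>)" by (rule variance_positive)
  also have "\<dots> = (\<integral>\<omega>. (R \<omega>)\<^sup>2 \<partial>M) - (\<integral>\<omega>. \<bar>R \<omega>\<bar> \<partial>M)\<^sup>2"
    using assms by (subst variance_eq) auto
  finally show ?thesis by (intro real_le_rsqrt) simp
qed

lemma xi_distributed: "j \<ge> 1 \<Longrightarrow> distributed M lborel (w (\<phi> j)) std_normal_density"
  using w_distributed[OF basis_family] by auto

lemma xi_indep: "indep_vars (\<lambda>_. borel) (\<lambda>j. w (\<phi> j)) {1..}"
  using w_indep[OF basis_family] .

text \<open>After the bound on \<open>cosh\<close>, the exponent is the quadratic sum minus
  \<open>D / 4\<close> minus \<open>R / 12\<close>: since the fourth moment of each coordinate is 3,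
  the quartic term splits into a mean \<open>D / 4\<close> and a centered part \<open>R\<close>,
  negligible for small \<open>e\<close>. The free \<open>c\<close> lets \<open>D / 4\<close> be
  replaced by its limit.\<close>

lemma mixture_density_lower:
  assumes J: "\<And>j. j \<in> {1..J} \<Longrightarrow> 0 \<le> u j \<and> u j \<le> e" and e: "e \<ge> 0" and t: "t > 0"
    and a: "\<And>j. j \<in> {1..J} \<Longrightarrow> (a j)\<^sup>2 = u j"
  defines "D \<equiv> \<Sum>j=1..J. (u j)\<^sup>2"
  shows "(\<integral>\<omega>. min (exp ((\<Sum>j=1..J. (u j / 2) * ((w (\<phi> j) \<omega>)\<^sup>2 - 1)) - c)) t \<partial>M)
      - t * (\<bar>D / 4 - c\<bar> + sqrt (96 * (e\<^sup>2 * D)) / 12)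
    \<le> (\<integral>\<omega>. min (mixture_density a J \<omega>) t \<partial>M)"
proof -
  define \<xi> where "\<xi> j = w (\<phi> j)" for j
  have [measurable]: "\<xi> j \<in> borel_measurable M" if "j \<in> {1..J}" for j using that by (simp add: \<xi>_def)
  define W where "W \<omega> = (\<Sum>j=1..J. (u j / 2) * ((\<xi> j \<omega>)\<^sup>2 - 1))" for \<omega>
  define R where "R \<omega> = (\<Sum>j=1..J. (u j)\<^sup>2 * (\<xi> j \<omega> ^ 4 - 3))" for \<omega>
  have mW [measurable]: "W \<in> borel_measurable M" unfolding W_def by measurable
  have mR [measurable]: "R \<in> borel_measurable M" unfolding R_def by measurable
  have lower: "exp (W \<omega> - D / 4 - R \<omega> / 12) \<le> mixture_density a J \<omega>" for \<omega>
  proof -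
    let ?v = "\<lambda>j. u j * (\<xi> j \<omega>)\<^sup>2 / 2 - (u j)\<^sup>2 * \<xi> j \<omega> ^ 4 / 12"
    have "W \<omega> - D / 4 - R \<omega> / 12 = (\<Sum>j=1..J. - u j / 2 + (?v j))"
      unfolding W_def D_def R_def
      by (simp add: sum_divide_distrib flip: sum_subtractf) (intro sum.cong refl, simp add: field_simps)
    then have "exp (W \<omega> - D / 4 - R \<omega> / 12) = (\<Prod>j=1..J. exp (- u j / 2) * exp (?v j))"
      by (simp only: exp_sum[OF finite_atLeastAtMost] exp_add)
    also have "\<dots> \<le> mixture_density a J \<omega>" unfolding mixture_density_def
    proof (intro prod_mono conjI)
      fix j assume j: "j \<in> {1..J}"
      have "(a j) ^ 4 = (u j)\<^sup>2" using a[OF j] by (metis power_mult mult_2_right numeral_Bit0 power2_eq_square power_add)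
      then have "exp (?v j) \<le> cosh (a j * \<xi> j \<omega>)"
        using cosh_real_lower[of "a j * \<xi> j \<omega>"] a[OF j] by (simp add: power_mult_distrib)
      then show "exp (- u j / 2) * exp (?v j)
        \<le> exp (- (a j)\<^sup>2 / 2) * cosh (a j * w (\<phi> j) \<omega>)"
        unfolding a[OF j] \<xi>_def by (intro mult_left_mono) auto
    qed auto
    finally show ?thesis .
  qed
  have iv: "indep_vars (\<lambda>_. borel) (\<lambda>j \<omega>. \<xi> j \<omega> ^ 4 - 3) {1..J}"
    unfolding \<xi>_def by (rule indep_vars_compose2[OF indep_vars_subset[OF xi_indep]]) auto
  have sq4: "(\<lambda>\<omega>. (\<xi> j \<omega> ^ 4 - 3)\<^sup>2) = (\<lambda>\<omega>. \<xi> j \<omega> ^ 8 - 6 * \<xi> j \<omega> ^ 4 + 9)" for j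
    by (auto simp: power2_eq_square algebra_simps simp flip: power_add)
  have R2: "integrable M (\<lambda>\<omega>. (R \<omega>)\<^sup>2)" "(\<integral>\<omega>. (R \<omega>)\<^sup>2 \<partial>M) = 96 * (\<Sum>j=1..J. ((u j)\<^sup>2)\<^sup>2)"
  proof -
    have d: "distributed M lborel (\<xi> j) std_normal_density" if "j \<in> {1..J}" for j
      using xi_distributed that by (simp add: \<xi>_def)
    have i: "integrable M (\<lambda>\<omega>. \<xi> j \<omega> ^ m)" if "j \<in> {1..J}" for j m
      using std_normal_moment_integrable[OF d[OF that]] .
    \<comment> \<open>The eighth and fourth moments are 105 and 3, so the variance is
      \<open>105 - 6 * 3 + 9 = 96\<close>.\<close>
    have m: "expectation (\<lambda>\<omega>. \<xi> j \<omega> ^ 4 - 3) = 0" "(\<integral>\<omega>. (\<xi> j \<omega> ^ 4 - 3)\<^sup>2 \<partial>M) = 96" if "j \<in> {1..J}" for j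
      unfolding sq4 using std_normal_moments(3,4)[OF d[OF that]] i[OF that] by (simp_all add: prob_space)
    have i2: "integrable M (\<lambda>\<omega>. \<xi> j \<omega> ^ 4 - 3)" "integrable M (\<lambda>\<omega>. (\<xi> j \<omega> ^ 4 - 3)\<^sup>2)" if "j \<in> {1..J}" for j
      unfolding sq4 using i[OF that] by auto
    show "integrable M (\<lambda>\<omega>. (R \<omega>)\<^sup>2)" "(\<integral>\<omega>. (R \<omega>)\<^sup>2 \<partial>M) = 96 * (\<Sum>j=1..J. ((u j)\<^sup>2)\<^sup>2)"
      unfolding R_def
      using expectation_sum_sq[OF iv _ i2 m, of "\<lambda>j. (u j)\<^sup>2"] by auto
  qed
  have iR: "integrable M R" using R2(1) mR by (rule square_integrable_imp_integrable[rotated])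
  have "(\<Sum>j=1..J. ((u j)\<^sup>2)\<^sup>2) \<le> (\<Sum>j=1..J. e\<^sup>2 * (u j)\<^sup>2)"
  proof (rule sum_mono)
    fix j assume j: "j \<in> {1..J}"
    have "(u j)\<^sup>2 \<le> e\<^sup>2" using J[OF j] by (intro power_mono) auto
    then show "((u j)\<^sup>2)\<^sup>2 \<le> e\<^sup>2 * (u j)\<^sup>2" unfolding power2_eq_square[of "(u j)\<^sup>2"] by (intro mult_right_mono) auto
  qed
  then have sum4: "(\<Sum>j=1..J. ((u j)\<^sup>2)\<^sup>2) \<le> e\<^sup>2 * D" by (simp add: D_def sum_distrib_left)
  have "(\<integral>\<omega>. \<bar>R \<omega>\<bar> \<partial>M) \<le> sqrt (96 * (\<Sum>j=1..J. ((u j)\<^sup>2)\<^sup>2))"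
    using expectation_abs_le_sqrt[OF iR R2(1)] R2(2) by simp
  also have "\<dots> \<le> sqrt (96 * (e\<^sup>2 * D))" using sum4 by simp
  finally have ER: "(\<integral>\<omega>. \<bar>R \<omega>\<bar> \<partial>M) \<le> sqrt (96 * (e\<^sup>2 * D))" .
  have im: "integrable M (\<lambda>\<omega>. min (exp (g \<omega>)) t)" if "g \<in> borel_measurable M" for g
  proof (rule integrable_const_bound[where B=t])
    have "norm (min (exp y) t) \<le> t" for y :: real using t by (simp add: abs_if min_less_iff_disj)
    then show "AE \<omega> in M. norm (min (exp (g \<omega>)) t) \<le> t" by simp
  qed (use that in auto)
  have "(\<integral>\<omega>. min (exp (W \<omega> - c)) t - t * (\<bar>D / 4 - c\<bar> + \<bar>R \<omega>\<bar> / 12) \<partial>M) \<le> (\<integral>\<omega>. min (mixture_density a J \<omega>) t \<partial>M)"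
  proof (rule integral_mono)
    show "integrable M (\<lambda>\<omega>. min (exp (W \<omega> - c)) t - t * (\<bar>D / 4 - c\<bar> + \<bar>R \<omega>\<bar> / 12))"
      using im[of "\<lambda>\<omega>. W \<omega> - c"] iR by auto
    have m0: "0 \<le> mixture_density a J \<omega>" for \<omega> using lower[of \<omega>] exp_gt_zero[of "W \<omega> - D / 4 - R \<omega> / 12"] by linarith
    show "integrable M (\<lambda>\<omega>. min (mixture_density a J \<omega>) t)"
      using t m0 by (intro integrable_const_bound[where B=t]) auto
    fix \<omega>
    have "min (exp (W \<omega> - c)) t - min (exp (W \<omega> - D / 4 - R \<omega> / 12)) t \<le> t * \<bar>(W \<omega> - c) - (W \<omega> - D / 4 - R \<omega> / 12)\<bar>"
      by (rule min_exp_lipschitz[OF t])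
    also have "\<dots> \<le> t * (\<bar>D / 4 - c\<bar> + \<bar>R \<omega>\<bar> / 12)" using t by (intro mult_left_mono) linarith+
    finally show "min (exp (W \<omega> - c)) t - t * (\<bar>D / 4 - c\<bar> + \<bar>R \<omega>\<bar> / 12) \<le> min (mixture_density a J \<omega>) t"
      using lower[of \<omega>] by (auto simp: min_def split: if_splits)
  qed
  moreover have "(\<integral>\<omega>. min (exp (W \<omega> - c)) t - t * (\<bar>D / 4 - c\<bar> + \<bar>R \<omega>\<bar> / 12) \<partial>M) =
     (\<integral>\<omega>. min (exp (W \<omega> - c)) t \<partial>M) - t * (\<bar>D / 4 - c\<bar> + (\<integral>\<omega>. \<bar>R \<omega>\<bar> \<partial>M) / 12)"
    using im[of "\<lambda>\<omega>. W \<omega> - c"] iR by (simp add: prob_space)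
  moreover have "t * (\<bar>D / 4 - c\<bar> + (\<integral>\<omega>. \<bar>R \<omega>\<bar> \<partial>M) / 12) \<le> t * (\<bar>D / 4 - c\<bar> + sqrt (96 * (e\<^sup>2 * D)) / 12)"
    using t ER by (intro mult_left_mono) auto
  ultimately show ?thesis unfolding W_def \<xi>_def by linarith
qed

end

section \<open>The minimax lower bound\<close>

context gauss_noise begin

text \<open>Where \<open>D\<close> converges to \<open>l\<close>, the quadratic sum tends to a
  centered normal variable of variance \<open>d\<^sup>2 = l / 2\<close>, and the lower bound of the
  likelihood ratio tends to that of a Gaussian shift by \<open>d\<close>. The risk of that
  experiment is given by \<open>neyman_pearson_value\<close>.\<close>

lemma mixture_risk_asymptotics:
  fixes J :: "nat \<Rightarrow> nat" and a :: "nat \<Rightarrow> nat \<Rightarrow> real" and \<beta> p \<eta> e :: "nat \<Rightarrow> real"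
  defines "D \<equiv> \<lambda>n. \<Sum>j=1..J n. ((a n j)\<^sup>2)\<^sup>2"
  assumes e0: "\<And>n. e n \<ge> 0" and e: "e \<longlonglongrightarrow> 0"
    and a: "\<And>n j. j \<in> {1..J n} \<Longrightarrow> (a n j)\<^sup>2 \<le> e n"
    and D: "\<And>n. D n \<le> B"
    and \<beta>: "\<And>n t. t > 0 \<Longrightarrow> (\<integral>\<omega>. min (mixture_density (a n) (J n) \<omega>) t \<partial>M) - t * p n \<le> \<beta> n"
    and p: "\<And>n. p n \<le> 1 - std_normal_cdf x + \<eta> n" and \<eta>: "\<eta> \<longlonglongrightarrow> 0"
    and \<epsilon>: "\<epsilon> > 0"
  shows "\<forall>\<^sub>F n in sequentially. std_normal_cdf (x - sqrt (D n / 2)) - \<epsilon> \<le> \<beta> n"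
proof (rule eventually_by_subseq)
  have D0: "D n \<ge> 0" for n by (simp add: D_def sum_nonneg)
  show "bounded (range D)"
    using D0 D by (intro boundedI[of _ B]) auto
  fix r :: "nat \<Rightarrow> nat" and l assume r: "strict_mono r" and l: "(\<lambda>n. D (r n)) \<longlonglongrightarrow> l"
  have l0: "l \<ge> 0" using l by (rule LIMSEQ_le_const) (use D0 in auto)
  define d where "d = sqrt (l / 2)"
  have d: "d \<ge> 0" "d\<^sup>2 = l / 2" using l0 by (auto simp: d_def)
  \<comment> \<open>The limiting likelihood ratio at the critical value \<open>x\<close>. With this
    threshold the terms \<open>t * (1 - std_normal_cdf x)\<close> cancel and only the Neyman-Pearson
    risk at \<open>x - d\<close> remains.\<close>
  define t where "t = exp (d * x - d\<^sup>2 / 2)"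
  have t: "t > 0" by (simp add: t_def)
  define W where "W n \<omega> = (\<Sum>j=1..J (r n). ((a (r n) j)\<^sup>2 / 2) * ((w (\<phi> j) \<omega>)\<^sup>2 - 1))" for n \<omega>
  have mW [measurable]: "W n \<in> borel_measurable M" for n unfolding W_def by measurable
  have er: "(\<lambda>n. e (r n)) \<longlonglongrightarrow> 0" using LIMSEQ_subseq_LIMSEQ[OF e r] by (simp add: o_def)
  have \<eta>r: "(\<lambda>n. \<eta> (r n)) \<longlonglongrightarrow> 0" using LIMSEQ_subseq_LIMSEQ[OF \<eta> r] by (simp add: o_def)
  have "weak_conv_m (\<lambda>n. distr M borel (\<lambda>\<omega>. \<Sum>j=1..J (r n). ((a (r n) j)\<^sup>2 / 2) * ((w (\<phi> j) \<omega>)\<^sup>2 - 1)))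
     (distr std_normal_distribution borel (\<lambda>x. sqrt (2 * (l / 4)) * x))"
  proof (rule chi_square_clt[OF xi_indep xi_distributed])
    show "\<bar>(a (r n) j)\<^sup>2 / 2\<bar> \<le> e (r n)" if "j \<in> {1..J (r n)}" for n j
      using a[OF that] e0[of "r n"] by simp
    show "(\<lambda>n. e (r n)) \<longlonglongrightarrow> 0" by (rule er)
    have "(\<lambda>n. D (r n) / 4) \<longlonglongrightarrow> l / 4" by (intro tendsto_intros l) simp
    then show "(\<lambda>n. \<Sum>j=1..J (r n). ((a (r n) j)\<^sup>2 / 2)\<^sup>2) \<longlonglongrightarrow> l / 4"
      by (simp add: D_def sum_divide_distrib power_divide)
  qed
  then have wc: "weak_conv_m (\<lambda>n. distr M borel (W n)) (distr std_normal_distribution borel (\<lambda>x. d * x))"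
    by (simp add: W_def[abs_def] d_def)
  let ?f = "\<lambda>y. min (exp (y - l / 4)) t"
  have "(\<lambda>n. integral\<^sup>L (distr M borel (W n)) ?f) \<longlonglongrightarrow> integral\<^sup>L (distr std_normal_distribution borel (\<lambda>x. d * x)) ?f"
  proof (rule weak_conv_imp_integral_bdd_continuous_conv[OF _ _ wc])
    show "real_distribution (distr M borel (W n))" for n by (intro real_distribution_distr) simp
    show "real_distribution (distr std_normal_distribution borel (\<lambda>x. d * x))"
      by (intro std_normal.real_distribution_distr) simp
    show "isCont ?f y" for y by (intro continuous_intros)
    show "norm (?f y) \<le> t" for y using t by (simp add: abs_if min_less_iff_disj)
  qed
  moreover have "integral\<^sup>L (distr M borel (W n)) ?f = (\<integral>\<omega>. ?f (W n \<omega>) \<partial>M)" for n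
    by (subst integral_distr) auto
  moreover have "integral\<^sup>L (distr std_normal_distribution borel (\<lambda>x. d * x)) ?f =
    std_normal_cdf (x - d) + t * (1 - std_normal_cdf x)"
    using neyman_pearson_value[OF d(1), of x] d(2)
    by (subst integral_distr) (auto simp: t_def)
  ultimately have I: "(\<lambda>n. \<integral>\<omega>. ?f (W n \<omega>) \<partial>M) \<longlonglongrightarrow> std_normal_cdf (x - d) + t * (1 - std_normal_cdf x)"
    by simp
  define low where "low n = (\<integral>\<omega>. ?f (W n \<omega>) \<partial>M) - t * (\<bar>D (r n) / 4 - l / 4\<bar> + sqrt (96 * ((e (r n))\<^sup>2 * D (r n))) / 12)
      - t * (1 - std_normal_cdf x + \<eta> (r n))" for n
  have "low \<longlonglongrightarrow> std_normal_cdf (x - d) + t * (1 - std_normal_cdf x) - t * (\<bar>l / 4 - l / 4\<bar> + sqrt (96 * (0\<^sup>2 * l)) / 12)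
      - t * (1 - std_normal_cdf x + 0)"
    unfolding low_def by (intro tendsto_intros I l er \<eta>r) simp_all
  then have lim: "low \<longlonglongrightarrow> std_normal_cdf (x - d)" by simp
  have le: "low n \<le> \<beta> (r n)" for n
  proof -
    have "(\<integral>\<omega>. ?f (W n \<omega>) \<partial>M) - t * (\<bar>D (r n) / 4 - l / 4\<bar> + sqrt (96 * ((e (r n))\<^sup>2 * D (r n))) / 12)
      \<le> (\<integral>\<omega>. min (mixture_density (a (r n)) (J (r n)) \<omega>) t \<partial>M)"
      unfolding W_def D_def
      by (rule mixture_density_lower[where u="\<lambda>j. (a (r n) j)\<^sup>2", OF _ e0 t]) (use a in auto)
    moreover have "t * p (r n) \<le> t * (1 - std_normal_cdf x + \<eta> (r n))"
      using p t by (intro mult_left_mono) auto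
    ultimately show ?thesis using \<beta>[OF t, of "r n"] unfolding low_def by linarith
  qed
  have cont: "isCont std_normal_cdf y" for y
    using isCont_std_normal_cdf[of y] by (simp add: std_normal_cdf_def)
  have "(\<lambda>n. std_normal_cdf (x - sqrt (D (r n) / 2))) \<longlonglongrightarrow> std_normal_cdf (x - sqrt (l / 2))"
    by (intro isCont_tendsto_compose[OF cont] tendsto_intros l) simp
  then have "\<forall>\<^sub>F n in sequentially. std_normal_cdf (x - sqrt (D (r n) / 2)) < std_normal_cdf (x - d) + \<epsilon> / 2"
    using \<epsilon> unfolding d_def by (intro order_tendstoD(2)) auto
  moreover have "\<forall>\<^sub>F n in sequentially. std_normal_cdf (x - d) - \<epsilon> / 2 <
      low n"
    using lim \<epsilon> by (intro order_tendstoD(1)) auto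
  ultimately have "\<forall>\<^sub>F n in sequentially. std_normal_cdf (x - sqrt (D (r n) / 2)) - \<epsilon> \<le> \<beta> (r n)"
  proof eventually_elim
    case (elim n) then show ?case using le[of n] by linarith
  qed
  then show "\<exists>n. std_normal_cdf (x - sqrt (D (r n) / 2)) - \<epsilon> \<le> \<beta> (r n)"
    by (rule eventually_happens'[OF sequentially_bot])
qed

end

text \<open>The numbers \<open>u n j\<close> occur twice: as weights of the squared normalised
  observations in the statistic, and, up to the inflation of the prior, as squared signal-to-noise
  ratios of the least favourable coefficients. Hence the sum of their squares, \<open>A n\<close>,
  governs both bounds.\<close>

locale gauss_besov_test = gauss_noise +
  fixes \<sigma> s P\<^sub>0 :: real and \<rho> k :: "nat \<Rightarrow> real" and u :: "nat \<Rightarrow> nat \<Rightarrow> real" and A :: "nat \<Rightarrow> real"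
    and a\<^sub>0 b\<^sub>0 :: real
  assumes sigma: "\<sigma> > 0" and s: "s > 0" and P0: "P\<^sub>0 > 0"
    and k_pos: "\<And>n. n \<ge> 1 \<Longrightarrow> k n > 0"
    and rho_eq: "\<And>n. n \<ge> 1 \<Longrightarrow> \<rho> n = (1 + 2 * s) * P\<^sub>0 * k n powr (- 2 * s)"
    and k_lim: "filterlim k at_top sequentially"
    and u_def: "\<And>n j. u n j = real n / \<sigma>\<^sup>2 * prof s P\<^sub>0 (k n) (real j)"
    and A_eq: "\<And>n. n \<ge> 1 \<Longrightarrow> A n = A_seq \<sigma> n (\<lambda>j. prof s P\<^sub>0 (k n) (real j))"
    and a0: "a\<^sub>0 > 0" and A_lower: "\<forall>\<^sub>F n in sequentially. a\<^sub>0 \<le> A n"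
    and A_upper: "\<forall>\<^sub>F n in sequentially. A n \<le> b\<^sub>0"
begin

abbreviation V :: "nat \<Rightarrow> (real \<Rightarrow> real) set" where
  "V \<equiv> alternatives \<phi> s P\<^sub>0 \<rho>"

abbreviation \<xi> :: "nat \<Rightarrow> 'a \<Rightarrow> real" where
  "\<xi> j \<equiv> w (\<phi> j)"

abbreviation h :: "nat \<Rightarrow> nat \<Rightarrow> real" where
  "h n j \<equiv> prof s P\<^sub>0 (k n) (real j)"


section \<open>The weights of the statistic\<close>

lemma u_nonneg: "0 \<le> u n j"
  using prof_nonneg[OF s P0] by (simp add: u_def)

lemma u_antimono: "n \<ge> 1 \<Longrightarrow> i \<le> j \<Longrightarrow> u n j \<le> u n i"
  unfolding u_def using prof_antimono[OF s P0 k_pos] by (intro mult_left_mono) auto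

lemma u_summable: "n \<ge> 1 \<Longrightarrow> summable (\<lambda>j. u n (Suc j))"
  unfolding u_def using summable_prof[OF s P0 k_pos] by (intro summable_mult)

lemma u_sq_summable:
  assumes "n \<ge> 1"
  shows "summable (\<lambda>j. (u n (Suc j))\<^sup>2)"
proof (rule summable_comparison_test')
  show "summable (\<lambda>j. u n 1 * u n (Suc j))" using u_summable[OF assms] by (rule summable_mult)
  show "norm ((u n (Suc j))\<^sup>2) \<le> u n 1 * u n (Suc j)" if "j \<ge> 0" for j
    using u_antimono[OF assms, of 1 "Suc j"] u_nonneg by (auto simp: power2_eq_square intro!: mult_right_mono)
qed

lemma A_suminf:
  assumes n: "n \<ge> 1"
  shows "A n = (\<Sum>j. (u n (Suc j))\<^sup>2)"
proof -
  define c where "c = (real n)\<^sup>2 / \<sigma> ^ 4"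
  have c0: "c \<noteq> 0" using n sigma by (simp add: c_def)
  have eq: "(\<lambda>j. (u n (Suc j))\<^sup>2) = (\<lambda>j. c * (h n (Suc j))\<^sup>2)"
    by (simp add: u_def c_def power_mult_distrib power_divide flip: power_mult)
  have "summable (\<lambda>j. (h n (Suc j))\<^sup>2)"
    using u_sq_summable[OF n] c0 unfolding eq by (simp add: summable_cmult_iff)
  then show ?thesis unfolding A_eq[OF n] A_seq_def eq c_def[symmetric] by (rule suminf_mult[symmetric])
qed

lemma A_nonneg: "n \<ge> 1 \<Longrightarrow> A n \<ge> 0"
  unfolding A_suminf by (intro suminf_nonneg u_sq_summable) auto

lemma sum_u_sq_le:
  assumes "n \<ge> 1"
  shows "(\<Sum>j=1..N. (u n j)\<^sup>2) \<le> A n"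
proof -
  have "(\<Sum>j=1..N. (u n j)\<^sup>2) = (\<Sum>j<N. (u n (Suc j))\<^sup>2)"
    by (simp add: sum.atLeast1_atMost_eq)
  also have "\<dots> \<le> A n" unfolding A_suminf[OF assms] using u_sq_summable[OF assms] by (intro sum_le_suminf) auto
  finally show ?thesis .
qed

lemma eventually_k_ge: "\<forall>\<^sub>F n in sequentially. c \<le> k n"
  using k_lim by (simp add: filterlim_at_top)

text \<open>The weights are constant up to \<open>k n\<close>, so about \<open>k n\<close> copies of
  \<open>(u n 1)\<^sup>2\<close> are contained in the bounded sum \<open>A n\<close>, while
  \<open>k n\<close> tends to infinity. This is the uniform smallness required by the central limit
  theorem.\<close>

lemma u_1_tendsto: "(\<lambda>n. u n 1) \<longlonglongrightarrow> 0"
proof -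
  have "\<forall>\<^sub>F n in sequentially. norm ((u n 1)\<^sup>2) \<le> b\<^sub>0 / (k n - 1)"
    using eventually_k_ge[of 2] A_upper eventually_ge_at_top[of 1]
  proof eventually_elim
    case (elim n)
    define m where "m = nat \<lfloor>k n\<rfloor>"
    have m: "real m \<le> k n" "k n - 1 \<le> real m" using elim by (auto simp: m_def)
    have "real m * (u n 1)\<^sup>2 = (\<Sum>j=1..m. (u n j)\<^sup>2)"
    proof -
      have uj: "u n j = u n 1" if "j \<in> {1..m}" for j
      proof -
        have "real j \<le> k n" "1 \<le> k n" using that m elim by auto
        then have "h n j = prof s P\<^sub>0 (k n) 1"
          using prof_le_level[of "real j" "k n" s P\<^sub>0] prof_le_level[of 1 "k n" s P\<^sub>0] by argo
        then show ?thesis unfolding u_def by simp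
      qed
      have "(\<Sum>j=1..m. (u n j)\<^sup>2) = (\<Sum>j=1..m. (u n 1)\<^sup>2)"
        by (intro sum.cong refl arg_cong[where f="\<lambda>x. x\<^sup>2"] uj)
      then show ?thesis by simp
    qed
    also have "\<dots> \<le> b\<^sub>0" using sum_u_sq_le[of n m] elim by linarith
    finally have "real m * (u n 1)\<^sup>2 \<le> b\<^sub>0" .
    moreover have "(k n - 1) * (u n 1)\<^sup>2 \<le> real m * (u n 1)\<^sup>2" using m by (intro mult_right_mono) auto
    ultimately show ?case using elim by (simp add: pos_le_divide_eq mult.commute)
  qed
  moreover have "(\<lambda>n. b\<^sub>0 / (k n - 1)) \<longlonglongrightarrow> 0"
  proof (rule tendsto_divide_0[OF tendsto_const])
    have "filterlim (\<lambda>n. -1 + k n) at_top sequentially"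
      by (rule filterlim_tendsto_add_at_top[OF tendsto_const k_lim])
    then show "filterlim (\<lambda>n. k n - 1) at_infinity sequentially"
      by (intro filterlim_at_top_imp_at_infinity) (simp add: algebra_simps)
  qed
  ultimately have "(\<lambda>n. (u n 1)\<^sup>2) \<longlonglongrightarrow> 0" by (rule Lim_null_comparison)
  then have "(\<lambda>n. sqrt ((u n 1)\<^sup>2)) \<longlonglongrightarrow> sqrt 0" by (rule tendsto_real_sqrt)
  then show ?thesis using u_nonneg by simp
qed

definition sign_prior :: "real \<Rightarrow> nat \<Rightarrow> nat \<Rightarrow> (nat \<Rightarrow> real) \<Rightarrow> bool" where
  "sign_prior c n J b \<longleftrightarrow> (\<forall>j. 0 \<le> b j \<and> b j \<le> c * h n j) \<and>
    (\<forall>S. (\<lambda>t. \<Sum>j=1..J. (sqrt (b j) * (if j \<in> S then 1 else -1)) * \<phi> j t) \<in> V n)"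

text \<open>For fixed \<open>q\<close> the gain \<open>q powr (- s)\<close> exceeds 1, whereas the
  discretisation loss \<open>2 * s / (q * k n)\<close> vanishes.\<close>

lemma eventually_sign_prior:
  assumes q: "0 < q" "q < 1"
  shows "\<forall>\<^sub>F n in sequentially. \<exists>J b. sign_prior (q powr (- 2 * s - 1)) n J b"
proof -
  have "(\<lambda>n. q powr (- s) * (1 + 2 * s - 2 * s / (q * k n))) \<longlonglongrightarrow> q powr (- s) * (1 + 2 * s - 0)"
  proof (intro tendsto_intros tendsto_divide_0[OF tendsto_const])
    show "filterlim (\<lambda>n. q * k n) at_infinity sequentially"
      using q by (intro filterlim_at_top_imp_at_infinity filterlim_tendsto_pos_mult_at_top[OF tendsto_const] k_lim) auto
  qed
  moreover have "1 + 2 * s < q powr (- s) * (1 + 2 * s - 0)"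
  proof -
    have "1 < q powr (- s)" using q s powr_less_mono2_neg[of "- s" q 1] by simp
    then show ?thesis using s by simp
  qed
  ultimately have "\<forall>\<^sub>F n in sequentially. 1 + 2 * s < q powr (- s) * (1 + 2 * s - 2 * s / (q * k n))"
    by (rule order_tendstoD(1))
  then show ?thesis
    using eventually_k_ge[of "1 / q"] eventually_ge_at_top[of 1]
  proof eventually_elim
    case (elim n)
    have "1 \<le> q * k n" using elim q by (simp add: field_simps)
    then obtain J b where b: "\<And>j. 0 \<le> b j \<and> b j \<le> q powr (- 2 * s - 1) * h n j"
      and total: "\<rho> n \<le> (\<Sum>j=1..J. b j)"
      and tail: "\<And>j. j \<ge> 1 \<Longrightarrow> (\<Sum>i=j..J. b i) \<le> P\<^sub>0 * q powr s * real j powr (- 2 * s)"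
      using prior_weights_exist[OF s P0 k_pos q, of n] elim rho_eq[of n] by auto
    have "(\<lambda>t. \<Sum>j=1..J. (sqrt (b j) * (if j \<in> S then 1 else -1)) * \<phi> j t) \<in> V n" for S
    proof (rule basis_comb_in_alternatives[where b=b and P="P\<^sub>0 * q powr s"])
      show "(sqrt (b j) * (if j \<in> S then 1 else -1))\<^sup>2 = b j" for j using b[of j] by (simp add: power_mult_distrib)
      show "0 < P\<^sub>0 * q powr s" using P0 q by simp
      have "q powr s < 1" using q s powr_less_mono2[of s q 1] by simp
      then show "P\<^sub>0 * q powr s < P\<^sub>0" using P0 by simp
    qed (fact s total tail)+
    with b show ?case unfolding sign_prior_def by blast
  qed
qed

text \<open>Needed because a real supremum over an empty set of alternatives could not be bounded
  from above. The value \<open>1 / 2\<close> for \<open>q\<close> is arbitrary.\<close>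

lemma eventually_alternatives_nonempty: "\<forall>\<^sub>F n in sequentially. V n \<noteq> {}"
proof -
  have "0 < (1 / 2 :: real)" "(1 / 2 :: real) < 1" by auto
  from eventually_sign_prior[OF this] show ?thesis
    unfolding sign_prior_def by eventually_elim blast
qed

text \<open>The slack \<open>\<eta>\<close> makes the bound apply both to competitors of exact level
  and to the tests \<open>L\<close> themselves, whose level is correct only in the limit.\<close>

lemma type_II_sup_lower:
  fixes K :: "nat \<Rightarrow> observation \<Rightarrow> real"
  assumes K: "\<And>n. n \<ge> 1 \<Longrightarrow> is_test (K n)"
    and level: "\<And>n. n \<ge> 1 \<Longrightarrow> type_I M w \<sigma> n (K n) \<le> 1 - std_normal_cdf x + \<eta> n"
    and \<eta>: "\<eta> \<longlonglongrightarrow> 0" and \<epsilon>: "\<epsilon> > 0"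
  shows "\<forall>\<^sub>F n in sequentially. std_normal_cdf (x - sqrt (A n / 2)) - \<epsilon>
    \<le> type_II_sup M w \<sigma> n (K n) (V n)"
proof -
  have b0: "b\<^sub>0 > 0"
    using eventually_happens'[OF sequentially_bot eventually_conj[OF A_lower A_upper]] a0 by auto
  define z where "z = sqrt (b\<^sub>0 / 2) + 1"
  \<comment> \<open>The inflation of the weights that can be afforded: multiplying
    \<open>sqrt (A n / 2)\<close> by \<open>c\<close> moves the argument of the distribution
    function by at most \<open>\<epsilon> / 2\<close>. The number \<open>q\<close> below is chosen
    to produce exactly this factor.\<close>
  define c where "c = 1 + \<epsilon> / (2 * z)"
  have z: "z > 0" "sqrt (b\<^sub>0 / 2) \<le> z" using b0 by (simp_all add: z_def add_nonneg_pos)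
  have c1: "c > 1" using z \<epsilon> by (simp add: c_def)
  have "(c - 1) * sqrt (b\<^sub>0 / 2) \<le> (c - 1) * z" using c1 z by (intro mult_left_mono) auto
  also have "\<dots> = \<epsilon> / 2" using z by (simp add: c_def)
  finally have cs: "(c - 1) * sqrt (b\<^sub>0 / 2) \<le> \<epsilon> / 2" .
  define q where "q = c powr (- 1 / (2 * s + 1))"
  have q: "0 < q" "q < 1"
    using c1 s powr_less_mono2_neg[of "- 1 / (2 * s + 1)" 1 c] by (simp_all add: q_def)
  have qc: "q powr (- 2 * s - 1) = c"
  proof -
    have "- 1 / (2 * s + 1) * (- 2 * s - 1) = 1" using s by (simp add: field_simps)
    then show ?thesis using c1 by (simp add: q_def powr_powr)
  qed
  have "\<forall>\<^sub>F n in sequentially. \<exists>J b. sign_prior c n J b"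
    using eventually_sign_prior[OF q] unfolding qc .
  then have "\<forall>\<^sub>F n in sequentially. n \<ge> 1 \<and> A n \<le> b\<^sub>0 \<and> (\<exists>J b. sign_prior c n J b)"
    using A_upper eventually_ge_at_top[of 1] by eventually_elim blast
  then obtain n0 where n0: "\<And>n. n \<ge> n0 \<Longrightarrow> n \<ge> 1 \<and> A n \<le> b\<^sub>0"
    and "\<And>n. n \<ge> n0 \<Longrightarrow> \<exists>J b. sign_prior c n J b"
    unfolding eventually_sequentially by blast
  \<comment> \<open>Priors exist only for large \<open>n\<close>; shifting the index makes one
    available for each \<open>n\<close>, and the last step undoes the shift.\<close>
  then have "\<exists>J b. sign_prior c (n + n0) J b" for n by simp
  then obtain J b where prior: "\<And>n. sign_prior c (n + n0) (J n) (b n)" by metis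
  have b: "0 \<le> b n j \<and> b n j \<le> c * h (n + n0) j" for n j
    using prior[of n] unfolding sign_prior_def by blast
  have V: "(\<lambda>t. \<Sum>j=1..J n. (sqrt (b n j) * (if j \<in> S then 1 else -1)) * \<phi> j t) \<in> V (n + n0)" for n S
    using prior[of n] unfolding sign_prior_def by blast
  define a where "a n j = sqrt (real (n + n0)) * sqrt (b n j) / \<sigma>" for n j
  define D where "D = (\<lambda>n. \<Sum>j=1..J n. ((a n j)\<^sup>2)\<^sup>2)"
  have au: "(a n j)\<^sup>2 \<le> c * u (n + n0) j" for n j
  proof -
    have "(a n j)\<^sup>2 = real (n + n0) / \<sigma>\<^sup>2 * b n j" using b[of n j] by (simp add: a_def power_mult_distrib power_divide)
    also have "\<dots> \<le> real (n + n0) / \<sigma>\<^sup>2 * (c * h (n + n0) j)"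
      using b[of n j] by (intro mult_left_mono) auto
    finally show ?thesis by (simp add: u_def mult_ac)
  qed
  have DA: "D n \<le> c\<^sup>2 * A (n + n0)" for n
  proof -
    have "D n \<le> (\<Sum>j=1..J n. (c * u (n + n0) j)\<^sup>2)" unfolding D_def using au by (intro sum_mono power_mono) auto
    also have "\<dots> = c\<^sup>2 * (\<Sum>j=1..J n. (u (n + n0) j)\<^sup>2)" by (simp add: power_mult_distrib sum_distrib_left)
    also have "\<dots> \<le> c\<^sup>2 * A (n + n0)" using sum_u_sq_le[of "n + n0" "J n"] n0[of "n + n0"] by (intro mult_left_mono) auto
    finally show ?thesis .
  qed
  have "\<forall>\<^sub>F n in sequentially. std_normal_cdf (x - sqrt (D n / 2)) - \<epsilon> / 2
    \<le> type_II_sup M w \<sigma> (n + n0) (K (n + n0)) (V (n + n0))"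
    unfolding D_def
  proof (rule mixture_risk_asymptotics[where e="\<lambda>n. c * u (n + n0) 1" and p="\<lambda>n. type_I M w \<sigma> (n + n0) (K (n + n0))"
        and \<eta>="\<lambda>n. \<eta> (n + n0)" and B="c\<^sup>2 * b\<^sub>0"])
    show "0 \<le> c * u (n + n0) 1" for n using c1 u_nonneg by simp
    have "(\<lambda>n. c * u (n + n0) 1) \<longlonglongrightarrow> c * 0"
      by (intro tendsto_intros LIMSEQ_ignore_initial_segment u_1_tendsto)
    then show "(\<lambda>n. c * u (n + n0) 1) \<longlonglongrightarrow> 0" by simp
    show "(a n j)\<^sup>2 \<le> c * u (n + n0) 1" if "j \<in> {1..J n}" for n j
    proof -
      have "c * u (n + n0) j \<le> c * u (n + n0) 1"
        using u_antimono[of "n + n0" 1 j] that c1 n0[of "n + n0"] by (intro mult_left_mono) auto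
      then show ?thesis using au[of n j] by linarith
    qed
    show "(\<Sum>j=1..J n. ((a n j)\<^sup>2)\<^sup>2) \<le> c\<^sup>2 * b\<^sub>0" for n
      using DA[of n] mult_left_mono[of "A (n + n0)" b\<^sub>0 "c\<^sup>2"] n0[of "n + n0"] unfolding D_def by auto
    show "type_I M w \<sigma> (n + n0) (K (n + n0)) \<le> 1 - std_normal_cdf x + \<eta> (n + n0)" for n
      using level[of "n + n0"] n0[of "n + n0"] by auto
    show "(\<lambda>n. \<eta> (n + n0)) \<longlonglongrightarrow> 0" by (intro LIMSEQ_ignore_initial_segment \<eta>)
    show "\<epsilon> / 2 > 0" using \<epsilon> by simp
    fix n and t :: real assume t: "t > 0"
    show "(\<integral>\<omega>. min (mixture_density (a n) (J n) \<omega>) t \<partial>M) - t * type_I M w \<sigma> (n + n0) (K (n + n0))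
      \<le> type_II_sup M w \<sigma> (n + n0) (K (n + n0)) (V (n + n0))"
      using V bayes_risk_bound[OF sigma _ K _ t, of "n + n0" "n + n0" "J n" "\<lambda>j. sqrt (b n j)"] n0[of "n + n0"]
      unfolding a_def by auto
  qed
  then have "\<forall>\<^sub>F n in sequentially. std_normal_cdf (x - sqrt (A (n + n0) / 2)) - \<epsilon>
    \<le> type_II_sup M w \<sigma> (n + n0) (K (n + n0)) (V (n + n0))"
  proof eventually_elim
    case (elim n)
    define y where "y = sqrt (A (n + n0) / 2)"
    have "sqrt (D n / 2) \<le> sqrt (c\<^sup>2 * (A (n + n0) / 2))" using DA[of n] by simp
    also have "\<dots> = c * y" unfolding y_def using c1 by (subst real_sqrt_mult) simp
    finally have "std_normal_cdf (x - c * y) \<le> std_normal_cdf (x - sqrt (D n / 2))"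
      by (intro std_normal_cdf_mono) simp
    moreover have "\<bar>std_normal_cdf (x - y) - std_normal_cdf (x - c * y)\<bar> \<le> \<bar>(x - y) - (x - c * y)\<bar>"
      by (rule abs_std_normal_cdf_diff_le)
    moreover have "\<bar>(x - y) - (x - c * y)\<bar> = (c - 1) * \<bar>y\<bar>"
    proof -
      have "(x - y) - (x - c * y) = (c - 1) * y" by (simp add: algebra_simps)
      then show ?thesis using c1 by (simp add: abs_mult)
    qed
    moreover have "(c - 1) * \<bar>y\<bar> \<le> (c - 1) * sqrt (b\<^sub>0 / 2)"
    proof (rule mult_left_mono)
      have "A (n + n0) \<ge> 0" using n0[of "n + n0"] A_nonneg by simp
      then show "\<bar>y\<bar> \<le> sqrt (b\<^sub>0 / 2)" using n0[of "n + n0"] by (simp add: y_def)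
    qed (use c1 in simp)
    ultimately show ?case using elim cs unfolding y_def by linarith
  qed
  then show ?thesis using eventually_sequentially_seg[of _ n0] by blast
qed

section \<open>The test statistic\<close>

text \<open>The ball controls sums over indices strictly above a real \<open>l\<close>, so the
  closed tail from \<open>j\<close> is reached in the limit as \<open>l\<close> increases to
  \<open>j\<close>.\<close>

lemma besov_ball_tail:
  assumes f: "f \<in> besov_ball \<phi> s P\<^sub>0" and j: "j \<ge> 1"
  shows "(\<Sum>\<^sub>\<infinity>i\<in>{j..}. (ip f (\<phi> i))\<^sup>2) \<le> P\<^sub>0 * real j powr (- 2 * s)"
proof -
  define t where "t = (\<Sum>\<^sub>\<infinity>i\<in>{j..}. (ip f (\<phi> i))\<^sup>2)"
  \<comment> \<open>The denominator starts at 2 so that \<open>l m\<close> is positive even for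
    \<open>j = 1\<close>.\<close>
  define l where "l m = real j - 1 / real (Suc (Suc m))" for m
  have "l m powr (2 * s) * t \<le> P\<^sub>0" for m
  proof -
    have "0 < 1 / real (Suc (Suc m))" "1 / real (Suc (Suc m)) < 1" "1 \<le> real j" using j by simp_all
    then have l: "0 < l m" "real j - 1 < l m" "l m < real j" unfolding l_def by linarith+
    have "{i. real i > l m} = {j..}"
    proof (intro set_eqI iffI)
      fix i assume "i \<in> {i. real i > l m}"
      then have "real j - 1 < real i" using l by simp
      then show "i \<in> {j..}" by simp
    next
      fix i assume "i \<in> {j..}"
      then show "i \<in> {i. real i > l m}" using l by auto
    qed
    then have "ereal (l m powr (2 * s) * t) \<le>
      (SUP l\<in>{0<..}. ereal (l powr (2 * s) * (\<Sum>\<^sub>\<infinity>j\<in>{j. real j > l}. (ip f (\<phi> j))\<^sup>2)))"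
      using l(1) unfolding t_def by (intro SUP_upper2[of "l m"]) auto
    also have "\<dots> < ereal P\<^sub>0" using f by (simp add: besov_ball_def)
    finally show ?thesis by simp
  qed
  moreover have "(\<lambda>m. l m powr (2 * s) * t) \<longlonglongrightarrow> real j powr (2 * s) * t"
  proof -
    have "(\<lambda>m. real j - 1 / real (Suc (Suc m))) \<longlonglongrightarrow> real j - 0"
      using LIMSEQ_Suc[OF LIMSEQ_inverse_real_of_nat]
      by (intro tendsto_diff tendsto_const) (simp add: inverse_eq_divide)
    then have "l \<longlonglongrightarrow> real j" by (simp add: l_def[abs_def])
    then show ?thesis using j by (intro tendsto_intros) auto
  qed
  ultimately have "real j powr (2 * s) * t \<le> P\<^sub>0" by (intro LIMSEQ_le_const2) auto
  then have "real j powr (- 2 * s) * (real j powr (2 * s) * t) \<le> real j powr (- 2 * s) * P\<^sub>0"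
    by (intro mult_left_mono) auto
  moreover have "real j powr (- 2 * s) * (real j powr (2 * s) * t) = t"
    using j by (simp add: mult.assoc[symmetric] powr_add[symmetric])
  ultimately have "t \<le> real j powr (- 2 * s) * P\<^sub>0" by (simp only:)
  then show ?thesis unfolding t_def by (simp only: mult.commute)
qed

lemma rho_eq_ptail: "n \<ge> 1 \<Longrightarrow> \<rho> n = ptail s P\<^sub>0 (k n) 0"
proof -
  assume n: "n \<ge> 1"
  have "k n * k n powr (- 2 * s - 1) = k n powr (- 2 * s)"
    using k_pos[OF n] powr_mult_base[of "k n" "- 2 * s - 1"] by simp
  then have "prof s P\<^sub>0 (k n) (k n) * k n = 2 * s * P\<^sub>0 * k n powr (- 2 * s)"
    by (simp add: prof_def mult.commute mult.left_commute)
  then show ?thesis using k_pos[OF n] rho_eq[OF n] by (simp add: ptail_def algebra_simps)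
qed

text \<open>The drift in units of the noise level: the rescaled observation of coordinate
  \<open>j\<close> is \<open>\<xi> j \<omega> + \<tau> n f j\<close>.\<close>

definition \<tau> :: "nat \<Rightarrow> (real \<Rightarrow> real) \<Rightarrow> nat \<Rightarrow> real" where
  "\<tau> n f j = sqrt (real n) * ip f (\<phi> j) / \<sigma>"

text \<open>\<open>extremal_prof_sum\<close> for the energy tails of \<open>f\<close>: their
  increments are the squared coefficients, the first tail is the squared norm, and the ball bounds
  the others. Both sides scale by \<open>(real n / \<sigma>\<^sup>2)\<^sup>2\<close>.\<close>

lemma drift_lower:
  assumes n: "n \<ge> 1" and f: "f \<in> V n" and N: "N \<ge> 1" "k n \<le> real N"
  shows "(\<Sum>j=2..Suc N. (u n j)\<^sup>2) \<le> (\<Sum>j=1..N. u n j * (\<tau> n f j)\<^sup>2)"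
proof -
  have fB: "f \<in> besov_ball \<phi> s P\<^sub>0" and fn: "\<rho> n \<le> (Lnorm f)\<^sup>2" using f by (auto simp: alternatives_def)
  have fL: "f \<in> Ltwo" using fB by (simp add: besov_ball_def)
  define t where "t j = (\<Sum>\<^sub>\<infinity>i\<in>{j..}. (ip f (\<phi> i))\<^sup>2)" for j :: nat
  note P = parseval[OF basis fL]
  have sm: "(\<lambda>i. (ip f (\<phi> i))\<^sup>2) summable_on {j..}" if "j \<ge> 1" for j
    by (rule summable_on_subset_banach[OF has_sum_imp_summable[OF P]]) (use that in auto)
  have t1: "t 1 = (Lnorm f)\<^sup>2" unfolding t_def using P by (rule infsumI)
  have td: "t j - t (Suc j) = (ip f (\<phi> j))\<^sup>2" if "j \<ge> 1" for j
  proof -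
    have "{j..} = insert j {Suc j..}" by auto
    then show ?thesis unfolding t_def using infsum_insert[OF sm[of "Suc j"], of j] by simp
  qed
  have "(\<Sum>j=2..Suc N. (h n j)\<^sup>2) \<le> (\<Sum>j=1..N. h n j * (t j - t (Suc j)))"
    using t1 fn rho_eq_ptail[OF n] besov_ball_tail[OF fB]
    by (intro extremal_prof_sum[OF s P0 k_pos[OF n] _ _ N]) (auto simp: t_def)
  also have "\<dots> = (\<Sum>j=1..N. h n j * (ip f (\<phi> j))\<^sup>2)"
    using td by (intro sum.cong) auto
  finally have "(real n / \<sigma>\<^sup>2)\<^sup>2 * (\<Sum>j=2..Suc N. (h n j)\<^sup>2) \<le>
    (real n / \<sigma>\<^sup>2)\<^sup>2 * (\<Sum>j=1..N. h n j * (ip f (\<phi> j))\<^sup>2)"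
    by (intro mult_left_mono) auto
  moreover have "(u n j)\<^sup>2 = (real n / \<sigma>\<^sup>2)\<^sup>2 * (h n j)\<^sup>2" for j
    by (simp only: u_def power_mult_distrib)
  moreover have "u n j * (\<tau> n f j)\<^sup>2 = (real n / \<sigma>\<^sup>2)\<^sup>2 * (h n j * (ip f (\<phi> j))\<^sup>2)" for j
  proof -
    have "(\<tau> n f j)\<^sup>2 = real n / \<sigma>\<^sup>2 * (ip f (\<phi> j))\<^sup>2" by (simp add: \<tau>_def power_mult_distrib power_divide)
    then show ?thesis by (simp add: u_def power2_eq_square)
  qed
  ultimately show ?thesis by (simp only: sum_distrib_left)
qed

text \<open>The expectations add up to the convergent series of the weights. The mean of the shifted
  series is what Markov's inequality needs for the truncation error.\<close>

lemma u_xi_summable: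
  assumes n: "n \<ge> 1"
  shows "AE \<omega> in M. summable (\<lambda>j. u n (Suc j) * (\<xi> (Suc j) \<omega>)\<^sup>2)"
    and "integrable M (\<lambda>\<omega>. \<Sum>j. u n (Suc (j + N)) * (\<xi> (Suc (j + N)) \<omega>)\<^sup>2)"
    and "(\<integral>\<omega>. (\<Sum>j. u n (Suc (j + N)) * (\<xi> (Suc (j + N)) \<omega>)\<^sup>2) \<partial>M) = (\<Sum>j. u n (Suc (j + N)))"
proof -
  have D: "distributed M lborel (\<xi> (Suc j)) std_normal_density" for j
    by (rule xi_distributed) simp
  have i: "integrable M (\<lambda>\<omega>. u n (Suc j) * (\<xi> (Suc j) \<omega>)\<^sup>2)" for j
    using std_normal_moment_integrable[OF D] by simp
  have e: "(\<integral>\<omega>. u n (Suc j) * (\<xi> (Suc j) \<omega>)\<^sup>2 \<partial>M) = u n (Suc j)" for j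
    using std_normal_moments(2)[OF D] by simp
  have "(\<integral>\<^sup>+\<omega>. (\<Sum>j. ennreal (u n (Suc j) * (\<xi> (Suc j) \<omega>)\<^sup>2)) \<partial>M) =
    (\<Sum>j. \<integral>\<^sup>+\<omega>. ennreal (u n (Suc j) * (\<xi> (Suc j) \<omega>)\<^sup>2) \<partial>M)"
    by (rule nn_integral_suminf) simp
  also have "\<dots> = (\<Sum>j. ennreal (u n (Suc j)))"
  proof (rule suminf_cong)
    fix j
    have "(\<integral>\<^sup>+\<omega>. ennreal (u n (Suc j) * (\<xi> (Suc j) \<omega>)\<^sup>2) \<partial>M) = ennreal (\<integral>\<omega>. u n (Suc j) * (\<xi> (Suc j) \<omega>)\<^sup>2 \<partial>M)"
      by (rule nn_integral_eq_integral[OF i]) (simp add: u_nonneg)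
    then show "(\<integral>\<^sup>+\<omega>. ennreal (u n (Suc j) * (\<xi> (Suc j) \<omega>)\<^sup>2) \<partial>M) = ennreal (u n (Suc j))"
      unfolding e .
  qed
  also have "\<dots> = ennreal (\<Sum>j. u n (Suc j))"
    using u_summable[OF n] u_nonneg by (intro suminf_ennreal2) auto
  finally have "(\<integral>\<^sup>+\<omega>. (\<Sum>j. ennreal (u n (Suc j) * (\<xi> (Suc j) \<omega>)\<^sup>2)) \<partial>M) \<noteq> \<infinity>" by simp
  then have "AE \<omega> in M. (\<Sum>j. ennreal (u n (Suc j) * (\<xi> (Suc j) \<omega>)\<^sup>2)) \<noteq> \<infinity>"
    by (rule nn_integral_PInf_AE[rotated]) simp
  then show ae: "AE \<omega> in M. summable (\<lambda>j. u n (Suc j) * (\<xi> (Suc j) \<omega>)\<^sup>2)"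
    by eventually_elim (rule summable_suminf_not_top, auto simp: u_nonneg)
  have ae2: "AE \<omega> in M. summable (\<lambda>j. norm (u n (Suc (j + N)) * (\<xi> (Suc (j + N)) \<omega>)\<^sup>2))"
    using ae
  proof eventually_elim
    case (elim \<omega>)
    then have "summable (\<lambda>j. u n (Suc (j + N)) * (\<xi> (Suc (j + N)) \<omega>)\<^sup>2)"
      by (subst (asm) summable_iff_shift[of _ N, symmetric]) simp
    then show ?case using u_nonneg by simp
  qed
  have sm: "summable (\<lambda>j. \<integral>\<omega>. norm (u n (Suc (j + N)) * (\<xi> (Suc (j + N)) \<omega>)\<^sup>2) \<partial>M)"
  proof -
    have "(\<integral>\<omega>. norm (u n (Suc (j + N)) * (\<xi> (Suc (j + N)) \<omega>)\<^sup>2) \<partial>M) = u n (Suc (j + N))" for j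
      using e[of "j + N"] u_nonneg by simp
    then show ?thesis using u_summable[OF n] summable_iff_shift[of "\<lambda>j. u n (Suc j)" N] by simp
  qed
  show "integrable M (\<lambda>\<omega>. \<Sum>j. u n (Suc (j + N)) * (\<xi> (Suc (j + N)) \<omega>)\<^sup>2)"
    by (rule integrable_suminf[OF i ae2 sm])
  show "(\<integral>\<omega>. (\<Sum>j. u n (Suc (j + N)) * (\<xi> (Suc (j + N)) \<omega>)\<^sup>2) \<partial>M) = (\<Sum>j. u n (Suc (j + N)))"
    using integral_suminf[OF i ae2 sm] unfolding e .
qed

text \<open>Summability follows from
  \<open>(a + b)\<^sup>2 \<le> 2 * a\<^sup>2 + 2 * b\<^sup>2\<close>, bounded weights and Parseval.
  It is recorded because the value of the series is meaningful only where it converges.\<close>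

lemma T_stat_expansion:
  assumes n: "n \<ge> 1" and f: "f \<in> Ltwo"
  shows "AE \<omega> in M. summable (\<lambda>j. u n (Suc j) * (\<xi> (Suc j) \<omega> + \<tau> n f (Suc j))\<^sup>2) \<and>
    T_stat \<sigma> n (h n) (coords \<phi> (obs w \<sigma> n f \<omega>)) =
      (\<Sum>j. u n (Suc j) * (\<xi> (Suc j) \<omega> + \<tau> n f (Suc j))\<^sup>2)"
  using u_xi_summable(1)[OF n]
proof eventually_elim
  case (elim \<omega>)
  have "range Suc = {1..}" by (metis atLeast_Suc_greaterThan greaterThan_0 One_nat_def)
  then have "((\<lambda>j. (ip f (\<phi> j))\<^sup>2) has_sum (Lnorm f)\<^sup>2) (range Suc)" using parseval[OF basis f] by simp
  then have "((\<lambda>j. (ip f (\<phi> (Suc j)))\<^sup>2) has_sum (Lnorm f)\<^sup>2) UNIV"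
    by (subst (asm) has_sum_reindex) (simp_all add: o_def)
  then have "summable (\<lambda>j. (ip f (\<phi> (Suc j)))\<^sup>2)" by (rule has_sum_imp_sums[THEN sums_summable])
  then have "summable (\<lambda>j. (2 * u n 1 * (real n / \<sigma>\<^sup>2)) * (ip f (\<phi> (Suc j)))\<^sup>2)" by (rule summable_mult)
  moreover have "summable (\<lambda>j. 2 * (u n (Suc j) * (\<xi> (Suc j) \<omega>)\<^sup>2))" using elim by (rule summable_mult)
  ultimately have "summable (\<lambda>j. 2 * (u n (Suc j) * (\<xi> (Suc j) \<omega>)\<^sup>2) + (2 * u n 1 * (real n / \<sigma>\<^sup>2)) * (ip f (\<phi> (Suc j)))\<^sup>2)"
    by (rule summable_add[rotated])
  then have sm: "summable (\<lambda>j. u n (Suc j) * (\<xi> (Suc j) \<omega> + \<tau> n f (Suc j))\<^sup>2)"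
  proof (rule summable_comparison_test'[where N=0])
    fix j :: nat
    have "(\<xi> (Suc j) \<omega> + \<tau> n f (Suc j))\<^sup>2 \<le> 2 * (\<xi> (Suc j) \<omega>)\<^sup>2 + 2 * (\<tau> n f (Suc j))\<^sup>2"
      using sum_squares_bound[of "\<xi> (Suc j) \<omega>" "\<tau> n f (Suc j)"] by (simp add: power2_sum)
    then have "u n (Suc j) * (\<xi> (Suc j) \<omega> + \<tau> n f (Suc j))\<^sup>2 \<le> u n (Suc j) * (2 * (\<xi> (Suc j) \<omega>)\<^sup>2 + 2 * (\<tau> n f (Suc j))\<^sup>2)"
      using u_nonneg by (rule mult_left_mono)
    also have "\<dots> = 2 * (u n (Suc j) * (\<xi> (Suc j) \<omega>)\<^sup>2) + 2 * (u n (Suc j) * (\<tau> n f (Suc j))\<^sup>2)" by (simp add: algebra_simps)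
    also have "u n (Suc j) * (\<tau> n f (Suc j))\<^sup>2 \<le> u n 1 * (\<tau> n f (Suc j))\<^sup>2"
      using u_antimono[OF n, of 1 "Suc j"] by (intro mult_right_mono) auto
    also have "u n 1 * (\<tau> n f (Suc j))\<^sup>2 = u n 1 * (real n / \<sigma>\<^sup>2) * (ip f (\<phi> (Suc j)))\<^sup>2"
      by (simp add: \<tau>_def power_mult_distrib power_divide)
    finally show "norm (u n (Suc j) * (\<xi> (Suc j) \<omega> + \<tau> n f (Suc j))\<^sup>2) \<le>
      2 * (u n (Suc j) * (\<xi> (Suc j) \<omega>)\<^sup>2) + (2 * u n 1 * (real n / \<sigma>\<^sup>2)) * (ip f (\<phi> (Suc j)))\<^sup>2"
      using u_nonneg by (simp add: mult.assoc)
  qed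
  define c where "c = (real n)\<^sup>2 / \<sigma> ^ 4"
  have c0: "c \<noteq> 0" using n sigma by (simp add: c_def)
  define g where "g j = h n (Suc j) * (coords \<phi> (obs w \<sigma> n f \<omega>) (Suc j))\<^sup>2" for j
  have summand: "u n (Suc j) * (\<xi> (Suc j) \<omega> + \<tau> n f (Suc j))\<^sup>2 = c * g j" for j
  proof -
    have "\<xi> (Suc j) \<omega> + \<tau> n f (Suc j) = (sqrt (real n) / \<sigma>) * (ip f (\<phi> (Suc j)) + \<sigma> / sqrt (real n) * \<xi> (Suc j) \<omega>)"
      using n sigma by (simp add: \<tau>_def field_simps)
    also have "ip f (\<phi> (Suc j)) + \<sigma> / sqrt (real n) * \<xi> (Suc j) \<omega> = coords \<phi> (obs w \<sigma> n f \<omega>) (Suc j)"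
      by (simp add: coords_def obs_def)
    finally have "(\<xi> (Suc j) \<omega> + \<tau> n f (Suc j))\<^sup>2 = (real n / \<sigma>\<^sup>2) * (coords \<phi> (obs w \<sigma> n f \<omega>) (Suc j))\<^sup>2"
      by (simp add: power_mult_distrib power_divide)
    then show ?thesis by (simp add: u_def g_def c_def power2_eq_square power4_eq_xxxx mult_ac)
  qed
  have "summable g" using sm c0 unfolding summand by (simp add: summable_cmult_iff)
  then have "(\<Sum>j. c * g j) = c * suminf g" by (rule suminf_mult)
  then show ?case using sm unfolding summand T_stat_def c_def g_def by simp
qed

section \<open>The tests and their error probabilities\<close>

definition L :: "real \<Rightarrow> nat \<Rightarrow> observation \<Rightarrow> real" where
  "L x n = region_test \<phi> (critical_region \<sigma> n (h n) (\<rho> n) x)"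

lemma T_stat_measurable: "(\<lambda>Y. T_stat \<sigma> n g (coords \<phi> Y)) \<in> borel_measurable obs_space"
proof -
  have "(\<lambda>Y. Y (\<phi> (Suc j))) \<in> borel_measurable obs_space" for j
    unfolding obs_space_def by (rule measurable_component_singleton) simp
  then show ?thesis unfolding T_stat_def coords_def by measurable
qed

lemma is_test_L: "is_test (L x n)"
proof -
  note [measurable] = T_stat_measurable
  have "{Y \<in> space obs_space. coords \<phi> Y \<in> critical_region \<sigma> n g (\<rho> n) x} \<in> sets obs_space" for g
    unfolding critical_region_def by simp measurable
  then have "(indicator {Y \<in> space obs_space. coords \<phi> Y \<in> critical_region \<sigma> n (h n) (\<rho> n) x}
     :: observation \<Rightarrow> real) \<in> borel_measurable obs_space" by simp
  also have "?this \<longleftrightarrow> L x n \<in> borel_measurable obs_space"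
    by (intro measurable_cong) (simp add: L_def region_test_def indicator_def)
  finally show ?thesis by (simp add: is_test_def L_def region_test_def indicator_def)
qed

definition crit :: "real \<Rightarrow> nat \<Rightarrow> real" where
  "crit x n = C_seq \<sigma> n (\<rho> n) + x * sqrt (2 * A n)"

lemma type_II_L:
  assumes n: "n \<ge> 1" and A: "A n > 0" and f: "f \<in> Ltwo"
  shows "type_II M w \<sigma> n (L x n) f =
    prob {\<omega> \<in> space M. (\<Sum>j. u n (Suc j) * (\<xi> (Suc j) \<omega> + \<tau> n f (Suc j))\<^sup>2) \<le> crit x n}"
    (is "_ = prob ?E")
proof -
  have E: "?E \<in> sets M" by measurable
  have "type_II M w \<sigma> n (L x n) f = (\<integral>\<omega>. indicator ?E \<omega> \<partial>M)"
    unfolding type_II_def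
  proof (rule integral_cong_AE)
    show "(\<lambda>\<omega>. 1 - L x n (obs w \<sigma> n f \<omega>)) \<in> borel_measurable M"
      using integrable_test[OF is_test_L, of x n \<sigma> n f] by auto
    show "(indicator ?E :: _ \<Rightarrow> real) \<in> borel_measurable M" using E by simp
    show "AE \<omega> in M. 1 - L x n (obs w \<sigma> n f \<omega>) = indicator ?E \<omega>"
      using T_stat_expansion[OF n f] AE_space
    proof eventually_elim
      case (elim \<omega>)
      define T where "T = T_stat \<sigma> n (h n) (coords \<phi> (obs w \<sigma> n f \<omega>))"
      have "(2 * A n) powr (- 1 / 2) = 1 / sqrt (2 * A n)"
        using A by (simp add: powr_minus_divide powr_half_sqrt)
      then have "coords \<phi> (obs w \<sigma> n f \<omega>) \<in> critical_region \<sigma> n (h n) (\<rho> n) x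
        \<longleftrightarrow> x < (T - C_seq \<sigma> n (\<rho> n)) / sqrt (2 * A n)"
        unfolding critical_region_def T_def[symmetric] A_eq[OF n, symmetric] by (simp add: T_def)
      also have "\<dots> \<longleftrightarrow> crit x n < T" using A by (simp add: crit_def pos_less_divide_eq algebra_simps)
      finally show ?case using elim unfolding L_def region_test_def T_def by (auto simp: indicator_def)
    qed
  qed
  also have "\<dots> = prob ?E" using E by simp
  finally show ?thesis .
qed

text \<open>A truncation point at which everything discarded is negligible: the mean of the
  remainder is so small that Markov's inequality at level \<open>1 / n\<close> leaves probability
  \<open>1 / n\<close>, and the losses in \<open>A n\<close> and in the centering are at most
  \<open>1 / n\<close>. It also lies beyond the cut-off, as \<open>drift_lower\<close>
  requires.\<close>

definition trunc :: "nat \<Rightarrow> nat" where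
  "trunc n = (SOME N. N \<ge> 1 \<and> k n \<le> real N \<and> (\<Sum>j. u n (Suc (j + N))) \<le> 1 / (real n)\<^sup>2 \<and>
     A n - (\<Sum>j=1..N. (u n j)\<^sup>2) \<le> 1 / real n \<and> real n / \<sigma>\<^sup>2 * ptail s P\<^sub>0 (k n) (real (Suc N)) \<le> 1 / real n)"

lemma trunc:
  assumes n: "n \<ge> 1"
  shows "trunc n \<ge> 1" "k n \<le> real (trunc n)" "(\<Sum>j. u n (Suc (j + trunc n))) \<le> 1 / (real n)\<^sup>2"
    "A n - (\<Sum>j=1..trunc n. (u n j)\<^sup>2) \<le> 1 / real n"
    "real n / \<sigma>\<^sup>2 * ptail s P\<^sub>0 (k n) (real (Suc (trunc n))) \<le> 1 / real n"
proof -
  have "\<forall>\<^sub>F N in sequentially. (\<Sum>j. u n (Suc (j + N))) < 1 / (real n)\<^sup>2"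
    using n by (intro order_tendstoD(2)[OF suminf_exist_split2[OF u_summable[OF n]]]) auto
  moreover have "\<forall>\<^sub>F N in sequentially. A n - 1 / real n < (\<Sum>j=1..N. (u n j)\<^sup>2)"
  proof (rule order_tendstoD(1))
    have "(\<lambda>N. \<Sum>j<N. (u n (Suc j))\<^sup>2) \<longlonglongrightarrow> A n"
      using summable_LIMSEQ[OF u_sq_summable[OF n]] by (simp add: A_suminf[OF n])
    then show "(\<lambda>N. \<Sum>j=1..N. (u n j)\<^sup>2) \<longlonglongrightarrow> A n"
      by (simp add: sum.atLeast1_atMost_eq)
    show "A n - 1 / real n < A n" using n by simp
  qed
  moreover have "\<forall>\<^sub>F N in sequentially. real n / \<sigma>\<^sup>2 * ptail s P\<^sub>0 (k n) (real (Suc N)) < 1 / real n"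
  proof (rule order_tendstoD(2))
    have "(\<lambda>N. real n / \<sigma>\<^sup>2 * ptail s P\<^sub>0 (k n) (real (Suc N))) \<longlonglongrightarrow> real n / \<sigma>\<^sup>2 * 0"
      by (intro tendsto_mult tendsto_const LIMSEQ_Suc[OF ptail_tendsto_0[OF s]])
    then show "(\<lambda>N. real n / \<sigma>\<^sup>2 * ptail s P\<^sub>0 (k n) (real (Suc N))) \<longlonglongrightarrow> 0" by simp
    show "0 < 1 / real n" using n by simp
  qed
  moreover have "\<forall>\<^sub>F N in sequentially. k n \<le> real N"
    using filterlim_real_sequentially by (simp add: filterlim_at_top)
  moreover note eventually_ge_at_top[of "1::nat"]
  ultimately have "\<forall>\<^sub>F N in sequentially. N \<ge> 1 \<and> k n \<le> real N \<and> (\<Sum>j. u n (Suc (j + N))) \<le> 1 / (real n)\<^sup>2 \<and>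
     A n - (\<Sum>j=1..N. (u n j)\<^sup>2) \<le> 1 / real n \<and> real n / \<sigma>\<^sup>2 * ptail s P\<^sub>0 (k n) (real (Suc N)) \<le> 1 / real n"
    by eventually_elim auto
  from someI_ex[OF eventually_happens'[OF sequentially_bot this]]
  show "trunc n \<ge> 1" "k n \<le> real (trunc n)" "(\<Sum>j. u n (Suc (j + trunc n))) \<le> 1 / (real n)\<^sup>2"
    "A n - (\<Sum>j=1..trunc n. (u n j)\<^sup>2) \<le> 1 / real n"
    "real n / \<sigma>\<^sup>2 * ptail s P\<^sub>0 (k n) (real (Suc (trunc n))) \<le> 1 / real n"
    unfolding trunc_def[symmetric] by auto
qed

text \<open>\<open>C_seq\<close> is a multiple of the integral of the profile over the half-line and
  the sum of the weights is its right-endpoint sum. They differ by at most one step,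
  \<open>u n 1\<close>, and the tail beyond the truncation.\<close>

lemma centering_bounds:
  assumes n: "n \<ge> 1" and kn: "k n \<ge> 1"
  shows "0 \<le> C_seq \<sigma> n (\<rho> n) - (\<Sum>j=1..trunc n. u n j)"
    "C_seq \<sigma> n (\<rho> n) - (\<Sum>j=1..trunc n. u n j) \<le> u n 1 + 1 / real n"
proof -
  note b = ptail_sum_bounds[OF s P0 k_pos[OF n]]
  have c: "0 \<le> real n / \<sigma>\<^sup>2" by simp
  have S: "(\<Sum>j=1..trunc n. u n j) = real n / \<sigma>\<^sup>2 * (\<Sum>j=1..trunc n. h n j)"
    by (simp add: u_def sum_distrib_left)
  have C: "C_seq \<sigma> n (\<rho> n) = real n / \<sigma>\<^sup>2 * ptail s P\<^sub>0 (k n) 0"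
    using rho_eq_ptail[OF n] by (simp add: C_seq_def)
  show "0 \<le> C_seq \<sigma> n (\<rho> n) - (\<Sum>j=1..trunc n. u n j)"
    unfolding S C using mult_left_mono[OF b(1)[of 0 "trunc n"] c] by simp
  have "ptail s P\<^sub>0 (k n) 0 - ptail s P\<^sub>0 (k n) 1 \<le> prof s P\<^sub>0 (k n) 0"
    using ptail_diff_bounds[OF s P0 k_pos[OF n], of 0 1] by simp
  also have "prof s P\<^sub>0 (k n) 0 = prof s P\<^sub>0 (k n) 1"
    using kn prof_le_level[of 0 "k n" s P\<^sub>0] prof_le_level[of 1 "k n" s P\<^sub>0] by argo
  finally have "ptail s P\<^sub>0 (k n) 0 - (\<Sum>j=1..trunc n. h n j) \<le>
    prof s P\<^sub>0 (k n) 1 + ptail s P\<^sub>0 (k n) (real (Suc (trunc n)))"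
    using b(2)[of 0 "trunc n"] by simp
  from mult_left_mono[OF this c] trunc(5)[OF n]
  show "C_seq \<sigma> n (\<rho> n) - (\<Sum>j=1..trunc n. u n j) \<le> u n 1 + 1 / real n"
    unfolding S C by (simp add: u_def algebra_simps)
qed

definition Z :: "nat \<Rightarrow> 'a \<Rightarrow> real" where
  "Z n \<omega> = (\<Sum>j=1..trunc n. u n j / sqrt (2 * A n) * ((\<xi> j \<omega>)\<^sup>2 - 1))"

lemma Z_measurable [measurable]: "Z n \<in> borel_measurable M"
proof -
  have [measurable]: "\<xi> j \<in> borel_measurable M" if "j \<in> {1..trunc n}" for j using that by simp
  show ?thesis unfolding Z_def by measurable
qed

abbreviation level :: "real \<Rightarrow> nat \<Rightarrow> real" where
  "level x n \<equiv> type_I M w \<sigma> n (L x n)"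

abbreviation risk :: "real \<Rightarrow> nat \<Rightarrow> real" where
  "risk x n \<equiv> type_II_sup M w \<sigma> n (L x n) (V n)"

abbreviation F :: "nat \<Rightarrow> real \<Rightarrow> real" where
  "F n x \<equiv> prob {\<omega> \<in> space M. Z n \<omega> \<le> x}"

lemma sqrt_A_lower: "\<forall>\<^sub>F n in sequentially. sqrt (2 * a\<^sub>0) \<le> sqrt (2 * A n)"
  using A_lower by eventually_elim simp

text \<open>Division by \<open>sqrt (2 * A n)\<close> makes the limit law independent of
  \<open>n\<close> even though \<open>A n\<close> may oscillate: the squared weights sum to
  \<open>1 / 2\<close> in the limit, and each term \<open>\<xi>\<^sup>2 - 1\<close> has variance
  2.\<close>

lemma Z_weak_conv: "weak_conv_m (\<lambda>n. distr M borel (Z n)) std_normal_distribution"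
proof -
  have "weak_conv_m (\<lambda>n. distr M borel (\<lambda>\<omega>. \<Sum>j=1..trunc n. u n j / sqrt (2 * A n) * ((\<xi> j \<omega>)\<^sup>2 - 1)))
     (distr std_normal_distribution borel (\<lambda>x. sqrt (2 * (1 / 2)) * x))"
  proof (rule chi_square_clt[OF xi_indep xi_distributed, where e="\<lambda>n. \<bar>u n 1 / sqrt (2 * A n)\<bar>"])
    fix n j assume j: "j \<in> {1..trunc n}"
    show "\<bar>u n j / sqrt (2 * A n)\<bar> \<le> \<bar>u n 1 / sqrt (2 * A n)\<bar>"
    proof (cases "n = 0")
      case True then show ?thesis by (simp add: u_def)
    next
      case False
      then have "u n j \<le> u n 1" using j by (intro u_antimono) auto
      then show ?thesis using u_nonneg[of n j] u_nonneg[of n 1] by (simp add: abs_divide divide_right_mono)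
    qed
  next
    have "\<forall>\<^sub>F n in sequentially. norm (\<bar>u n 1 / sqrt (2 * A n)\<bar>) \<le> u n 1 / sqrt (2 * a\<^sub>0)"
      using sqrt_A_lower
    proof eventually_elim
      case (elim n)
      moreover have "0 < sqrt (2 * a\<^sub>0)" using a0 by simp
      ultimately have "u n 1 / sqrt (2 * A n) \<le> u n 1 / sqrt (2 * a\<^sub>0)" "0 < sqrt (2 * A n)"
        using u_nonneg by (auto intro!: divide_left_mono mult_pos_pos)
      then show ?case using u_nonneg by simp
    qed
    moreover have "(\<lambda>n. u n 1 / sqrt (2 * a\<^sub>0)) \<longlonglongrightarrow> 0"
      using tendsto_divide[OF u_1_tendsto tendsto_const, of "sqrt (2 * a\<^sub>0)"] a0 by simp
    ultimately show "(\<lambda>n. \<bar>u n 1 / sqrt (2 * A n)\<bar>) \<longlonglongrightarrow> 0" by (rule Lim_null_comparison)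
  next
    have "\<forall>\<^sub>F n in sequentially. norm ((\<Sum>j=1..trunc n. (u n j / sqrt (2 * A n))\<^sup>2) - 1 / 2) \<le> (1 / real n) / (2 * a\<^sub>0)"
      using A_lower eventually_ge_at_top[of 1]
    proof eventually_elim
      case (elim n)
      have A: "A n > 0" using elim a0 by simp
      have "(\<Sum>j=1..trunc n. (u n j / sqrt (2 * A n))\<^sup>2) = (\<Sum>j=1..trunc n. (u n j)\<^sup>2) / (2 * A n)"
        using A by (simp add: power_divide sum_divide_distrib)
      then have "(\<Sum>j=1..trunc n. (u n j / sqrt (2 * A n))\<^sup>2) - 1 / 2 = - ((A n - (\<Sum>j=1..trunc n. (u n j)\<^sup>2)) / (2 * A n))"
        using A by (simp add: field_simps)
      moreover have "0 \<le> A n - (\<Sum>j=1..trunc n. (u n j)\<^sup>2)" using sum_u_sq_le elim by simp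
      moreover have "(A n - (\<Sum>j=1..trunc n. (u n j)\<^sup>2)) / (2 * A n) \<le> (1 / real n) / (2 * a\<^sub>0)"
        using trunc(4) elim a0 by (intro frac_le) auto
      ultimately show ?case using A by simp
    qed
    moreover have "(\<lambda>n. (1 / real n) / (2 * a\<^sub>0)) \<longlonglongrightarrow> 0 / (2 * a\<^sub>0)"
      using a0 by (intro tendsto_divide lim_1_over_n tendsto_const) simp
    then have "(\<lambda>n. (1 / real n) / (2 * a\<^sub>0)) \<longlonglongrightarrow> 0" by simp
    ultimately have "(\<lambda>n. (\<Sum>j=1..trunc n. (u n j / sqrt (2 * A n))\<^sup>2) - 1 / 2) \<longlonglongrightarrow> 0" by (rule Lim_null_comparison)
    then show "(\<lambda>n. \<Sum>j=1..trunc n. (u n j / sqrt (2 * A n))\<^sup>2) \<longlonglongrightarrow> 1 / 2" by (rule LIM_zero_cancel)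
  qed
  then show ?thesis by (simp add: Z_def[abs_def] distr_id2)
qed

lemma Z_cdf_tendsto:
  assumes "bounded (range z)"
  shows "(\<lambda>n. F n (z n) - std_normal_cdf (z n)) \<longlonglongrightarrow> 0"
proof -
  have "cdf (distr M borel (Z n)) (z n) = F n (z n)" for n
    unfolding cdf_def2 by (subst measure_distr) (auto intro!: arg_cong[where f=prob])
  then show ?thesis
    using cdf_moving_point[OF _ Z_weak_conv assms] by (simp add: real_distribution_distr)
qed

lemma sum_u_xi:
  assumes "A n > 0"
  shows "(\<Sum>j=1..trunc n. u n j * (\<xi> j \<omega>)\<^sup>2) = sqrt (2 * A n) * Z n \<omega> + (\<Sum>j=1..trunc n. u n j)"
proof -
  have "sqrt (2 * A n) * Z n \<omega> = (\<Sum>j=1..trunc n. u n j * ((\<xi> j \<omega>)\<^sup>2 - 1))"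
    unfolding Z_def sum_distrib_left using assms by (intro sum.cong) auto
  then show ?thesis by (simp add: sum_subtractf algebra_simps)
qed

lemma partial_le_series:
  assumes "n \<ge> 1" "f \<in> Ltwo"
  shows "AE \<omega> in M. (\<Sum>j=1..N. u n j * (\<xi> j \<omega> + \<tau> n f j)\<^sup>2) \<le>
    (\<Sum>j. u n (Suc j) * (\<xi> (Suc j) \<omega> + \<tau> n f (Suc j))\<^sup>2)"
  using T_stat_expansion[OF assms]
proof eventually_elim
  case (elim \<omega>)
  then show ?case unfolding One_nat_def sum.atLeast1_atMost_eq
    using u_nonneg by (intro sum_le_suminf) auto
qed

text \<open>The full statistic exceeds its truncation by a nonnegative remainder. Dropping the
  remainder gives the first bound; for the second it is taken to be below \<open>1 / n\<close>
  outside an event of probability at most \<open>1 / n\<close>.\<close>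

lemma type_I_L_bounds:
  assumes n: "n \<ge> 1" and kn: "k n \<ge> 1" and A: "A n > 0"
  defines "gap \<equiv> C_seq \<sigma> n (\<rho> n) - (\<Sum>j=1..trunc n. u n j)"
  shows "1 - level x n \<le> F n (x + gap / sqrt (2 * A n))"
    and "F n (x + (gap - 1 / real n) / sqrt (2 * A n)) - 1 / real n \<le> 1 - level x n"
proof -
  let ?D = "sqrt (2 * A n)" and ?N = "trunc n"
  have D: "?D > 0" using A by simp
  let ?T = "\<lambda>\<omega>. \<Sum>j. u n (Suc j) * (\<xi> (Suc j) \<omega>)\<^sup>2"
  let ?R = "\<lambda>\<omega>. \<Sum>j. u n (Suc (j + ?N)) * (\<xi> (Suc (j + ?N)) \<omega>)\<^sup>2"
  have \<tau>0: "\<tau> n (\<lambda>_. 0) j = 0" for j by (simp add: \<tau>_def)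
  have "1 - level x n = type_II M w \<sigma> n (L x n) (\<lambda>_. 0)"
    unfolding type_I_def type_II_def using integrable_test[OF is_test_L] by (simp add: prob_space)
  also have "\<dots> = prob {\<omega> \<in> space M. ?T \<omega> \<le> crit x n}"
    using type_II_L[OF n A Ltwo_0, of x] unfolding \<tau>0 by simp
  finally have eq: "1 - level x n = prob {\<omega> \<in> space M. ?T \<omega> \<le> crit x n}" .
  have crit: "crit x n = gap + (\<Sum>j=1..?N. u n j) + x * ?D" by (simp add: crit_def gap_def)
  have ae: "AE \<omega> in M. summable (\<lambda>j. u n (Suc j) * (\<xi> (Suc j) \<omega>)\<^sup>2)" by (rule u_xi_summable(1)[OF n])
  have split: "?T \<omega> = ?R \<omega> + (?D * Z n \<omega> + (\<Sum>j=1..?N. u n j))" and R0: "?R \<omega> \<ge> 0"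
    if "summable (\<lambda>j. u n (Suc j) * (\<xi> (Suc j) \<omega>)\<^sup>2)" for \<omega>
  proof -
    show "?T \<omega> = ?R \<omega> + (?D * Z n \<omega> + (\<Sum>j=1..?N. u n j))"
      using suminf_split_initial_segment[OF that, of ?N] sum_u_xi[OF A, of \<omega>] unfolding One_nat_def sum.atLeast1_atMost_eq by simp
    show "?R \<omega> \<ge> 0" using that u_nonneg
      by (intro suminf_nonneg) (auto simp: summable_iff_shift[of "\<lambda>j. u n (Suc j) * (\<xi> (Suc j) \<omega>)\<^sup>2" ?N])
  qed
  show "1 - level x n \<le> F n (x + gap / ?D)"
    unfolding eq
  proof (rule finite_measure_mono_AE)
    show "AE \<omega> in M. \<omega> \<in> {\<omega> \<in> space M. ?T \<omega> \<le> crit x n} \<longrightarrow> \<omega> \<in> {\<omega> \<in> space M. Z n \<omega> \<le> x + gap / ?D}"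
      using ae
    proof eventually_elim
      case (elim \<omega>)
      have "?D * Z n \<omega> \<le> ?D * (x + gap / ?D)" if "?T \<omega> \<le> crit x n"
        using that split[OF elim] R0[OF elim] D by (simp add: crit algebra_simps)
      then show ?case using D by simp
    qed
  qed simp
  let ?E = "{\<omega> \<in> space M. Z n \<omega> \<le> x + (gap - 1 / real n) / ?D}"
    and ?B = "{\<omega> \<in> space M. 1 / real n \<le> ?R \<omega>}"
  have "prob ?E \<le> prob ({\<omega> \<in> space M. ?T \<omega> \<le> crit x n} \<union> ?B)"
  proof (rule finite_measure_mono_AE)
    show "AE \<omega> in M. \<omega> \<in> ?E \<longrightarrow> \<omega> \<in> {\<omega> \<in> space M. ?T \<omega> \<le> crit x n} \<union> ?B"
      using ae
    proof eventually_elim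
      case (elim \<omega>)
      have "?T \<omega> \<le> crit x n" if "Z n \<omega> \<le> x + (gap - 1 / real n) / ?D" "?R \<omega> < 1 / real n"
      proof -
        have "?D * Z n \<omega> \<le> ?D * (x + (gap - 1 / real n) / ?D)" using that(1) D by (intro mult_left_mono) auto
        also have "\<dots> = x * ?D + (gap - 1 / real n)" using D by (simp only: distrib_left) (simp add: mult.commute)
        finally show ?thesis using split[OF elim] that(2) by (simp add: crit)
      qed
      then show ?case by force
    qed
  qed (measurable)
  also have "\<dots> \<le> prob {\<omega> \<in> space M. ?T \<omega> \<le> crit x n} + prob ?B"
    by (intro measure_Un_le) measurable
  also have "prob ?B \<le> (\<integral>\<omega>. ?R \<omega> \<partial>M) / (1 / real n)"
  proof (rule integral_Markov_inequality_measure[where A="{}"])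
    show "integrable M ?R" by (rule u_xi_summable(2)[OF n])
    show "AE \<omega> in M. 0 \<le> ?R \<omega>" using ae by eventually_elim (rule R0)
  qed (use n in auto)
  also have "(\<integral>\<omega>. ?R \<omega> \<partial>M) / (1 / real n) \<le> (1 / (real n)\<^sup>2) / (1 / real n)"
    unfolding u_xi_summable(3)[OF n] using trunc(3)[OF n] n by (intro divide_right_mono) auto
  also have "\<dots> = 1 / real n" using n by (simp add: power2_eq_square)
  finally show "prob ?E - 1 / real n \<le> 1 - level x n" unfolding eq by simp
qed

lemma type_I_L_tendsto: "(\<lambda>n. level x n) \<longlonglongrightarrow> 1 - std_normal_cdf x"
proof -
  define gap where "gap n = C_seq \<sigma> n (\<rho> n) - (\<Sum>j=1..trunc n. u n j)" for n
  define z\<^sub>1 z\<^sub>2 where "z\<^sub>1 n = x + (gap n - 1 / real n) / sqrt (2 * A n)" and "z\<^sub>2 n = x + gap n / sqrt (2 * A n)" for n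
  have good: "\<forall>\<^sub>F n in sequentially. n \<ge> 1 \<and> k n \<ge> 1 \<and> A n > 0 \<and> sqrt (2 * a\<^sub>0) \<le> sqrt (2 * A n)"
    using A_lower sqrt_A_lower eventually_k_ge[of 1] eventually_ge_at_top[of 1]
    by eventually_elim (use a0 in auto)
  have lim0: "(\<lambda>n. (u n 1 + 1 / real n) / sqrt (2 * a\<^sub>0)) \<longlonglongrightarrow> (0 + 0) / sqrt (2 * a\<^sub>0)"
    using a0 by (intro tendsto_intros u_1_tendsto lim_1_over_n) simp
  have bnd: "\<forall>\<^sub>F n in sequentially. norm (z\<^sub>1 n - x) \<le> (u n 1 + 1 / real n) / sqrt (2 * a\<^sub>0) \<and>
      norm (z\<^sub>2 n - x) \<le> (u n 1 + 1 / real n) / sqrt (2 * a\<^sub>0)"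
    using good
  proof eventually_elim
    case (elim n)
    then have gap: "0 \<le> gap n" "gap n \<le> u n 1 + 1 / real n" unfolding gap_def using centering_bounds by blast+
    have sa: "0 < sqrt (2 * a\<^sub>0)" using a0 by simp
    have n0: "0 \<le> 1 / real n" by simp
    have *: "\<bar>y / sqrt (2 * A n)\<bar> \<le> (u n 1 + 1 / real n) / sqrt (2 * a\<^sub>0)" if "\<bar>y\<bar> \<le> u n 1 + 1 / real n" for y
    proof -
      have "\<bar>y\<bar> / sqrt (2 * A n) \<le> (u n 1 + 1 / real n) / sqrt (2 * a\<^sub>0)"
        using that elim sa by (intro frac_le) auto
      then show ?thesis using elim by (simp add: abs_divide)
    qed
    have "\<bar>gap n - 1 / real n\<bar> \<le> u n 1 + 1 / real n" "\<bar>gap n\<bar> \<le> u n 1 + 1 / real n"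
      using gap n0 u_nonneg[of n 1] by linarith+
    then show ?case using *[of "gap n - 1 / real n"] *[of "gap n"] by (simp add: z\<^sub>1_def z\<^sub>2_def)
  qed
  have z1: "z\<^sub>1 \<longlonglongrightarrow> x"
  proof (rule LIM_zero_cancel, rule Lim_null_comparison)
    show "\<forall>\<^sub>F n in sequentially. norm (z\<^sub>1 n - x) \<le> (u n 1 + 1 / real n) / sqrt (2 * a\<^sub>0)"
      using bnd by eventually_elim blast
  qed (use lim0 in simp)
  have z2: "z\<^sub>2 \<longlonglongrightarrow> x"
  proof (rule LIM_zero_cancel, rule Lim_null_comparison)
    show "\<forall>\<^sub>F n in sequentially. norm (z\<^sub>2 n - x) \<le> (u n 1 + 1 / real n) / sqrt (2 * a\<^sub>0)"
      using bnd by eventually_elim blast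
  qed (use lim0 in simp)
  have cont: "isCont std_normal_cdf x" using isCont_std_normal_cdf[of x] by (simp add: std_normal_cdf_def)
  have lim: "(\<lambda>n. F n (z n)) \<longlonglongrightarrow> std_normal_cdf x" if "z \<longlonglongrightarrow> x" for z
  proof -
    have "bounded (range z)" using that by (rule convergent_imp_bounded)
    from tendsto_add[OF Z_cdf_tendsto[OF this] isCont_tendsto_compose[OF cont that]]
    show ?thesis by simp
  qed
  have "(\<lambda>n. 1 - level x n) \<longlonglongrightarrow> std_normal_cdf x"
  proof (rule tendsto_sandwich)
    show "\<forall>\<^sub>F n in sequentially. F n (z\<^sub>1 n) - 1 / real n \<le> 1 - level x n"
      using good by eventually_elim (unfold z\<^sub>1_def gap_def, rule type_I_L_bounds(2), auto)
    show "\<forall>\<^sub>F n in sequentially. 1 - level x n \<le> F n (z\<^sub>2 n)"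
      using good by eventually_elim (unfold z\<^sub>2_def gap_def, rule type_I_L_bounds(1), auto)
    show "(\<lambda>n. F n (z\<^sub>1 n) - 1 / real n) \<longlonglongrightarrow> std_normal_cdf x"
      using tendsto_diff[OF lim[OF z1] lim_1_over_n] by simp
    show "(\<lambda>n. F n (z\<^sub>2 n)) \<longlonglongrightarrow> std_normal_cdf x" by (rule lim[OF z2])
  qed
  from tendsto_diff[OF tendsto_const[of 1] this] show ?thesis by simp
qed

text \<open>The truncated statistic is its null version plus a linear term \<open>Lin\<close> plus
  the drift \<open>\<mu>\<close>. The variance of \<open>Lin\<close> is at most
  \<open>4 * u n 1 * \<mu>\<close>, so the deviation of \<open>Lin\<close> is compared with
  \<open>\<delta> * \<mu>\<close>; this relative scale keeps the estimate uniform over alternatives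
  with large drift.\<close>

lemma type_II_L_upper:
  assumes n: "n \<ge> 1" and kn: "k n \<ge> 1" and A: "A n > 0" and f: "f \<in> V n"
    and \<delta>: "0 < \<delta>" "\<delta> \<le> 1"
  defines "m \<equiv> A n - 1 / real n - (u n 1)\<^sup>2"
  assumes m: "m > 0"
  shows "type_II M w \<sigma> n (L x n) f \<le>
    F n ((u n 1 + 1 / real n + x * sqrt (2 * A n) - (1 - \<delta>) * m) / sqrt (2 * A n))
    + 4 * u n 1 / (\<delta>\<^sup>2 * m)"
proof -
  let ?D = "sqrt (2 * A n)" and ?N = "trunc n"
  have D: "?D > 0" using A by simp
  have fL: "f \<in> Ltwo" using f by (simp add: alternatives_def besov_ball_def)
  define \<mu> where "\<mu> = (\<Sum>j=1..?N. u n j * (\<tau> n f j)\<^sup>2)"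
  define a where "a j = 2 * (u n j * \<tau> n f j)" for j
  define Lin where "Lin \<omega> = (\<Sum>j=1..?N. a j * \<xi> j \<omega>)" for \<omega>
  have [measurable]: "\<xi> j \<in> borel_measurable M" if "j \<in> {1..?N}" for j using that by simp
  have [measurable]: "Lin \<in> borel_measurable M" unfolding Lin_def by measurable
  \<comment> \<open>From \<open>A n\<close> the bound \<open>m\<close> loses the truncation error
    and the single square missing in \<open>drift_lower\<close>, whose sum starts at 2. It does not
    depend on \<open>f\<close>.\<close>
  have \<mu>m: "m \<le> \<mu>"
  proof -
    have "(\<Sum>j=1..?N. (u n j)\<^sup>2) \<le> (\<Sum>j=1..Suc ?N. (u n j)\<^sup>2)" by simp
    also have "\<dots> = (u n 1)\<^sup>2 + (\<Sum>j=2..Suc ?N. (u n j)\<^sup>2)"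
      by (subst sum.atLeast_Suc_atMost) (simp_all add: numeral_2_eq_2)
    also have "\<dots> \<le> (u n 1)\<^sup>2 + \<mu>"
      unfolding \<mu>_def using drift_lower[OF n f trunc(1,2)[OF n]] by simp
    finally show ?thesis using trunc(4)[OF n] by (simp add: m_def)
  qed
  then have \<mu>0: "\<mu> > 0" using m by simp
  have iv: "indep_vars (\<lambda>_. borel) (\<lambda>j. \<xi> j) {1..?N}" by (rule indep_vars_subset[OF xi_indep]) auto
  have d: "distributed M lborel (\<xi> j) std_normal_density" if "j \<in> {1..?N}" for j
    using that by (intro xi_distributed) auto
  have mom: "integrable M (\<xi> j)" "integrable M (\<lambda>\<omega>. (\<xi> j \<omega>)\<^sup>2)" "expectation (\<xi> j) = 0"
    "(\<integral>\<omega>. (\<xi> j \<omega>)\<^sup>2 \<partial>M) = 1" if "j \<in> {1..?N}" for j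
    using std_normal_moment_integrable[OF d[OF that], of 1] std_normal_moment_integrable[OF d[OF that], of 2]
      std_normal_moments(1,2)[OF d[OF that]] by simp_all
  note L2 = expectation_sum_sq[OF iv finite_atLeastAtMost mom, of a]
  have "(\<integral>\<omega>. (Lin \<omega>)\<^sup>2 \<partial>M) = (\<Sum>j=1..?N. (a j)\<^sup>2)" unfolding Lin_def using L2(2) by simp
  also have "\<dots> \<le> (\<Sum>j=1..?N. 4 * u n 1 * (u n j * (\<tau> n f j)\<^sup>2))"
  proof (rule sum_mono)
    fix j assume "j \<in> {1..?N}"
    then have "u n j * (u n j * (\<tau> n f j)\<^sup>2) \<le> u n 1 * (u n j * (\<tau> n f j)\<^sup>2)"
      using u_antimono[OF n, of 1 j] u_nonneg[of n j] by (intro mult_right_mono) auto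
    then show "(a j)\<^sup>2 \<le> 4 * u n 1 * (u n j * (\<tau> n f j)\<^sup>2)"
      by (simp add: a_def power2_eq_square mult_ac)
  qed
  finally have VL: "(\<integral>\<omega>. (Lin \<omega>)\<^sup>2 \<partial>M) \<le> 4 * u n 1 * \<mu>" by (simp add: \<mu>_def sum_distrib_left)
  let ?B = "{\<omega> \<in> space M. (\<delta> * \<mu>)\<^sup>2 \<le> (Lin \<omega>)\<^sup>2}"
  have "prob ?B \<le> (\<integral>\<omega>. (Lin \<omega>)\<^sup>2 \<partial>M) / (\<delta> * \<mu>)\<^sup>2"
    using L2(1) \<delta> \<mu>0 by (intro integral_Markov_inequality_measure[where A="{}"]) (auto simp: Lin_def)
  also have "\<dots> \<le> (4 * u n 1 * \<mu>) / (\<delta> * \<mu>)\<^sup>2" using VL by (rule divide_right_mono) simp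
  also have "\<dots> = 4 * u n 1 / (\<delta>\<^sup>2 * \<mu>)" using \<mu>0 \<delta> by (simp add: power2_eq_square)
  also have "\<dots> \<le> 4 * u n 1 / (\<delta>\<^sup>2 * m)"
    using \<mu>m m \<mu>0 \<delta> u_nonneg[of n 1] by (intro divide_left_mono mult_left_mono mult_pos_pos) auto
  finally have B: "prob ?B \<le> 4 * u n 1 / (\<delta>\<^sup>2 * m)" .
  let ?z = "(u n 1 + 1 / real n + x * ?D - (1 - \<delta>) * m) / ?D"
  let ?E = "{\<omega> \<in> space M. Z n \<omega> \<le> ?z}"
  have "type_II M w \<sigma> n (L x n) f \<le> prob (?E \<union> ?B)"
    unfolding type_II_L[OF n A fL]
  proof (rule finite_measure_mono_AE)
    show "AE \<omega> in M. \<omega> \<in> {\<omega> \<in> space M. (\<Sum>j. u n (Suc j) * (\<xi> (Suc j) \<omega> + \<tau> n f (Suc j))\<^sup>2) \<le> crit x n}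
      \<longrightarrow> \<omega> \<in> ?E \<union> ?B"
      using partial_le_series[OF n fL, of ?N]
    proof eventually_elim
      case (elim \<omega>)
      have "Z n \<omega> \<le> ?z" if T: "(\<Sum>j. u n (Suc j) * (\<xi> (Suc j) \<omega> + \<tau> n f (Suc j))\<^sup>2) \<le> crit x n"
        and notB: "(Lin \<omega>)\<^sup>2 < (\<delta> * \<mu>)\<^sup>2"
      proof -
        have "\<bar>Lin \<omega>\<bar> < \<bar>\<delta> * \<mu>\<bar>" using notB abs_le_square_iff[of "\<delta> * \<mu>" "Lin \<omega>"] by linarith
        then have "- (\<delta> * \<mu>) \<le> Lin \<omega>" using \<delta> \<mu>0 by simp
        moreover have "(\<Sum>j=1..?N. u n j * (\<xi> j \<omega> + \<tau> n f j)\<^sup>2) =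
          (\<Sum>j=1..?N. u n j * (\<xi> j \<omega>)\<^sup>2) + Lin \<omega> + \<mu>"
          unfolding Lin_def \<mu>_def a_def sum.distrib[symmetric]
          by (intro sum.cong refl) (simp add: power2_eq_square algebra_simps)
        moreover have "(1 - \<delta>) * m \<le> (1 - \<delta>) * \<mu>" using \<mu>m \<delta> by (intro mult_left_mono) auto
        then have "(1 - \<delta>) * m \<le> \<mu> - \<delta> * \<mu>" by (simp add: left_diff_distrib)
        ultimately have "?D * Z n \<omega> \<le> u n 1 + 1 / real n + x * ?D - (1 - \<delta>) * m"
          using elim T centering_bounds(2)[OF n kn] sum_u_xi[OF A, of \<omega>] unfolding crit_def by linarith
        then show ?thesis using D by (simp add: pos_le_divide_eq mult.commute)
      qed
      then show ?case by force
    qed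
  qed measurable
  also have "\<dots> \<le> prob ?E + prob ?B" by (intro measure_Un_le) measurable
  finally show ?thesis using B by simp
qed

lemma type_II_sup_L_upper:
  assumes \<epsilon>: "\<epsilon> > 0"
  shows "\<forall>\<^sub>F n in sequentially. risk x n
    \<le> std_normal_cdf (x - sqrt (A n / 2)) + \<epsilon>"
proof -
  \<comment> \<open>The fourth root balances two demands: \<open>\<delta> n\<close> tends to 0, and
    so does the error term of order
    \<open>u n 1 / (\<delta> n)\<^sup>2 = sqrt (u n 1)\<close>.\<close>
  define \<delta> where "\<delta> n = sqrt (sqrt (u n 1))" for n
  define m where "m n = A n - 1 / real n - (u n 1)\<^sup>2" for n
  define y where "y n = x - sqrt (A n / 2)" for n
  define z where "z n = (u n 1 + 1 / real n + x * sqrt (2 * A n) - (1 - \<delta> n) * m n) / sqrt (2 * A n)" for n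
  have \<delta>lim: "\<delta> \<longlonglongrightarrow> 0"
    using tendsto_real_sqrt[OF tendsto_real_sqrt[OF u_1_tendsto]] by (simp add: \<delta>_def[abs_def])
  have rlim: "(\<lambda>n. 1 / real n + (u n 1)\<^sup>2) \<longlonglongrightarrow> 0"
    using tendsto_add[OF lim_1_over_n tendsto_power[OF u_1_tendsto, of 2]] by simp
  have r1: "\<forall>\<^sub>F n in sequentially. 1 / real n + (u n 1)\<^sup>2 < a\<^sub>0 / 2"
    using rlim a0 by (intro order_tendstoD(2)) auto
  have d1: "\<forall>\<^sub>F n in sequentially. \<delta> n < 1" using \<delta>lim by (rule order_tendstoD(2)) simp
  have good: "\<forall>\<^sub>F n in sequentially. n \<ge> 1 \<and> k n \<ge> 1 \<and> a\<^sub>0 \<le> A n \<and> A n \<le> b\<^sub>0 \<and> sqrt (2 * a\<^sub>0) \<le> sqrt (2 * A n) \<and>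
    a\<^sub>0 / 2 \<le> m n \<and> \<delta> n \<le> 1 \<and> V n \<noteq> {}"
    using A_lower A_upper sqrt_A_lower eventually_k_ge[of 1] eventually_ge_at_top[of 1]
      eventually_alternatives_nonempty r1 d1
    by eventually_elim (use a0 in \<open>auto simp: m_def\<close>)
  have upos: "u n 1 > 0" if "n \<ge> 1" for n
    using that sigma prof_pos[OF s P0 k_pos[OF that], of 1] by (simp add: u_def)
  have sa: "sqrt (2 * a\<^sub>0) > 0" using a0 by simp
  define bd where "bd n = u n 1 + 1 / real n + (1 / real n + (u n 1)\<^sup>2) + \<delta> n * b\<^sub>0" for n
  have "\<forall>\<^sub>F n in sequentially. norm (z n - y n) \<le> bd n / sqrt (2 * a\<^sub>0)"
    using good
  proof eventually_elim
    case (elim n)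
    define D where "D = sqrt (2 * A n)"
    have A: "A n > 0" using elim a0 by simp
    have D: "D > 0" using A by (simp add: D_def)
    have "D * sqrt (A n / 2) = A n" unfolding D_def using A by (simp flip: real_sqrt_mult)
    moreover have "D * z n = u n 1 + 1 / real n + x * D - (1 - \<delta> n) * m n"
      unfolding z_def D_def[symmetric] using D by (simp only: times_divide_eq_right nonzero_mult_div_cancel_left[OF less_imp_neq[OF D, symmetric]])
    ultimately have "D * (z n - y n) = u n 1 + 1 / real n + (A n - m n) + \<delta> n * m n"
      unfolding y_def by (simp add: right_diff_distrib left_diff_distrib mult.commute[of D x])
    then have e: "z n - y n = (u n 1 + 1 / real n + (A n - m n) + \<delta> n * m n) / D"
      using D by (simp add: nonzero_eq_divide_eq mult.commute)
    have m: "0 \<le> m n" "m n \<le> b\<^sub>0" 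
    proof -
      have "0 \<le> 1 / real n" "0 \<le> (u n 1)\<^sup>2" by simp_all
      then show "0 \<le> m n" "m n \<le> b\<^sub>0" using elim a0 unfolding m_def by linarith+
    qed
    have \<delta>0: "0 \<le> \<delta> n" using u_nonneg by (simp add: \<delta>_def)
    have Am: "A n - m n = 1 / real n + (u n 1)\<^sup>2" by (simp add: m_def)
    have num0: "0 \<le> u n 1 + 1 / real n + (A n - m n) + \<delta> n * m n"
      unfolding Am using u_nonneg[of n 1] \<delta>0 m by simp
    have "z n - y n \<le> bd n / sqrt (2 * a\<^sub>0)"
      unfolding e D_def
    proof (rule frac_le)
      show "u n 1 + 1 / real n + (A n - m n) + \<delta> n * m n \<le> bd n"
        unfolding Am bd_def using mult_left_mono[OF m(2) \<delta>0] by simp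
      then show "0 \<le> bd n" using num0 by linarith
    qed (use elim sa in auto)
    moreover have "0 \<le> z n - y n" unfolding e using num0 D by simp
    ultimately show ?case by simp
  qed
  moreover have "(\<lambda>n. bd n / sqrt (2 * a\<^sub>0)) \<longlonglongrightarrow> (0 + 0 + 0 + 0 * b\<^sub>0) / sqrt (2 * a\<^sub>0)"
    unfolding bd_def using sa by (intro tendsto_intros u_1_tendsto lim_1_over_n rlim \<delta>lim) simp
  then have "(\<lambda>n. bd n / sqrt (2 * a\<^sub>0)) \<longlonglongrightarrow> 0" by simp
  ultimately have zy: "(\<lambda>n. z n - y n) \<longlonglongrightarrow> 0" by (rule Lim_null_comparison)
  have "Bseq z"
  proof (rule BfunI)
    show "\<forall>\<^sub>F n in sequentially. norm (z n) \<le> \<bar>x\<bar> + sqrt (b\<^sub>0 / 2) + 1"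
      using good tendstoD[OF zy zero_less_one]
    proof eventually_elim
      case (elim n)
      have "0 \<le> sqrt (A n / 2)" "sqrt (A n / 2) \<le> sqrt (b\<^sub>0 / 2)" using elim a0 by auto
      moreover have "\<bar>z n - y n\<bar> < 1" using elim by (simp add: dist_real_def)
      ultimately show ?case unfolding y_def by (simp only: real_norm_def)
    qed
  qed
  then have zb: "bounded (range z)" by (simp add: Bseq_eq_bounded)
  have err: "(\<lambda>n. 4 * sqrt (u n 1) / (a\<^sub>0 / 2)) \<longlonglongrightarrow> 0"
  proof -
    have "(\<lambda>n. 4 * sqrt (u n 1) / (a\<^sub>0 / 2)) \<longlonglongrightarrow> 4 * sqrt 0 / (a\<^sub>0 / 2)"
      using a0 by (intro tendsto_intros u_1_tendsto) simp
    then show ?thesis by simp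
  qed
  have e3: "\<epsilon> / 3 > 0" using \<epsilon> by simp
  show ?thesis
    using good tendstoD[OF zy e3] tendstoD[OF Z_cdf_tendsto[OF zb] e3] tendstoD[OF err e3]
  proof eventually_elim
    case (elim n)
    have A: "A n > 0" using elim a0 by simp
    have m0: "m n > 0" using elim a0 by linarith
    have \<delta>0: "0 < \<delta> n" using upos[of n] elim by (simp add: \<delta>_def)
    have d2: "(\<delta> n)\<^sup>2 = sqrt (u n 1)" using u_nonneg by (simp add: \<delta>_def)
    have q: "4 * u n 1 / ((\<delta> n)\<^sup>2 * m n) \<le> 4 * sqrt (u n 1) / (a\<^sub>0 / 2)"
    proof -
      have "u n 1 = sqrt (u n 1) * sqrt (u n 1)" using u_nonneg by simp
      then have "4 * u n 1 / ((\<delta> n)\<^sup>2 * m n) = 4 * sqrt (u n 1) / m n"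
        unfolding d2 using upos[of n] elim m0 by (simp add: field_simps)
      also have "\<dots> \<le> 4 * sqrt (u n 1) / (a\<^sub>0 / 2)"
        using elim a0 m0 u_nonneg[of n 1] by (intro divide_left_mono mult_pos_pos) auto
      finally show ?thesis .
    qed
    have "risk x n
      \<le> F n (z n) + 4 * u n 1 / ((\<delta> n)\<^sup>2 * m n)"
      unfolding type_II_sup_def z_def m_def
    proof (rule cSUP_least)
      show "V n \<noteq> {}" using elim by blast
      fix f assume "f \<in> V n"
      then show "type_II M w \<sigma> n (L x n) f \<le> F n ((u n 1 + 1 / real n + x * sqrt (2 * A n) - (1 - \<delta> n) * (A n - 1 / real n - (u n 1)\<^sup>2)) / sqrt (2 * A n))
        + 4 * u n 1 / ((\<delta> n)\<^sup>2 * (A n - 1 / real n - (u n 1)\<^sup>2))"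
        using elim A \<delta>0 m0 by (intro type_II_L_upper) (auto simp: m_def)
    qed
    moreover have "std_normal_cdf (z n) - std_normal_cdf (y n) \<le> \<bar>z n - y n\<bar>"
      using abs_std_normal_cdf_diff_le[of "z n" "y n"] by linarith
    moreover have "\<bar>F n (z n) - std_normal_cdf (z n)\<bar> < \<epsilon> / 3" "\<bar>z n - y n\<bar> < \<epsilon> / 3"
      "4 * sqrt (u n 1) / (a\<^sub>0 / 2) < \<epsilon> / 3"
      using elim(2-4) unfolding dist_real_def by linarith+
    ultimately show ?case using q unfolding y_def by linarith
  qed
qed

text \<open>The general lower bound is applied to the tests themselves, with the deviation of their
  level from its limit as slack.\<close>

lemma type_II_sup_L_lower:
  assumes \<epsilon>: "\<epsilon> > 0"
  shows "\<forall>\<^sub>F n in sequentially. std_normal_cdf (x - sqrt (A n / 2)) - \<epsilon>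
    \<le> risk x n"
proof (rule type_II_sup_lower[OF is_test_L _ _ \<epsilon>])
  show "level x n \<le> 1 - std_normal_cdf x + (level x n - (1 - std_normal_cdf x))" for n
    by simp
  show "(\<lambda>n. level x n - (1 - std_normal_cdf x)) \<longlonglongrightarrow> 0"
    using type_I_L_tendsto by (rule LIM_zero)
qed

lemma type_I_L_equiv:
  assumes "std_normal_cdf x < 1"
  shows "(\<lambda>n. level x n) \<sim>[sequentially] (\<lambda>_. 1 - std_normal_cdf x)"
  using assms type_I_L_tendsto by (intro tendsto_imp_asymp_equiv_const) auto

text \<open>As \<open>A n\<close> is eventually at most \<open>b\<^sub>0\<close>, the target is
  bounded below by a positive constant, so additive accuracy implies relative accuracy.\<close>

lemma type_II_sup_L_equiv:
  "(\<lambda>n. risk x n) \<sim>[sequentially]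
    (\<lambda>n. std_normal_cdf (x - sqrt (A n / 2)))"
proof (rule asymp_equivI')
  let ?g = "\<lambda>n. std_normal_cdf (x - sqrt (A n / 2))"
  define g\<^sub>0 where "g\<^sub>0 = std_normal_cdf (x - sqrt (b\<^sub>0 / 2))"
  have g0: "g\<^sub>0 > 0" unfolding g\<^sub>0_def by (rule std_normal_cdf_pos)
  have g: "\<forall>\<^sub>F n in sequentially. g\<^sub>0 \<le> ?g n"
    using A_upper by eventually_elim (auto simp: g\<^sub>0_def intro!: std_normal_cdf_mono)
  show "(\<lambda>n. risk x n / ?g n) \<longlonglongrightarrow> 1"
  proof (rule tendstoI)
    fix e :: real assume e: "e > 0"
    have e': "e * g\<^sub>0 / 2 > 0" using e g0 by simp
    show "\<forall>\<^sub>F n in sequentially. dist (risk x n / ?g n) 1 < e"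
      using g type_II_sup_L_upper[OF e', of x] type_II_sup_L_lower[OF e', of x]
    proof eventually_elim
      case (elim n)
      have gp: "?g n > 0" using elim g0 by linarith
      have "\<bar>risk x n - ?g n\<bar> \<le> e * g\<^sub>0 / 2" using elim by linarith
      also have "\<dots> < e * g\<^sub>0" using e g0 by simp
      also have "\<dots> \<le> e * ?g n" using elim e by (intro mult_left_mono) auto
      finally have "\<bar>risk x n - ?g n\<bar> / ?g n < e" using gp by (simp add: pos_divide_less_eq)
      moreover have "risk x n / ?g n - 1 = (risk x n - ?g n) / ?g n" using gp by (simp add: diff_divide_distrib)
      ultimately show ?case using gp by (simp add: dist_real_def abs_divide)
    qed
  qed
qed

text \<open>The lower bound for arbitrary tests and the upper bound for \<open>L\<close> have the
  same main term. The term, which need not converge, cancels in the difference.\<close>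

lemma asymptotically_minimax_L:
  assumes "std_normal_cdf x < 1"
  shows "asymptotically_minimax M w \<sigma> (1 - std_normal_cdf x) (V) (L x)"
  unfolding asymptotically_minimax_def
proof (intro conjI allI impI)
  show "is_test (L x n)" for n by (rule is_test_L)
  show "(\<lambda>n. level x n) \<sim>[sequentially] (\<lambda>_. 1 - std_normal_cdf x)"
    by (rule type_I_L_equiv[OF assms])
  fix K :: "nat \<Rightarrow> observation \<Rightarrow> real"
  assume K: "\<forall>n\<ge>1. is_test (K n) \<and> type_I M w \<sigma> n (K n) \<le> 1 - std_normal_cdf x"
  show "0 \<le> liminf (\<lambda>n. ereal (type_II_sup M w \<sigma> n (K n) (V n) -
      risk x n))"
    unfolding le_Liminf_iff
  proof (intro allI impI)
    fix c :: ereal assume "c < 0"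
    then obtain d where d: "c < ereal d" "ereal d < 0" using ereal_dense2 by blast
    then have e: "- d / 2 > 0" by simp
    have "\<forall>\<^sub>F n in sequentially. std_normal_cdf (x - sqrt (A n / 2)) - (- d / 2)
      \<le> type_II_sup M w \<sigma> n (K n) (V n)"
      by (rule type_II_sup_lower[where \<eta>="\<lambda>_. 0", OF _ _ _ e]) (use K in auto)
    with type_II_sup_L_upper[OF e, of x]
    show "\<forall>\<^sub>F n in sequentially. c < ereal (type_II_sup M w \<sigma> n (K n) (V n) -
      risk x n)"
    proof eventually_elim
      case (elim n)
      then have "d \<le> type_II_sup M w \<sigma> n (K n) (V n) -
        risk x n" by linarith
      then show ?case using d(1) by (meson ereal_less_eq(3) less_le_trans)
    qed
  qed
qed

end

section \<open>Return to the sequences given by the defining equations\<close>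

lemma asymptotically_minimax_cong:
  assumes L: "\<And>n. n \<ge> 1 \<Longrightarrow> L n = L' n" and min: "asymptotically_minimax M w \<sigma> \<alpha> V L'"
  shows "asymptotically_minimax M w \<sigma> \<alpha> V L"
proof -
  have ev: "\<forall>\<^sub>F n in sequentially. L n = L' n"
    using eventually_ge_at_top[of 1] by eventually_elim (rule L)
  have "(\<lambda>n. type_I M w \<sigma> n (L n)) \<sim>[sequentially] (\<lambda>_. \<alpha>)"
  proof (rule asymp_equiv_trans[OF asymp_equiv_refl_ev])
    show "\<forall>\<^sub>F n in sequentially. type_I M w \<sigma> n (L n) = type_I M w \<sigma> n (L' n)"
      using ev by eventually_elim simp
    show "(\<lambda>n. type_I M w \<sigma> n (L' n)) \<sim>[sequentially] (\<lambda>_. \<alpha>)"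
      using min by (simp add: asymptotically_minimax_def)
  qed
  moreover have "liminf (\<lambda>n. ereal (type_II_sup M w \<sigma> n (K n) (V n) - type_II_sup M w \<sigma> n (L n) (V n))) =
    liminf (\<lambda>n. ereal (type_II_sup M w \<sigma> n (K n) (V n) - type_II_sup M w \<sigma> n (L' n) (V n)))" for K
    by (rule Liminf_eq) (use ev in \<open>eventually_elim, simp\<close>)
  ultimately show ?thesis using min L unfolding asymptotically_minimax_def by simp
qed

text \<open>The order condition forces \<open>\<rho>\<close> to 0, and \<open>\<rho>\<close> is a
  positive constant times a negative power of the cut-off.\<close>

lemma cutoff_tendsto_infinity:
  assumes s: "s > 0" and P0: "P\<^sub>0 > 0"
    and rho: "same_order \<rho> (\<lambda>n. real n powr (- (4 * s) / (1 + 4 * s)))"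
    and k_pos: "\<And>n. n \<ge> 1 \<Longrightarrow> k n > 0"
    and rho_eq: "\<And>n. n \<ge> 1 \<Longrightarrow> \<rho> n = (1 + 2 * s) * P\<^sub>0 * k n powr (- 2 * s)"
  shows "filterlim k at_top sequentially"
  unfolding filterlim_at_top_gt[where c=0]
proof (intro allI impI)
  fix c :: real assume c: "c > 0"
  obtain a b where a: "0 < a" and ab: "\<And>n. n \<ge> 1 \<Longrightarrow> a * \<rho> n \<le> real n powr (- (4 * s) / (1 + 4 * s))"
    using rho by (auto simp: same_order_def)
  have "- (4 * s) / (1 + 4 * s) < 0" using s by (simp add: divide_neg_pos)
  then have "(\<lambda>n. real n powr (- (4 * s) / (1 + 4 * s))) \<longlonglongrightarrow> 0"
    by (rule tendsto_neg_powr[OF _ filterlim_real_sequentially])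
  then have "\<forall>\<^sub>F n in sequentially. real n powr (- (4 * s) / (1 + 4 * s)) < a * ((1 + 2 * s) * P\<^sub>0 * c powr (- 2 * s))"
    using a s P0 c by (intro order_tendstoD(2)) auto
  then show "\<forall>\<^sub>F n in sequentially. c \<le> k n"
    using eventually_ge_at_top[of 1]
  proof eventually_elim
    case (elim n)
    have "a * \<rho> n < a * ((1 + 2 * s) * P\<^sub>0 * c powr (- 2 * s))" using ab[of n] elim by linarith
    then have "k n powr (- 2 * s) < c powr (- 2 * s)" using a s P0 rho_eq[of n] elim by simp
    then show ?case using powr_mono2'[of "- 2 * s" "k n" c] s k_pos[of n] elim by force
  qed
qed

theorem theorem8p1:
  fixes M :: "'w measure" and w :: "(real \<Rightarrow> real) \<Rightarrow> 'w \<Rightarrow> real"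
    and \<phi> :: "nat \<Rightarrow> real \<Rightarrow> real"
    and \<sigma> s P\<^sub>0 \<alpha> x\<^sub>\<alpha> :: real
    and \<rho> k \<kappa> :: "nat \<Rightarrow> real"
    and ksq :: "nat \<Rightarrow> nat \<Rightarrow> real" and A :: "nat \<Rightarrow> real"
    and V :: "nat \<Rightarrow> (real \<Rightarrow> real) set" and L :: "nat \<Rightarrow> observation \<Rightarrow> real"
  assumes noise: "white_noise M w" and sigma: "\<sigma> > 0"
    and basis: "orthonormal_basis \<phi>"
    and s: "s > 0" and P0: "P\<^sub>0 > 0"
    and rho: "same_order \<rho> (\<lambda>n. real n powr (- (4 * s) / (1 + 4 * s)))"
    and alpha: "0 < \<alpha>" "\<alpha> < 1" and x_alpha: "\<alpha> = 1 - std_normal_cdf x\<^sub>\<alpha>"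
    and k_pos: "\<And>n. n \<ge> 1 \<Longrightarrow> k n > 0"
    and eq1: "\<And>n. n \<ge> 1 \<Longrightarrow> 1 / (2 * s) * k n powr (1 + 2 * s) * (\<kappa> n)\<^sup>2 = P\<^sub>0"
    and eq2: "\<And>n. n \<ge> 1 \<Longrightarrow> k n * (\<kappa> n)\<^sup>2 + k n powr (- 2 * s) * P\<^sub>0 = \<rho> n"
    and ksq_eq: "\<And>n. ksq n = kappa_sq s P\<^sub>0 (k n) ((\<kappa> n)\<^sup>2)"
    and A_eq: "\<And>n. A n = A_seq \<sigma> n (ksq n)"
    and V_eq: "\<And>n. V n = alternatives \<phi> s P\<^sub>0 \<rho> n"
    and L_eq: "\<And>n. L n = region_test \<phi> (critical_region \<sigma> n (ksq n) (\<rho> n) x\<^sub>\<alpha>)"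
    and A_bounds: "0 < liminf (\<lambda>n. ereal (A n))"
      "liminf (\<lambda>n. ereal (A n)) \<le> limsup (\<lambda>n. ereal (A n))"
      "limsup (\<lambda>n. ereal (A n)) < \<infinity>"
  shows "asymptotically_minimax M w \<sigma> \<alpha> V L \<and>
         (\<lambda>n. type_I M w \<sigma> n (L n)) \<sim>[sequentially] (\<lambda>_. \<alpha>) \<and>
         (\<lambda>n. type_II_sup M w \<sigma> n (L n) (V n)) \<sim>[sequentially]
           (\<lambda>n. std_normal_cdf (x\<^sub>\<alpha> - sqrt (A n / 2)))"
proof -
  note pe = prof_eq_of_eqs[OF s k_pos eq1 eq2]
  have ksq: "ksq n = (\<lambda>j. prof s P\<^sub>0 (k n) (real j))" if "n \<ge> 1" for n
    unfolding ksq_eq pe(1)[OF that that that] using kappa_sq_eq_prof by blast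
  have rho_eq: "\<rho> n = (1 + 2 * s) * P\<^sub>0 * k n powr (- 2 * s)" if "n \<ge> 1" for n
    using pe(3)[OF that that that] .
  obtain a\<^sub>0 where a0: "0 < ereal a\<^sub>0" "ereal a\<^sub>0 < liminf (\<lambda>n. ereal (A n))"
    using ereal_dense2[OF A_bounds(1)] by blast
  obtain b\<^sub>0 where b0: "limsup (\<lambda>n. ereal (A n)) < ereal b\<^sub>0"
    using ereal_dense2[OF A_bounds(3)] by blast
  have Al: "\<forall>\<^sub>F n in sequentially. a\<^sub>0 \<le> A n"
    using less_LiminfD[OF a0(2)] by eventually_elim simp
  have Au: "\<forall>\<^sub>F n in sequentially. A n \<le> b\<^sub>0"
    using Limsup_lessD[OF b0] by eventually_elim simp
  interpret T: gauss_besov_test M w \<phi> \<sigma> s P\<^sub>0 \<rho> k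
    "\<lambda>n j. real n / \<sigma>\<^sup>2 * prof s P\<^sub>0 (k n) (real j)" A a\<^sub>0 b\<^sub>0
  proof unfold_locales
    show "filterlim k at_top sequentially" by (rule cutoff_tendsto_infinity[OF s P0 rho k_pos rho_eq])
    show "A n = A_seq \<sigma> n (\<lambda>j. prof s P\<^sub>0 (k n) (real j))" if "n \<ge> 1" for n
      unfolding A_eq ksq[OF that] ..
    show "a\<^sub>0 > 0" using a0(1) by simp
  qed (use noise basis sigma s P0 k_pos rho_eq Al Au in auto)
  have x1: "std_normal_cdf x\<^sub>\<alpha> < 1" using alpha x_alpha by simp
  have V: "V = alternatives \<phi> s P\<^sub>0 \<rho>" using V_eq by blast
  \<comment> \<open>The equations for the cut-off and the level are given for
    \<open>n \<ge> 1\<close>, so the weights agree with the continuous profile from there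
    on.\<close>
  have L: "L n = T.L x\<^sub>\<alpha> n" if "n \<ge> 1" for n unfolding L_eq T.L_def ksq[OF that] ..
  have Lev: "\<forall>\<^sub>F n in sequentially. L n = T.L x\<^sub>\<alpha> n"
    using eventually_ge_at_top[of 1] by eventually_elim (rule L)
  have minimax: "asymptotically_minimax M w \<sigma> \<alpha> V L"
    using T.asymptotically_minimax_L[OF x1] unfolding V x_alpha
    by (rule asymptotically_minimax_cong[rotated]) (rule L)
  moreover have "(\<lambda>n. type_II_sup M w \<sigma> n (L n) (V n)) \<sim>[sequentially] (\<lambda>n. std_normal_cdf (x\<^sub>\<alpha> - sqrt (A n / 2)))"
  proof (rule asymp_equiv_trans[OF asymp_equiv_refl_ev T.type_II_sup_L_equiv])
    show "\<forall>\<^sub>F n in sequentially. type_II_sup M w \<sigma> n (L n) (V n) =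
      type_II_sup M w \<sigma> n (T.L x\<^sub>\<alpha> n) (alternatives \<phi> s P\<^sub>0 \<rho> n)"
      using Lev by eventually_elim (simp add: V)
  qed
  ultimately show ?thesis by (simp add: asymptotically_minimax_def)
qed

end
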